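(* In the online resource allocation problem described in the context, with rewards and sizes as described there, suppose the regularity assumption on the distribution functions $F_i$ holds. Then the adaptive threshold policy $\text{ATP}_1$ satisfies $$\text{Regret}(\text{ATP}_1)\le \sum_{i=1}^{n}\sum_{j=1}^{m}r_{ii_j}\,[(j+1)M-j]\,(\log T+1)+\sum_{i=1}^{n}r^i_{\max}\cdot K_i=O(nm^2\log T).$$
   Context: **Problem.** There are $m$ resources with initial capacities $c_1,\dots,c_m$ and $T$ periods. In period $t$ one request arrives with a nonnegative reward vector $\mathbf r^t=(r^t_1,\dots,r^t_m)$ and a positive size vector $\mathbf d^t=(d^t_1,\dots,d^t_m)$; the pairs $(\mathbf r^t,\mathbf d^t)$, $t=1,\dots,T$, are drawn independently from a known distribution that does not depend on $t$. After seeing $(\mathbf r^t,\mathbf d^t)$ the decision maker irrevocably rejects the request or serves it with one resource $j$, which consumes $d^t_j$ units of resource $j$ and yields reward $r^t_j$. A feasible policy $\pi$ chooses $x^\pi_j(t)\in\{0,1\}$ depending only on the requests $1,\dots,t$, with $\sum_t d^t_jx^\pi_j(t)\le c_j$ for all $j$ and $\sum_j x^\pi_j(t)\le 1$ for all $t$. With $\mathbf I=\{(\mathbf r^t,\mathbf d^t)\}_{t=1}^T$, put $V^\pi(\mathbf I)=\sum_{t}\sum_j r^t_jx^\pi_j(t)$. The prophet value is $V^{\text{off}}(\mathbf I)=\max\sum_t\sum_j r^t_jx^t_j$ over $x^t_j\in\{0,1\}$ with $\sum_t d^t_jx^t_j\le c_j$ for all $j$ and $\sum_jx^t_j\le1$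 for all $t$. $\text{Regret}(\pi)=\mathbb E[V^{\text{off}}(\mathbf I)]-\mathbb E[V^\pi(\mathbf I)]$. **Rewards and sizes.** $\mathbf r^t$ takes values in a finite set $\{\mathbf r_1,\dots,\mathbf r_n\}$, $\mathbf r_i=(r_{i1},\dots,r_{im})$, and equals $\mathbf r_i$ with probability $p_i$. Given $\mathbf r^t=\mathbf r_i$, $\mathbf d^t=\mathbf b_i\cdot u^t_i$, where $\mathbf b_i=(b_{i1},\dots,b_{im})$ is a deterministic positive vector and $u_i^t$ is a one-dimensional random variable with distribution function $F_i$. $\mathbb E_i$ denotes expectation over $u_i\sim F_i$. **Regularity assumption on $F_i$.** For some $\bar\omega>0$ and for all $i$, $F_i$ has a continuous density $f_i$ and: (1) there exist a constant $0<\lambda<1$ and two constants $1<\gamma_1<\gamma_2$ such that $\gamma_1F_i(\lambda w)\le F_i(w)\le\gamma_2F_i(\lambda w)$ for all $w\in(0,\bar\omega)$; (2) $w\mapsto w^3f_i(w)$ is non-decreasing on $(0,\bar\omega)$. **Sub-LPs and thresholds.** For $\tilde{\mathbf c}_i=(\tilde c_{i1},\dots,\tilde c_{im})$ let $G_i(\tilde{\mathbf c}_i,t)$ be the maximum of $(T-t+1)p_i\,\mathbb E_i[\sum_{j}r_{ij}x_{ij}(u_i)]$ over functions $x_{ij}$ with $0\le x_{ij}(u_i)\le1$ and $\sum_jx_{ij}(u_i)\le1$ for all $u_i$, and $(T-t+1)p_ib_{ij}\mathbb E_i[u_ix_{ij}(u_i)]\le\tilde c_{ij}$ for all $j$. Let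 $\{\mathbf c^*_i\}$, $\mathbf c^*_i=(c^*_{i1},\dots,c^*_{im})$, be the optimal solution of $$\max\ \sum_{i=1}^nG_i(\tilde{\mathbf c}_i,1)\quad\text{s.t.}\quad\sum_{i=1}^n\tilde c_{ij}\le c_j\ \forall j,\qquad \tilde c_{ij}\ge0\ \forall i,j.$$ For each $i$ let $i_1,\dots,i_m$ be a permutation of $1,\dots,m$ with $r_{ii_1}\ge\dots\ge r_{ii_m}\ge0$. The threshold $\mu^{ii_j}_t(\tilde{\mathbf c}_i)$ is the solution of $p_i\int_0^{\mu^{ii_j}_t(\tilde{\mathbf c}_i)}u\,dF_i(u)=\frac{1}{T-t+1}\sum_{k=1}^{j}\tilde c_{ii_k}/b_{ii_k}$, and $\mu^{ii_j}_t(\tilde{\mathbf c}_i)=\infty$ if there is no solution. **Policy $\text{ATP}_1$.** Set $\mathbf c^1_i=\mathbf c^*_i$ for all $i$. In period $t$, when the request is revealed as $(\mathbf r_i,\mathbf b_i u^t_i)$, compute $h^{ii_j}_t(\mathbf c^t_i)=\min\{c^t_{ii_j}/b_{ii_j},\ \mu^{ii_j}_t(\mathbf c^t_i)\}$ for all $j$. If $u^t_i>h^{ii_j}_t(\mathbf c^t_i)$ for all $j$, reject and set $c^{t+1}_{i'j'}=c^t_{i'j'}$ for all $i',j'$. Otherwise serve the request with resource $i_j$ for the smallest $j$ with $u^t_i\le h^{ii_j}_t(\mathbf c^t_i)$, set $c^{t+1}_{ii_j}=c^t_{ii_j}-b_{ii_j}u^t_i$, and leave all other $c_{i'j'}$ unchanged.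 **Constants.** $M>1$ is the constant, existing under condition (1), such that $\frac{w_2(F_i(w_2)-F_i(w_1))}{\int_{w_1}^{w_2}w\,dF_i(w)}\le M$ for all $i$ and all $0<w_1<w_2<\bar\omega$. $r^i_{\max}=\max\{r_{i1},\dots,r_{im}\}$ and $$K_i=\left\lceil\frac{\sum_{j=1}^mc^*_{ii_j}/b_{ii_j}}{p_i\int_0^{\bar\omega}w\,dF_i(w)}\right\rceil.$$ *)

theory Defs
  imports "HOL-Probability.Probability"
begin

text \<open>
  All index sets are 1-based intervals: types \<open>{1..num_types I}\<close>, resources \<open>{1..num_res I}\<close>,
  periods \<open>{1..horizon I}\<close>.  A request is a pair \<open>(i, u)\<close> of a type and a scalar size; it stands
  for the reward vector \<open>(rew I i j)\<^sub>j\<close> and the size vector \<open>(coef I i j * u)\<^sub>j\<close>.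
  The law of the scalar size of a type \<open>i\<close> request is \<open>size_law I i\<close>; its distribution function
  \<open>F\<^sub>i\<close> is \<open>cdf (size_law I i)\<close>.
\<close>

record alloc_instance =
  num_types :: nat
  num_res :: nat
  horizon :: nat
  cap :: "nat \<Rightarrow> real"
  rew :: "nat \<Rightarrow> nat \<Rightarrow> real"
  coef :: "nat \<Rightarrow> nat \<Rightarrow> real"
  type_pmf :: "nat pmf"
  size_law :: "nat \<Rightarrow> real measure"

type_synonym request = "nat \<times> real"

abbreviation types :: "alloc_instance \<Rightarrow> nat set" where
  "types I \<equiv> {1..num_types I}"

abbreviation resources :: "alloc_instance \<Rightarrow> nat set" where
  "resources I \<equiv> {1..num_res I}"

abbreviation periods :: "alloc_instance \<Rightarrow> nat set" where
  "periods I \<equiv> {1..horizon I}"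

abbreviation type_prob :: "alloc_instance \<Rightarrow> nat \<Rightarrow> real" where
  "type_prob I i \<equiv> pmf (type_pmf I) i"

abbreviation size_cdf :: "alloc_instance \<Rightarrow> nat \<Rightarrow> real \<Rightarrow> real" where
  "size_cdf I i \<equiv> cdf (size_law I i)"

text \<open>
  \<open>size_law I i\<close> is a probability law also for the unused indices \<open>i\<close>, so that \<open>size_law I\<close> is a
  kernel on all of \<^typ>\<open>nat\<close>.
\<close>

definition valid_instance :: "alloc_instance \<Rightarrow> bool" where
  "valid_instance I \<longleftrightarrow>
     1 \<le> num_res I \<and> 1 \<le> horizon I \<and>
     (\<forall>j\<in>resources I. 0 \<le> cap I j) \<and>
     (\<forall>i\<in>types I. \<forall>j\<in>resources I. 0 \<le> rew I i j \<and> 0 < coef I i j) \<and>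
     set_pmf (type_pmf I) = types I \<and>
     (\<forall>i. prob_space (size_law I i) \<and> sets (size_law I i) = sets borel) \<and>
     (\<forall>i\<in>types I. AE u in size_law I i. 0 < u)"

definition request_law :: "alloc_instance \<Rightarrow> request measure" where
  "request_law I = measure_pmf (type_pmf I) \<bind>
     (\<lambda>i. distr (size_law I i) (count_space UNIV \<Otimes>\<^sub>M borel) (Pair i))"

definition sample_space :: "alloc_instance \<Rightarrow> (nat \<Rightarrow> request) measure" where
  "sample_space I = (\<Pi>\<^sub>M t\<in>periods I. request_law I)"

definition feasible_alloc ::
    "alloc_instance \<Rightarrow> (nat \<Rightarrow> request) \<Rightarrow> (nat \<Rightarrow> nat \<Rightarrow> real) \<Rightarrow> bool" where
  "feasible_alloc I \<omega> x \<longleftrightarrow>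
     (\<forall>t\<in>periods I. \<forall>j\<in>resources I. x t j \<in> {0, 1}) \<and>
     (\<forall>j\<in>resources I. (\<Sum>t\<in>periods I. coef I (fst (\<omega> t)) j * snd (\<omega> t) * x t j) \<le> cap I j) \<and>
     (\<forall>t\<in>periods I. (\<Sum>j\<in>resources I. x t j) \<le> 1)"

definition alloc_value ::
    "alloc_instance \<Rightarrow> (nat \<Rightarrow> request) \<Rightarrow> (nat \<Rightarrow> nat \<Rightarrow> real) \<Rightarrow> real" where
  "alloc_value I \<omega> x = (\<Sum>t\<in>periods I. \<Sum>j\<in>resources I. rew I (fst (\<omega> t)) j * x t j)"

text \<open>The set of values is finite because each entry is 0 or 1.\<close>

definition prophet_value :: "alloc_instance \<Rightarrow> (nat \<Rightarrow> request) \<Rightarrow> real" where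
  "prophet_value I \<omega> = Max {alloc_value I \<omega> x | x. feasible_alloc I \<omega> x}"

text \<open>A policy maps the request sequence to an allocation, \<open>x \<omega> t j\<close> being its decision.\<close>

type_synonym policy = "(nat \<Rightarrow> request) \<Rightarrow> nat \<Rightarrow> nat \<Rightarrow> real"

definition feasible_policy :: "alloc_instance \<Rightarrow> policy \<Rightarrow> bool" where
  "feasible_policy I x \<longleftrightarrow>
     (\<forall>t\<in>periods I. \<forall>\<omega> \<omega>'. (\<forall>s\<in>{1..t}. \<omega> s = \<omega>' s) \<longrightarrow>
        (\<forall>j\<in>resources I. x \<omega> t j = x \<omega>' t j)) \<and>
     (\<forall>\<omega>. (\<forall>t\<in>periods I. fst (\<omega> t) \<in> types I \<and> 0 < snd (\<omega> t)) \<longrightarrow> feasible_alloc I \<omega> (x \<omega>))"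

definition regret :: "alloc_instance \<Rightarrow> policy \<Rightarrow> real" where
  "regret I x = (\<integral>\<omega>. prophet_value I \<omega> \<partial>sample_space I)
              - (\<integral>\<omega>. alloc_value I \<omega> (x \<omega>) \<partial>sample_space I)"

definition partial_mean :: "alloc_instance \<Rightarrow> nat \<Rightarrow> real \<Rightarrow> real \<Rightarrow> real" where
  "partial_mean I i w1 w2 = (LINT u:{w1..w2}|size_law I i. u)"

text \<open>
  Without the clause \<open>0 < size_cdf I i w\<close> a law with no mass in \<open>(0, wbar)\<close> would satisfy the
  remaining clauses trivially, and the quotients in \<open>ratio_const\<close> and \<open>K_const\<close> would be
  undefined.  Continuity of the density is only required on \<open>(0, wbar)\<close>, so that laws such as the
  uniform distribution on \<open>[0, 1]\<close> are covered.
\<close>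

definition regular_sizes :: "alloc_instance \<Rightarrow> real \<Rightarrow> bool" where
  "regular_sizes I wbar \<longleftrightarrow> 0 < wbar \<and>
     (\<forall>i\<in>types I.
        (\<forall>w\<in>{0<..<wbar}. 0 < size_cdf I i w) \<and>
        (\<exists>lam \<gamma>1 \<gamma>2. 0 < lam \<and> lam < 1 \<and> 1 < \<gamma>1 \<and> \<gamma>1 < \<gamma>2 \<and>
           (\<forall>w\<in>{0<..<wbar}. \<gamma>1 * size_cdf I i (lam * w) \<le> size_cdf I i w \<and>
                             size_cdf I i w \<le> \<gamma>2 * size_cdf I i (lam * w))) \<and>
        (\<exists>f. f \<in> borel_measurable borel \<and> (\<forall>w. 0 \<le> f w) \<and>
           size_law I i = density lborel (\<lambda>w. ennreal (f w)) \<and>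
           continuous_on {0<..<wbar} f \<and>
           mono_on {0<..<wbar} (\<lambda>w. w ^ 3 * f w)))"

definition ratio_const :: "alloc_instance \<Rightarrow> real \<Rightarrow> real \<Rightarrow> bool" where
  "ratio_const I wbar M \<longleftrightarrow> 1 < M \<and>
     (\<forall>i\<in>types I. \<forall>w1 w2. 0 < w1 \<and> w1 < w2 \<and> w2 < wbar \<longrightarrow>
        w2 * (size_cdf I i w2 - size_cdf I i w1) / partial_mean I i w1 w2 \<le> M)"

lemma ratio_const_exists_single:
  assumes val: "valid_instance I" and reg: "regular_sizes I wbar" and i: "i \<in> types I"
  shows "\<exists>M>1. \<forall>w1 w2. 0 < w1 \<and> w1 < w2 \<and> w2 < wbar \<longrightarrow>
    w2 * (size_cdf I i w2 - size_cdf I i w1) / partial_mean I i w1 w2 \<le> M"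
proof -
  let ?D = "size_law I i" and ?F = "size_cdf I i"
  interpret D: prob_space ?D using val by (simp add: valid_instance_def)
  have sets_D[simp, measurable_cong]: "sets ?D = sets borel"
    using val by (simp add: valid_instance_def)
  have space_D: "space ?D = UNIV" using sets_eq_imp_space_eq[OF sets_D] by simp
  interpret D: real_distribution ?D by unfold_locales (simp_all add: space_D)
  obtain lam \<gamma> where lam: "0 < lam" "lam < 1" and \<gamma>: "1 < \<gamma>"
    and c1: "\<And>w. 0 < w \<Longrightarrow> w < wbar \<Longrightarrow> \<gamma> * ?F (lam * w) \<le> ?F w"
    using reg i unfolding regular_sizes_def by (metis greaterThanLessThan_iff)
  define M where "M = \<gamma> / ((\<gamma> - 1) * lam)"
  have "(\<gamma> - 1) * lam < (\<gamma> - 1) * 1" using \<gamma> lam by (intro mult_strict_left_mono) auto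
  then have M1: "1 < M" using \<gamma> lam by (simp add: M_def field_simps)
  have "w2 * (?F w2 - ?F w1) / partial_mean I i w1 w2 \<le> M"
    if w: "0 < w1" "w1 < w2" "w2 < wbar" for w1 w2
  proof -
    define a where "a = max w1 (lam * w2)"
    have a: "0 < a" "w1 \<le> a" "lam * w2 \<le> a" "a < w2"
      using w lam by (auto simp: a_def)
    have Fmono: "?F x \<le> ?F y" if "x \<le> y" for x y
      using that by (rule D.cdf_nondecreasing)
    have "(\<gamma> - 1) * (?F w2 - ?F w1) \<le> \<gamma> * (?F w2 - ?F a)"
    proof (cases "lam * w2 \<le> w1")
      case True
      then have "a = w1" by (simp add: a_def)
      with Fmono[of w1 w2] w show ?thesis by (simp add: algebra_simps)
    next
      case False
      then have aeq: "a = lam * w2" by (simp add: a_def)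
      have "0 \<le> ?F w1" by (simp add: cdf_def)
      then have "(\<gamma> - 1) * (?F w2 - ?F w1) \<le> (\<gamma> - 1) * ?F w2"
        using \<gamma> by (intro mult_left_mono) auto
      also have "\<dots> \<le> \<gamma> * (?F w2 - ?F a)"
        using c1[of w2] w by (simp add: aeq algebra_simps)
      finally show ?thesis .
    qed
    then have "?F w2 - ?F w1 \<le> \<gamma> * (?F w2 - ?F a) / (\<gamma> - 1)"
      using \<gamma> by (simp add: pos_le_divide_eq mult.commute)
    then have "w2 * (?F w2 - ?F w1) \<le> w2 * (\<gamma> * (?F w2 - ?F a) / (\<gamma> - 1))"
      using w by (intro mult_left_mono) auto
    also have "\<dots> = M * (lam * w2 * (?F w2 - ?F a))"
      using \<gamma> lam by (simp add: M_def)
    finally have num: "w2 * (?F w2 - ?F w1) \<le> M * (lam * w2 * (?F w2 - ?F a))" .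
    have Fd: "?F w2 - ?F a = measure ?D {a<..w2}"
      using D.cdf_diff_eq[of a w2] a by simp
    have "lam * w2 * (?F w2 - ?F a) = (\<integral>u. lam * w2 * indicator {a<..w2} u \<partial>?D)"
      by (simp add: Fd space_D)
    also have "\<dots> \<le> partial_mean I i w1 w2"
      unfolding partial_mean_def set_lebesgue_integral_def
    proof (rule integral_mono)
      show "integrable ?D (\<lambda>u. lam * w2 * indicator {a<..w2} u)"
        by (rule D.integrable_const_bound[where B = "lam * w2"])
           (use lam w in \<open>auto simp: indicator_def\<close>)
      show "integrable ?D (\<lambda>u. indicat_real {w1..w2} u *\<^sub>R u)"
        by (rule D.integrable_const_bound[where B = w2])
           (use w in \<open>auto simp: indicator_def\<close>)
      show "lam * w2 * indicator {a<..w2} u \<le> indicat_real {w1..w2} u *\<^sub>R u" for u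
        using a w by (auto simp: indicator_def)
    qed
    finally have pm: "lam * w2 * (?F w2 - ?F a) \<le> partial_mean I i w1 w2" .
    have "0 \<le> lam * w2 * (?F w2 - ?F a)"
      using Fmono[of a w2] a lam w by simp
    with pm have pm0: "0 \<le> partial_mean I i w1 w2" by simp
    have "w2 * (?F w2 - ?F w1) \<le> M * partial_mean I i w1 w2"
      using num mult_left_mono[OF pm, of M] M1 by linarith
    then show ?thesis
      using pm0 M1 by (cases "partial_mean I i w1 w2 = 0") (simp_all add: divide_le_eq)
  qed
  then show ?thesis using M1 by blast
qed

lemma ratio_const_exists:
  assumes "valid_instance I" and "regular_sizes I wbar"
  shows "\<exists>M. ratio_const I wbar M"
proof -
  obtain M where M: "\<And>i. i \<in> types I \<Longrightarrow> 1 < M i \<and> (\<forall>w1 w2. 0 < w1 \<and> w1 < w2 \<and> w2 < wbar \<longrightarrow>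
      w2 * (size_cdf I i w2 - size_cdf I i w1) / partial_mean I i w1 w2 \<le> M i)"
    using ratio_const_exists_single[OF assms] by metis
  define B where "B = Max (insert 2 (M ` types I))"
  have le: "M i \<le> B" if "i \<in> types I" for i
    unfolding B_def using that by (intro Max_ge) auto
  have "2 \<le> B" unfolding B_def by (intro Max_ge) auto
  then have "ratio_const I wbar B"
    unfolding ratio_const_def using M le by (fastforce intro: order_trans)
  then show ?thesis ..
qed

abbreviation periods_left :: "alloc_instance \<Rightarrow> nat \<Rightarrow> real" where
  "periods_left I t \<equiv> real (horizon I) - real t + 1"

text \<open>
  Here \<open>ct\<close> is the capacity vector of the single type \<open>i\<close>.  Integrability is required explicitly
  because the integral of a non-integrable function is 0 by convention.
\<close>

definition sub_lp_feasible ::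
    "alloc_instance \<Rightarrow> nat \<Rightarrow> (nat \<Rightarrow> real) \<Rightarrow> nat \<Rightarrow> (nat \<Rightarrow> real \<Rightarrow> real) \<Rightarrow> bool" where
  "sub_lp_feasible I i ct t x \<longleftrightarrow>
     (\<forall>j\<in>resources I. x j \<in> borel_measurable borel \<and> (\<forall>u. 0 \<le> x j u \<and> x j u \<le> 1)) \<and>
     (\<forall>u. (\<Sum>j\<in>resources I. x j u) \<le> 1) \<and>
     (\<forall>j\<in>resources I. integrable (size_law I i) (\<lambda>u. u * x j u) \<and>
        periods_left I t * type_prob I i * coef I i j * (\<integral>u. u * x j u \<partial>size_law I i) \<le> ct j)"

definition sub_lp :: "alloc_instance \<Rightarrow> nat \<Rightarrow> (nat \<Rightarrow> real) \<Rightarrow> nat \<Rightarrow> real" where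
  "sub_lp I i ct t =
     Sup {periods_left I t * type_prob I i *
            (\<integral>u. (\<Sum>j\<in>resources I. rew I i j * x j u) \<partial>size_law I i) | x.
          sub_lp_feasible I i ct t x}"

definition feasible_split :: "alloc_instance \<Rightarrow> (nat \<Rightarrow> nat \<Rightarrow> real) \<Rightarrow> bool" where
  "feasible_split I ct \<longleftrightarrow>
     (\<forall>j\<in>resources I. (\<Sum>i\<in>types I. ct i j) \<le> cap I j) \<and>
     (\<forall>i\<in>types I. \<forall>j\<in>resources I. 0 \<le> ct i j)"

definition optimal_split :: "alloc_instance \<Rightarrow> (nat \<Rightarrow> nat \<Rightarrow> real) \<Rightarrow> bool" where
  "optimal_split I cs \<longleftrightarrow> feasible_split I cs \<and>
     (\<forall>ct. feasible_split I ct \<longrightarrow>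
        (\<Sum>i\<in>types I. sub_lp I i (ct i) 1) \<le> (\<Sum>i\<in>types I. sub_lp I i (cs i) 1))"

text \<open>\<open>\<sigma> i j\<close> is the resource with the \<open>j\<close>-th largest reward for type \<open>i\<close>.\<close>

definition reward_order :: "alloc_instance \<Rightarrow> (nat \<Rightarrow> nat \<Rightarrow> nat) \<Rightarrow> bool" where
  "reward_order I \<sigma> \<longleftrightarrow>
     (\<forall>i\<in>types I. bij_betw (\<sigma> i) (resources I) (resources I) \<and>
        antimono_on (resources I) (\<lambda>j. rew I i (\<sigma> i j)))"

text \<open>
  The infimum is the least solution of the defining equation (unique as long as it lies
  below \<open>wbar\<close> of \<open>regular_sizes\<close>), and \<open>\<infinity>\<close> if there is none.
\<close>

definition size_threshold ::
    "alloc_instance \<Rightarrow> (nat \<Rightarrow> nat \<Rightarrow> nat) \<Rightarrow> nat \<Rightarrow> nat \<Rightarrow> nat \<Rightarrow> (nat \<Rightarrow> real) \<Rightarrow> ereal" where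
  "size_threshold I \<sigma> t i j ct =
     Inf {ereal w | w. 0 \<le> w \<and>
            type_prob I i * partial_mean I i 0 w =
              1 / periods_left I t * (\<Sum>k=1..j. ct (\<sigma> i k) / coef I i (\<sigma> i k))}"

definition acceptance_level ::
    "alloc_instance \<Rightarrow> (nat \<Rightarrow> nat \<Rightarrow> nat) \<Rightarrow> nat \<Rightarrow> nat \<Rightarrow> nat \<Rightarrow> (nat \<Rightarrow> real) \<Rightarrow> ereal" where
  "acceptance_level I \<sigma> t i j ct =
     min (ereal (ct (\<sigma> i j) / coef I i (\<sigma> i j))) (size_threshold I \<sigma> t i j ct)"

definition atp1_choice ::
    "alloc_instance \<Rightarrow> (nat \<Rightarrow> nat \<Rightarrow> nat) \<Rightarrow> nat \<Rightarrow> (nat \<Rightarrow> nat \<Rightarrow> real) \<Rightarrow> request \<Rightarrow> nat option" where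
  "atp1_choice I \<sigma> t c q =
     (case q of (i, u) \<Rightarrow>
        let J = {j\<in>resources I. ereal u \<le> acceptance_level I \<sigma> t i j (c i)}
        in if J = {} then None else Some (\<sigma> i (Min J)))"

definition consume ::
    "alloc_instance \<Rightarrow> (nat \<Rightarrow> nat \<Rightarrow> real) \<Rightarrow> request \<Rightarrow> nat option \<Rightarrow> nat \<Rightarrow> nat \<Rightarrow> real" where
  "consume I c q d =
     (case d of None \<Rightarrow> c
      | Some k \<Rightarrow> c (fst q := (c (fst q)) (k := c (fst q) k - coef I (fst q) k * snd q)))"

text \<open>\<open>atp1_cap I \<sigma> cs \<omega> t\<close> is the table of type-wise capacities at the start of period
  \<open>t \<ge> 1\<close>; index 0 is a dummy.\<close>

primrec atp1_cap ::
    "alloc_instance \<Rightarrow> (nat \<Rightarrow> nat \<Rightarrow> nat) \<Rightarrow> (nat \<Rightarrow> nat \<Rightarrow> real) \<Rightarrow> (nat \<Rightarrow> request) \<Rightarrow>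
     nat \<Rightarrow> nat \<Rightarrow> nat \<Rightarrow> real" where
  "atp1_cap I \<sigma> cs \<omega> 0 = cs"
| "atp1_cap I \<sigma> cs \<omega> (Suc t) =
     (if t = 0 then cs
      else consume I (atp1_cap I \<sigma> cs \<omega> t) (\<omega> t)
             (atp1_choice I \<sigma> t (atp1_cap I \<sigma> cs \<omega> t) (\<omega> t)))"

definition atp1 ::
    "alloc_instance \<Rightarrow> (nat \<Rightarrow> nat \<Rightarrow> nat) \<Rightarrow> (nat \<Rightarrow> nat \<Rightarrow> real) \<Rightarrow> policy" where
  "atp1 I \<sigma> cs \<omega> t k =
     (if atp1_choice I \<sigma> t (atp1_cap I \<sigma> cs \<omega> t) (\<omega> t) = Some k then 1 else 0)"

lemma atp1_choice_SomeD:
  assumes ord: "reward_order I \<sigma>" and i: "fst q \<in> types I"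
    and ch: "atp1_choice I \<sigma> t c q = Some k"
  shows "k \<in> resources I" and "ereal (snd q) \<le> ereal (c (fst q) k / coef I (fst q) k)"
proof -
  obtain i u where q: "q = (i, u)" by (cases q)
  define J where "J = {j\<in>resources I. ereal u \<le> acceptance_level I \<sigma> t i j (c i)}"
  have J: "J \<noteq> {}" "k = \<sigma> i (Min J)"
    using ch unfolding atp1_choice_def q prod.case Let_def J_def[symmetric]
    by (auto split: if_splits)
  have "finite J" by (simp add: J_def)
  with J have mem: "Min J \<in> J" by simp
  have "bij_betw (\<sigma> i) (resources I) (resources I)"
    using ord i by (auto simp: reward_order_def q)
  moreover have "Min J \<in> resources I" using mem by (simp add: J_def)
  ultimately show "k \<in> resources I" using J(2) bij_betwE by blast
  show "ereal (snd q) \<le> ereal (c (fst q) k / coef I (fst q) k)"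
    using mem unfolding J(2) by (simp add: J_def acceptance_level_def q)
qed

lemma atp1_cap_cong:
  assumes "\<forall>s\<in>{1..<t}. \<omega> s = \<omega>' s"
  shows "atp1_cap I \<sigma> cs \<omega> t = atp1_cap I \<sigma> cs \<omega>' t"
  using assms by (induction t) auto

lemma atp1_cap_invariant:
  assumes val: "valid_instance I" and fs: "feasible_split I cs" and ord: "reward_order I \<sigma>"
    and \<omega>: "\<forall>t\<in>periods I. fst (\<omega> t) \<in> types I \<and> 0 < snd (\<omega> t)"
    and t: "t \<le> horizon I"
  shows "(\<forall>i\<in>types I. \<forall>j\<in>resources I. 0 \<le> atp1_cap I \<sigma> cs \<omega> (Suc t) i j) \<and>
    (\<forall>j\<in>resources I. (\<Sum>i\<in>types I. atp1_cap I \<sigma> cs \<omega> (Suc t) i j) +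
       (\<Sum>s=1..t. coef I (fst (\<omega> s)) j * snd (\<omega> s) * atp1 I \<sigma> cs \<omega> s j) =
       (\<Sum>i\<in>types I. cs i j))"
  using t
proof (induction t)
  case 0
  then show ?case using fs by (auto simp: feasible_split_def)
next
  case (Suc t)
  define c where "c = atp1_cap I \<sigma> cs \<omega> (Suc t)"
  define q where "q = \<omega> (Suc t)"
  define d where "d = atp1_choice I \<sigma> (Suc t) c q"
  have q: "fst q \<in> types I" "0 < snd q" using \<omega> Suc.prems by (auto simp: q_def)
  have nxt: "atp1_cap I \<sigma> cs \<omega> (Suc (Suc t)) = consume I c q d"
    unfolding c_def q_def d_def atp1_cap.simps(2)[of I \<sigma> cs \<omega> "Suc t"] by (rule if_not_P) simp
  have x: "atp1 I \<sigma> cs \<omega> (Suc t) j = (if d = Some j then 1 else 0)" for j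
    by (simp only: atp1_def c_def q_def d_def)
  have nn: "0 \<le> c i j" if "i \<in> types I" "j \<in> resources I" for i j
    using Suc.IH Suc.prems that unfolding c_def by (meson Suc_leD)
  have IH: "(\<Sum>i\<in>types I. c i j) +
      (\<Sum>s=1..t. coef I (fst (\<omega> s)) j * snd (\<omega> s) * atp1 I \<sigma> cs \<omega> s j) =
      (\<Sum>i\<in>types I. cs i j)" if "j \<in> resources I" for j
    using Suc.IH Suc.prems that unfolding c_def by (meson Suc_leD)
  have pos: "0 \<le> consume I c q d i j" if "i \<in> types I" "j \<in> resources I" for i j
  proof (cases d)
    case None
    then show ?thesis using nn that by (simp add: consume_def)
  next
    case (Some k)
    have k: "k \<in> resources I" "snd q \<le> c (fst q) k / coef I (fst q) k"
      using atp1_choice_SomeD[OF ord q(1) Some[unfolded d_def]] by auto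
    have "0 < coef I (fst q) k" using val q k by (auto simp: valid_instance_def)
    then have "coef I (fst q) k * snd q \<le> c (fst q) k"
      using k by (simp add: field_simps)
    then show ?thesis using nn that Some by (auto simp: consume_def)
  qed
  have bal: "(\<Sum>i\<in>types I. consume I c q d i j) + coef I (fst q) j * snd q * (if d = Some j then 1 else 0)
      = (\<Sum>i\<in>types I. c i j)" for j
  proof -
    have "consume I c q d i j =
        c i j - (if i = fst q then coef I (fst q) j * snd q * (if d = Some j then 1 else 0) else 0)" for i
      by (cases d) (auto simp: consume_def)
    then show ?thesis using q(1) by (simp add: sum_subtractf sum.delta)
  qed
  show ?case
  proof (intro conjI ballI)
    fix i j assume "i \<in> types I" "j \<in> resources I"
    then show "0 \<le> atp1_cap I \<sigma> cs \<omega> (Suc (Suc t)) i j" unfolding nxt by (rule pos)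
  next
    fix j assume j: "j \<in> resources I"
    have "(\<Sum>s=1..Suc t. coef I (fst (\<omega> s)) j * snd (\<omega> s) * atp1 I \<sigma> cs \<omega> s j) =
        (\<Sum>s=1..t. coef I (fst (\<omega> s)) j * snd (\<omega> s) * atp1 I \<sigma> cs \<omega> s j) +
        coef I (fst q) j * snd q * (if d = Some j then 1 else 0)"
      using x[of j] by (simp add: q_def)
    then show "(\<Sum>i\<in>types I. atp1_cap I \<sigma> cs \<omega> (Suc (Suc t)) i j) +
        (\<Sum>s=1..Suc t. coef I (fst (\<omega> s)) j * snd (\<omega> s) * atp1 I \<sigma> cs \<omega> s j) =
        (\<Sum>i\<in>types I. cs i j)"
      using bal[of j] IH[OF j] unfolding nxt by linarith
  qed
qed

lemma atp1_feasible:
  assumes val: "valid_instance I" and opt: "optimal_split I cs" and ord: "reward_order I \<sigma>"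
  shows "feasible_policy I (atp1 I \<sigma> cs)"
proof -
  have fs: "feasible_split I cs" using opt by (simp add: optimal_split_def)
  have adapted: "atp1 I \<sigma> cs \<omega> t j = atp1 I \<sigma> cs \<omega>' t j"
    if "t \<in> periods I" "\<forall>s\<in>{1..t}. \<omega> s = \<omega>' s" for t \<omega> \<omega>' j
    using that atp1_cap_cong[of t \<omega> \<omega>'] by (simp add: atp1_def)
  have feas: "feasible_alloc I \<omega> (atp1 I \<sigma> cs \<omega>)"
    if \<omega>: "\<forall>t\<in>periods I. fst (\<omega> t) \<in> types I \<and> 0 < snd (\<omega> t)" for \<omega>
    unfolding feasible_alloc_def
  proof (intro conjI ballI)
    fix j assume j: "j \<in> resources I"
    note inv = atp1_cap_invariant[OF val fs ord \<omega> order_refl]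
    have "0 \<le> (\<Sum>i\<in>types I. atp1_cap I \<sigma> cs \<omega> (Suc (horizon I)) i j)"
      using inv j by (intro sum_nonneg) blast
    moreover have "(\<Sum>i\<in>types I. cs i j) \<le> cap I j"
      using fs j by (simp add: feasible_split_def)
    ultimately show
      "(\<Sum>t\<in>periods I. coef I (fst (\<omega> t)) j * snd (\<omega> t) * atp1 I \<sigma> cs \<omega> t j) \<le> cap I j"
      using inv j by fastforce
  next
    fix t
    let ?d = "atp1_choice I \<sigma> t (atp1_cap I \<sigma> cs \<omega> t) (\<omega> t)"
    show "(\<Sum>j\<in>resources I. atp1 I \<sigma> cs \<omega> t j) \<le> 1"
      by (cases ?d) (simp_all add: atp1_def)
  qed (simp add: atp1_def)
  show ?thesis using adapted feas by (simp add: feasible_policy_def)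
qed

definition K_const ::
    "alloc_instance \<Rightarrow> (nat \<Rightarrow> nat \<Rightarrow> nat) \<Rightarrow> (nat \<Rightarrow> nat \<Rightarrow> real) \<Rightarrow> real \<Rightarrow> nat \<Rightarrow> int" where
  "K_const I \<sigma> cs wbar i =
     \<lceil>(\<Sum>j=1..num_res I. cs i (\<sigma> i j) / coef I i (\<sigma> i j)) /
       (type_prob I i * partial_mean I i 0 wbar)\<rceil>"

definition max_reward :: "alloc_instance \<Rightarrow> nat \<Rightarrow> real" where
  "max_reward I i = Max (rew I i ` resources I)"

definition atp1_bound ::
    "alloc_instance \<Rightarrow> (nat \<Rightarrow> nat \<Rightarrow> nat) \<Rightarrow> (nat \<Rightarrow> nat \<Rightarrow> real) \<Rightarrow> real \<Rightarrow> real \<Rightarrow> real" where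
  "atp1_bound I \<sigma> cs wbar M =
     (\<Sum>i\<in>types I. \<Sum>j=1..num_res I.
        rew I i (\<sigma> i j) * (real (j + 1) * M - real j) * (ln (real (horizon I)) + 1)) +
     (\<Sum>i\<in>types I. max_reward I i * of_int (K_const I \<sigma> cs wbar i))"

text \<open>
  Uniformity class for the order estimate: it bounds, independently of the horizon and of the
  numbers of types and resources, the rewards and the quantities that control \<open>K_const\<close>
  (capacities are fixed while the horizon grows; an optimal split never exceeds \<open>cap\<close>).
\<close>

definition bounded_data :: "alloc_instance \<Rightarrow> real \<Rightarrow> real \<Rightarrow> real \<Rightarrow> bool" where
  "bounded_data I wbar R \<kappa> \<longleftrightarrow>
     (\<forall>i\<in>types I. (\<forall>j\<in>resources I. rew I i j \<le> R) \<and>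
        (\<Sum>j\<in>resources I. cap I j / coef I i j) / (type_prob I i * partial_mean I i 0 wbar) \<le> \<kappa>)"

end

theory Submission
  imports Defs
begin

text \<open>
  Why the regret is logarithmic.  The prophet is dominated by the fluid relaxation: averaging its
  decisions, conditionally on the request of a period, yields a feasible point of the relaxed
  problems for some split of the capacities, and the optimal split does at least as well
  (\<open>prophet_le_sub_lp\<close>).  From then on every type can be treated separately, because a request of
  type \<open>i\<close> only touches the capacities reserved for type \<open>i\<close>.

  For one type, the best \<open>j\<close> resources act like a single resource whose budget \<open>S\<^sub>j\<close> is their joint
  capacity in units of size: the relaxed value with \<open>N\<close> periods to go is
  \<open>N p (\<Sum>j. w\<^sub>j \<Phi> (S\<^sub>j / (N p)))\<close>, where \<open>w\<^sub>j\<close> is the drop from the \<open>j\<close>-th to the next largest reward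
  and \<open>\<Phi> B\<close> is the largest acceptance probability with expected consumption \<open>B\<close>
  (\<open>sub_lp_le_potential\<close>).  This value, evaluated along the policy, is a potential, and the regret
  is what the potential and the collected rewards lose together in a period.  Two effects cost
  something at each level \<open>j\<close>.

  \<^item> A resource with little left cannot serve a request below its threshold.  Each resource that is
    short has at most the size of the lost request left, so the lost requests of a level take at most
    \<open>j \<mu>\<^sub>j / N\<close> of the consumption per period, and by the ratio constant they have probability at most
    \<open>j M / N\<close> (\<open>budget_le_level\<close>, \<open>service_loss\<close>).

  \<^item> The threshold \<open>\<mu>\<^sub>j\<close> makes the relative budget \<open>S\<^sub>j / N\<close> a martingale under full service, so the
    concave \<open>\<Phi>\<close> loses only its curvature times the variance.  Since \<open>\<Phi>' = 1 / \<mu>\<close> is convex in the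
    budget, by the monotonicity of \<open>w ^ 3 * f w\<close>, the relative error of the tangent,
    \<open>(\<Phi> B - \<Phi> B' - (B - B') / \<mu>) / (B - B')\<^sup>2\<close>, is largest at \<open>B' = 0\<close>, where the ratio constant
    bounds it by \<open>(M - 1) / (\<mu> B)\<close>.  This gives a quadratic minorant of \<open>\<Phi>\<close> on the whole range
    (\<open>accept_quadratic_lower_bound\<close>).  The consumption has second moment at most \<open>p \<mu> B\<close>, so
    the loss is at most \<open>(M - 1) / (N - 1)\<close> (\<open>minorant_expectation\<close>).

  Both losses are harmonic in the number of periods to go and sum to a multiple of \<open>ln T + 1\<close>.  The
  estimates need thresholds below \<open>wbar\<close>, which holds as long as at least \<open>K\<^sub>i\<close> periods remain after
  the current one; in the last \<open>K\<^sub>i\<close> periods at most one maximal reward per period is lost.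
\<close>

section \<open>Thresholds at a single type: the value of a size budget\<close>

text \<open>
  Here \<open>F v\<close> is the probability that a size is at most \<open>v\<close> and \<open>P v\<close> the expected size consumed
  when all sizes up to \<open>v\<close> are accepted.  As functions of the budget \<open>P v\<close>, the acceptance
  probability \<open>F v\<close> has derivative \<open>1 / v\<close>, and \<open>1 / v\<close> is convex in the budget because
  \<open>v ^ 3 * f v\<close> is monotone.
\<close>

locale size_profile =
  fixes F P f :: "real \<Rightarrow> real" and W M :: real
  assumes W_pos: "0 < W"
    and M_gt_1: "1 < M"
    and f_pos: "\<And>v. 0 < v \<Longrightarrow> v < W \<Longrightarrow> 0 < f v"
    and cube_mono: "mono_on {0<..<W} (\<lambda>v. v ^ 3 * f v)"
    and F_deriv: "\<And>v. 0 < v \<Longrightarrow> v < W \<Longrightarrow> (F has_real_derivative f v) (at v)"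
    and P_deriv: "\<And>v. 0 < v \<Longrightarrow> v < W \<Longrightarrow> (P has_real_derivative v * f v) (at v)"
    and F_cont: "continuous_on {0..W} F"
    and P_cont: "continuous_on {0..W} P"
    and F_0 [simp]: "F 0 = 0"
    and P_0 [simp]: "P 0 = 0"
    and F_le_1: "\<And>v. F v \<le> 1"
    and quotient_le: "\<And>w1 w2. 0 < w1 \<Longrightarrow> w1 < w2 \<Longrightarrow> w2 < W \<Longrightarrow>
          w2 * (F w2 - F w1) / (P w2 - P w1) \<le> M"
begin

lemma P_strict_mono: "0 \<le> x \<Longrightarrow> x < y \<Longrightarrow> y \<le> W \<Longrightarrow> P x < P y"
  by (rule DERIV_pos_imp_increasing_open)
     (auto intro!: exI P_deriv mult_pos_pos f_pos continuous_on_subset[OF P_cont])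

lemma F_strict_mono: "0 \<le> x \<Longrightarrow> x < y \<Longrightarrow> y \<le> W \<Longrightarrow> F x < F y"
  by (rule DERIV_pos_imp_increasing_open)
     (auto intro!: exI F_deriv f_pos continuous_on_subset[OF F_cont])

lemma P_mono: "0 \<le> x \<Longrightarrow> x \<le> y \<Longrightarrow> y \<le> W \<Longrightarrow> P x \<le> P y"
  using P_strict_mono[of x y] by (cases "x = y") auto

lemma F_mono: "0 \<le> x \<Longrightarrow> x \<le> y \<Longrightarrow> y \<le> W \<Longrightarrow> F x \<le> F y"
  using F_strict_mono[of x y] by (cases "x = y") auto

lemma P_le_iff: "0 \<le> x \<Longrightarrow> x \<le> W \<Longrightarrow> 0 \<le> y \<Longrightarrow> y \<le> W \<Longrightarrow> P x \<le> P y \<longleftrightarrow> x \<le> y"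
  using P_mono[of x y] P_strict_mono[of y x] by (cases "x \<le> y") auto

lemma P_pos: "0 < v \<Longrightarrow> v \<le> W \<Longrightarrow> 0 < P v"
  using P_strict_mono[of 0 v] by simp

lemma P_surj: "0 \<le> B \<Longrightarrow> B \<le> P W \<Longrightarrow> \<exists>v\<in>{0..W}. P v = B"
  using IVT'[of P 0 B W] W_pos P_cont by auto

text \<open>The left end point is included by continuity at \<open>0\<close>.\<close>

lemma ratio_le:
  assumes "0 \<le> v" "v \<le> w" "w < W"
  shows "w * (F w - F v) \<le> M * (P w - P v)"
proof -
  have pos: "w * (F w - F v) \<le> M * (P w - P v)" if "0 < v" "v < w" for v
    using quotient_le[of v w] P_strict_mono[of v w] that assms by (simp add: divide_le_eq)
  consider "v = w" | "0 < v" "v < w" | "v = 0" "0 < w" using assms by force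
  then show ?thesis
  proof cases
    case 3
    have "w * F w - w * F x \<le> M * P w" if "0 < x" "x < w" for x
    proof -
      have "0 \<le> M * P x" using that assms P_pos[of x] M_gt_1 by simp
      then show ?thesis using pos[of x] that by (simp add: algebra_simps)
    qed
    then have ev: "eventually (\<lambda>x. w * F w - w * F x \<le> M * P w) (at_right 0)"
      using 3 by (auto simp: eventually_at_right_field intro!: exI[of _ w])
    have "(F \<longlongrightarrow> F 0) (at_right 0)"
      by (rule continuous_on_Icc_at_rightD[OF F_cont W_pos])
    then have "((\<lambda>x. w * F w - w * F x) \<longlongrightarrow> w * F w - w * F 0) (at_right 0)"
      by (intro tendsto_intros)
    from tendsto_upperbound[OF this ev] have "w * F w - w * F 0 \<le> M * P w" by simp
    with 3 show ?thesis by simp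
  qed (use pos in auto)
qed

text \<open>
  The derivative \<open>-1 / (v ^ 3 * f v)\<close> of \<open>1 / v\<close> with respect to the budget increases with \<open>v\<close>.
\<close>

lemma inverse_tangent:
  assumes w: "0 < w" "w < W" and v: "0 < v" "v < W"
  shows "1 / w - (P v - P w) / (w ^ 3 * f w) \<le> 1 / v"
proof -
  define s where "s = 1 / (w ^ 3 * f w)"
  have cw: "0 < w ^ 3 * f w" using w f_pos by simp
  then have s: "0 < s" "s * (w ^ 3 * f w) = 1" by (auto simp: s_def)
  define g where "g x = 1 / x - 1 / w + s * (P x - P w)" for x
  have g': "(g has_real_derivative (s * (x ^ 3 * f x) - 1) / x ^ 2) (at x)" if "0 < x" "x < W" for x
    unfolding g_def using that
    by (auto intro!: derivative_eq_intros P_deriv simp: field_simps power2_eq_square power3_eq_cube)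
  have cube: "x ^ 3 * f x \<le> y ^ 3 * f y" if "0 < x" "x \<le> y" "y < W" for x y
    using mono_onD[OF cube_mono, of x y] that by auto
  have "g w \<le> g v"
  proof (cases "w \<le> v")
    case True
    have "\<exists>y. (g has_real_derivative y) (at x) \<and> 0 \<le> y" if "w \<le> x" "x \<le> v" for x
      using g'[of x] mult_left_mono[OF cube[of w x], of s] s w v that
      by (intro exI conjI) (auto intro!: divide_nonneg_pos)
    from DERIV_nonneg_imp_nondecreasing[OF True this] show ?thesis .
  next
    case False
    then have le: "v \<le> w" by simp
    have "\<exists>y. (g has_real_derivative y) (at x) \<and> y \<le> 0" if "v \<le> x" "x \<le> w" for x
      using g'[of x] mult_left_mono[OF cube[of x w], of s] s w v that
      by (intro exI conjI) (auto intro!: divide_nonpos_pos)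
    from DERIV_nonpos_imp_nonincreasing[OF le this] show ?thesis .
  qed
  then show ?thesis by (simp add: g_def s_def field_simps)
qed

text \<open>
  \<open>gap w v\<close> is the error of the linear approximation at the budget \<open>P w\<close> of the acceptance
  probability, evaluated at the budget \<open>P v\<close>.
\<close>

definition gap :: "real \<Rightarrow> real \<Rightarrow> real" where
  "gap w v = F w - F v - (P w - P v) / w"

lemma gap_deriv:
  assumes "0 < w" "0 < v" "v < W"
  shows "(gap w has_real_derivative - (v * f v * (1 / v - 1 / w))) (at v)"
  unfolding gap_def using assms
  by (auto intro!: derivative_eq_intros F_deriv P_deriv simp: field_simps)

lemma gap_cont: "0 < w \<Longrightarrow> continuous_on {0..W} (gap w)"
  unfolding gap_def by (intro continuous_intros F_cont P_cont) auto

lemma gap_0_le: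
  assumes "0 < w" "w < W"
  shows "gap w 0 \<le> (M - 1) * P w / w"
  using ratio_le[of 0 w] assms by (simp add: gap_def field_simps)

text \<open>
  The trapezoidal rule for the convex function \<open>1 / v\<close> of the budget; the derivative in \<open>v\<close> of the
  difference of the two sides is the tangent inequality at \<open>v\<close>.
\<close>

lemma gap_trapezoid:
  assumes w: "0 < w" "w < W" and v: "0 < v" "v \<le> w"
  shows "2 * gap w v \<le> (1 / v - 1 / w) * (P w - P v)"
proof -
  define T where "T x = (1 / x - 1 / w) * (P w - P x) - 2 * gap w x" for x
  have "\<exists>y. (T has_real_derivative y) (at x) \<and> y \<le> 0" if "v \<le> x" "x \<le> w" for x
  proof (intro exI conjI)
    have x: "0 < x" "x < W" using that v w by auto
    show "(T has_real_derivative
        x * f x * (1 / x - 1 / w) - (P w - P x) / x ^ 2) (at x)"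
      unfolding T_def using x w
      by (auto intro!: derivative_eq_intros P_deriv gap_deriv simp: field_simps power2_eq_square)
    have c: "0 < x ^ 3 * f x" using x f_pos by simp
    have "1 / x - 1 / w \<le> (P w - P x) / (x ^ 3 * f x)"
      using inverse_tangent[OF x w] by simp
    then have "x ^ 3 * f x * (1 / x - 1 / w) \<le> P w - P x"
      using c by (simp add: pos_le_divide_eq mult.commute)
    then have "x ^ 3 * f x * (1 / x - 1 / w) / x ^ 2 \<le> (P w - P x) / x ^ 2"
      by (rule divide_right_mono) simp
    moreover have "x ^ 3 * f x * (1 / x - 1 / w) / x ^ 2 = x * f x * (1 / x - 1 / w)"
      using x by (simp add: power2_eq_square power3_eq_cube)
    ultimately show "x * f x * (1 / x - 1 / w) - (P w - P x) / x ^ 2 \<le> 0" by simp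
  qed
  from DERIV_nonpos_imp_nonincreasing[OF v(2) this] have "T w \<le> T v" .
  then show ?thesis by (simp add: T_def gap_def)
qed

text \<open>
  By the trapezoidal rule the quotient of the gap and the squared budget difference decreases in
  \<open>v\<close>, so its value at \<open>v = 0\<close>, where the ratio constant applies, is the largest.
\<close>

lemma gap_le_below:
  assumes w: "0 < w" "w < W" and v: "0 \<le> v" "v < w"
  shows "gap w v \<le> (M - 1) / (w * P w) * (P v - P w) ^ 2"
proof -
  define Q where "Q x = P w - P x" for x
  define E where "E x = gap w x / Q x ^ 2" for x
  have Qpos: "0 < Q x" if "0 \<le> x" "x < w" for x
    using P_strict_mono[of x w] that w by (simp add: Q_def)
  have "E v \<le> E 0"
  proof (cases "v = 0")
    case False
    then have "0 < v" using v by simp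
    have "- E 0 \<le> - E v"
    proof (rule DERIV_nonneg_imp_increasing_open[where f = "\<lambda>x. - E x"])
      fix x assume x: "0 < x" "x < v"
      then have xW: "x < W" "x < w" using v w by auto
      have q: "0 < Q x" using Qpos[of x] x xW by simp
      have dQ: "(Q has_real_derivative - (x * f x)) (at x)"
        unfolding Q_def using x xW by (auto intro!: derivative_eq_intros P_deriv)
      have "((\<lambda>x. Q x ^ 2) has_real_derivative 2 * Q x * - (x * f x)) (at x)"
        using dQ by (auto intro!: derivative_eq_intros)
      from DERIV_minus[OF DERIV_divide[OF gap_deriv[OF w(1) x(1) xW(1)] this]]
      have "((\<lambda>x. - E x) has_real_derivative
          x * f x * ((1 / x - 1 / w) * Q x - 2 * gap w x) / Q x ^ 3) (at x)"
        unfolding E_def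
        by (rule DERIV_cong)
           (use q in \<open>simp_all add: divide_simps, simp add: algebra_simps power2_eq_square power3_eq_cube power4_eq_xxxx\<close>)
      moreover have "0 \<le> x * f x * ((1 / x - 1 / w) * Q x - 2 * gap w x) / Q x ^ 3"
        using gap_trapezoid[OF w x(1)] xW x q f_pos[of x]
        by (intro divide_nonneg_pos mult_nonneg_nonneg) (auto simp: Q_def)
      ultimately show "\<exists>y. ((\<lambda>x. - E x) has_real_derivative y) (at x) \<and> 0 \<le> y" by blast
    next
      have "continuous_on {0..v} (gap w)"
        using gap_cont[OF w(1)] by (rule continuous_on_subset) (use v w in auto)
      moreover have "continuous_on {0..v} Q"
        unfolding Q_def
        by (intro continuous_intros continuous_on_subset[OF P_cont]) (use v w in auto)
      moreover have "Q x ^ 2 \<noteq> 0" if "x \<in> {0..v}" for x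
        using Qpos[of x] that v by auto
      ultimately show "continuous_on {0..v} (\<lambda>x. - E x)"
        unfolding E_def by (intro continuous_intros) auto
    qed (use v in simp)
    then show ?thesis by simp
  qed simp
  moreover have "E 0 \<le> (M - 1) / (w * P w)"
    using divide_right_mono[OF gap_0_le[OF w], of "P w ^ 2"] P_pos[of w] w
    by (simp add: E_def Q_def power2_eq_square)
  ultimately have "E v \<le> (M - 1) / (w * P w)" by simp
  then show ?thesis
    using Qpos[OF v] by (simp add: E_def Q_def divide_le_eq power2_commute)
qed

text \<open>
  Above \<open>w\<close> the gap is at most half the tangential curvature times the squared budget difference;
  below \<open>w\<close> it is at least that much, so the bound just proved also controls the curvature.
\<close>

lemma gap_le_above:
  assumes w: "0 < w" "w < W" and v: "w \<le> v" "v \<le> W"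
  shows "gap w v \<le> (M - 1) / (w * P w) * (P v - P w) ^ 2"
proof -
  define s where "s = 1 / (2 * (w ^ 3 * f w))"
  define D where "D x = s * (P x - P w) ^ 2 - gap w x" for x
  have D': "(D has_real_derivative x * f x * (1 / x - 1 / w + 2 * s * (P x - P w))) (at x)"
    if "0 < x" "x < W" for x
    unfolding D_def using that w
    by (auto intro!: derivative_eq_intros P_deriv gap_deriv simp: algebra_simps)
  have nn: "0 \<le> x * f x * (1 / x - 1 / w + 2 * s * (P x - P w))" if "0 < x" "x < W" for x
    using inverse_tangent[OF w that] that f_pos[OF that]
    by (intro mult_nonneg_nonneg) (auto simp: s_def)
  have cont: "continuous_on {0..W} D"
    unfolding D_def using w by (intro continuous_intros P_cont gap_cont)
  have mono: "D x \<le> D y" if "0 \<le> x" "x \<le> y" "y \<le> W" for x y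
  proof (rule DERIV_nonneg_imp_increasing_open[OF that(2)])
    show "\<exists>d. (D has_real_derivative d) (at z) \<and> 0 \<le> d" if "x < z" "z < y" for z
      using D'[of z] nn[of z] that \<open>0 \<le> x\<close> \<open>y \<le> W\<close> by auto
    show "continuous_on {x..y} D"
      using cont by (rule continuous_on_subset) (use that in auto)
  qed
  have D_w: "D w = 0" by (simp add: D_def gap_def)
  have "s * P w ^ 2 \<le> gap w 0"
    using mono[of 0 w] w by (simp add: D_w) (simp add: D_def)
  also have "\<dots> \<le> (M - 1) / (w * P w) * P w ^ 2"
    using gap_le_below[OF w, of 0] w by simp
  finally have s: "s \<le> (M - 1) / (w * P w)"
    by (rule mult_right_le_imp_le) (use P_pos[of w] w in simp)
  have "gap w v \<le> s * (P v - P w) ^ 2"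
    using mono[of w v] w v by (simp add: D_w) (simp add: D_def)
  also have "\<dots> \<le> (M - 1) / (w * P w) * (P v - P w) ^ 2"
    using s by (rule mult_right_mono) simp
  finally show ?thesis .
qed

text \<open>
  The largest probability of acceptance with a given expected consumption; negative budgets count
  as zero so that the function is monotone on the whole line.
\<close>

definition accept :: "real \<Rightarrow> real" where
  "accept B = Sup (F ` {v\<in>{0..W}. P v \<le> max 0 B})"

lemma accept_set: "0 \<in> {v\<in>{0..W}. P v \<le> max 0 B}" "bdd_above (F ` {v\<in>{0..W}. P v \<le> max 0 B})"
  using W_pos F_le_1 by (auto intro!: bdd_aboveI[of _ 1])

lemma accept_nonneg: "0 \<le> accept B"
  unfolding accept_def using cSup_upper[OF imageI[OF accept_set(1)] accept_set(2)] by simp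

lemma accept_le_1: "accept B \<le> 1"
  unfolding accept_def using accept_set(1) F_le_1 by (intro cSup_least) blast+

lemma accept_mono: "A \<le> B \<Longrightarrow> accept A \<le> accept B"
  unfolding accept_def using accept_set by (intro cSup_subset_mono image_mono) (blast | force)+

lemma accept_measurable [measurable]: "accept \<in> borel_measurable borel"
  by (intro borel_measurable_mono monoI accept_mono)

lemma accept_P: "0 \<le> v \<Longrightarrow> v \<le> W \<Longrightarrow> accept (P v) = F v"
  unfolding accept_def
  by (intro cSup_eq_maximum) (use P_mono[of 0 v] P_le_iff in \<open>auto intro!: F_mono\<close>)

text \<open>
  The quadratic minorant is below zero for negative budgets because it increases up to the tangent
  point and is already at most zero at the budget zero; this is the case in which a served request
  would consume more than the budget.
\<close>

lemma accept_quadratic_lower_bound: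
  assumes w: "0 < w" "w < W" and B: "B \<le> P W"
  shows "F w + (B - P w) / w - (M - 1) / (w * P w) * (B - P w) ^ 2 \<le> accept B"
proof (cases "0 \<le> B")
  case True
  then obtain v where v: "0 \<le> v" "v \<le> W" "P v = B"
    using P_surj[of B] B by auto
  have "gap w v \<le> (M - 1) / (w * P w) * (P v - P w) ^ 2"
    using gap_le_above[OF w, of v] gap_le_below[OF w, of v] v by fastforce
  moreover have "(P v - P w) / w = - ((P w - P v) / w)"
    by (simp add: minus_divide_left)
  ultimately show ?thesis
    using accept_P[of v] v by (simp add: gap_def)
next
  case False
  have Pw: "0 < P w" using P_pos w by simp
  have "F w \<le> M * P w / w"
    using ratio_le[of 0 w] w by (simp add: field_simps)
  moreover have "(B - P w) / w \<le> - P w / w"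
    using divide_right_mono[of "B - P w" "- P w" w] False w by simp
  moreover have "P w ^ 2 \<le> (B - P w) ^ 2"
    using False Pw by (simp add: power2_le_iff_abs_le abs_le_iff flip: abs_le_square_iff)
  then have "(M - 1) / (w * P w) * P w ^ 2 \<le> (M - 1) / (w * P w) * (B - P w) ^ 2"
    using M_gt_1 Pw w by (intro mult_left_mono) auto
  moreover have "(M - 1) / (w * P w) * P w ^ 2 = M * P w / w - P w / w"
    using Pw w by (simp add: field_simps power2_eq_square)
  ultimately show ?thesis using accept_nonneg[of B] by simp
qed

end

section \<open>The size laws as size profiles\<close>

text \<open>
  The base point \<open>a\<close> is kept away from zero, where the density of a size law may be unbounded.
\<close>

lemma deriv_integral_density:
  fixes f k G :: "real \<Rightarrow> real"
  assumes D: "D = density lborel (\<lambda>w. ennreal (f w))" and f [measurable]: "f \<in> borel_measurable borel"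
    and f_nonneg: "\<And>w. 0 \<le> f w" and k [measurable]: "k \<in> borel_measurable borel"
    and cont: "continuous_on {a..b} f" "continuous_on {a..b} k"
    and G: "\<And>y. a \<le> y \<Longrightarrow> y \<le> b \<Longrightarrow> G y = c + (\<integral>u. indicator {a..y} u * k u \<partial>D)"
    and w: "a < w" "w < b"
  shows "(G has_real_derivative k w * f w) (at w)"
proof -
  have cont_kf: "continuous_on {a..b} (\<lambda>u. k u * f u)"
    using cont by (intro continuous_intros)
  have G_eq: "G y = c + integral {a..y} (\<lambda>u. k u * f u)" if "a \<le> y" "y \<le> b" for y
  proof -
    have "(\<integral>u. indicator {a..y} u * k u \<partial>D) = (LINT u:{a..y}|lborel. k u * f u)"
      unfolding D set_lebesgue_integral_def
      by (subst integral_density) (auto simp: f_nonneg mult_ac intro!: Bochner_Integration.integral_cong)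
    also have "\<dots> = integral {a..y} (\<lambda>u. k u * f u)"
      by (intro set_borel_integral_eq_integral borel_integrable_atLeastAtMost'
            continuous_on_subset[OF cont_kf]) (use that in auto)
    finally show ?thesis using G[OF that] by simp
  qed
  have "((\<lambda>y. c + integral {a..y} (\<lambda>u. k u * f u)) has_real_derivative k w * f w) (at w within {a..b})"
    using integral_has_real_derivative[OF cont_kf, of w] w by (auto intro!: derivative_eq_intros)
  then have "((\<lambda>y. c + integral {a..y} (\<lambda>u. k u * f u)) has_real_derivative k w * f w) (at w)"
    using w by (simp add: at_within_Icc_at)
  then show ?thesis
  proof (rule DERIV_cong_ev[THEN iffD2, rotated -1])
    show "\<forall>\<^sub>F y in nhds w. G y = c + integral {a..y} (\<lambda>u. k u * f u)"
      using eventually_nhds_in_open[of "{a<..<b}" w] w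
      by (auto elim!: eventually_mono intro!: G_eq)
  qed auto
qed

locale regular_instance =
  fixes I :: alloc_instance and wbar M :: real
  assumes valid: "valid_instance I"
    and regular: "regular_sizes I wbar"
    and ratio: "ratio_const I wbar M"
begin

abbreviation F :: "nat \<Rightarrow> real \<Rightarrow> real" where "F i \<equiv> size_cdf I i"
abbreviation P :: "nat \<Rightarrow> real \<Rightarrow> real" where "P i \<equiv> partial_mean I i 0"
abbreviation p :: "nat \<Rightarrow> real" where "p i \<equiv> type_prob I i"

lemma prob_size_law: "prob_space (size_law I i)"
  using valid by (simp add: valid_instance_def)

lemma sets_size_law [simp, measurable_cong]: "sets (size_law I i) = sets borel"
  using valid by (simp add: valid_instance_def)

lemma space_size_law [simp]: "space (size_law I i) = UNIV"
  using sets_eq_imp_space_eq[OF sets_size_law] by simp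

lemma real_distribution_size_law: "real_distribution (size_law I i)"
proof -
  interpret prob_space "size_law I i" by (rule prob_size_law)
  show ?thesis by unfold_locales auto
qed

lemma size_law_AE_pos: "i \<in> types I \<Longrightarrow> AE u in size_law I i. 0 < u"
  using valid by (simp add: valid_instance_def)

lemma wbar_pos: "0 < wbar"
  using regular by (simp add: regular_sizes_def)

lemma M_gt_1: "1 < M"
  using ratio by (simp add: ratio_const_def)

lemma p_pos: "i \<in> types I \<Longrightarrow> 0 < p i"
  using valid by (simp add: valid_instance_def pmf_positive)

lemma p_zero: "i \<notin> types I \<Longrightarrow> p i = 0"
  using valid set_pmf_iff[of i "type_pmf I"] by (auto simp: valid_instance_def)

lemma size_law_integrable_bounded:
  fixes g :: "real \<Rightarrow> real"
  assumes "g \<in> borel_measurable borel" "AE u in size_law I i. \<bar>g u\<bar> \<le> B"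
  shows "integrable (size_law I i) g"
proof -
  interpret prob_space "size_law I i" by (rule prob_size_law)
  show ?thesis using assms by (intro integrable_const_bound[of g B]) auto
qed

lemma size_law_density:
  assumes "i \<in> types I"
  obtains f where "f \<in> borel_measurable borel" "\<And>w. 0 \<le> f w"
    "size_law I i = density lborel (\<lambda>w. ennreal (f w))"
    "continuous_on {0<..<wbar} f" "mono_on {0<..<wbar} (\<lambda>w. w ^ 3 * f w)"
  using regular assms unfolding regular_sizes_def by blast

lemma size_law_no_atom:
  assumes "i \<in> types I"
  shows "measure (size_law I i) {x} = 0"
proof -
  obtain f where f: "f \<in> borel_measurable borel"
    and D: "size_law I i = density lborel (\<lambda>w. ennreal (f w))"
    using size_law_density[OF assms] by blast
  have "AE y in lborel. y \<in> {x} \<longrightarrow> ennreal (f y) = 0"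
    using AE_not_in[OF finite_imp_null_set_lborel[of "{x}"], simplified] by eventually_elim simp
  then have "{x} \<in> null_sets (size_law I i)"
    unfolding D using f by (subst null_sets_density_iff) auto
  then show ?thesis by (simp add: measure_def null_setsD1)
qed

lemma isCont_F: "i \<in> types I \<Longrightarrow> isCont (F i) x"
  using real_distribution.finite_borel_measure_M[OF real_distribution_size_law]
    finite_borel_measure.isCont_cdf size_law_no_atom by blast

lemma F_le_1: "F i x \<le> 1"
  using real_distribution.cdf_bounded_prob[OF real_distribution_size_law] .

lemma F_mono: "x \<le> y \<Longrightarrow> F i x \<le> F i y"
  using finite_borel_measure.cdf_nondecreasing
    real_distribution.finite_borel_measure_M[OF real_distribution_size_law] by blast

lemma F_0:
  assumes "i \<in> types I"
  shows "F i 0 = 0"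
proof -
  have "AE u in size_law I i. u \<notin> {..0}"
    using size_law_AE_pos[OF assms] by eventually_elim simp
  then have "{..0} \<in> null_sets (size_law I i)" by (subst AE_iff_null_sets) auto
  then show ?thesis by (simp add: cdf_def measure_def null_setsD1)
qed

lemma F_eq_integral:
  assumes "i \<in> types I" "0 \<le> x"
  shows "F i x = (\<integral>u. indicator {0..x} u \<partial>size_law I i)"
proof -
  interpret prob_space "size_law I i" by (rule prob_size_law)
  have "F i x = (\<integral>u. indicator {..x} u \<partial>size_law I i)" by (simp add: cdf_def)
  also have "\<dots> = (\<integral>u. indicator {0..x} u \<partial>size_law I i)"
    using size_law_AE_pos[OF assms(1)]
    by (intro integral_cong_AE) (auto elim!: eventually_mono simp: indicator_def)
  finally show ?thesis .
qed

lemma partial_mean_eq: "partial_mean I i x y = (\<integral>u. indicator {x..y} u * u \<partial>size_law I i)"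
  by (simp add: partial_mean_def set_lebesgue_integral_def)

lemma partial_integrable: "integrable (size_law I i) (\<lambda>u. indicator {x..y} u * u)"
  by (rule size_law_integrable_bounded[where B = "\<bar>x\<bar> + \<bar>y\<bar>"]) (auto simp: indicator_def)

lemma split_at:
  fixes k :: "real \<Rightarrow> real"
  assumes i: "i \<in> types I" and k [measurable]: "k \<in> borel_measurable borel"
    and int: "\<And>x y. integrable (size_law I i) (\<lambda>u. indicator {x..y} u * k u)"
    and xy: "0 \<le> x" "x \<le> y"
  shows "(\<integral>u. indicator {0..y} u * k u \<partial>size_law I i) =
    (\<integral>u. indicator {0..x} u * k u \<partial>size_law I i) + (\<integral>u. indicator {x..y} u * k u \<partial>size_law I i)"
proof -
  interpret prob_space "size_law I i" by (rule prob_size_law)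
  have "AE u in size_law I i. u \<noteq> x"
    using size_law_no_atom[OF i, of x] by (subst AE_iff_measurable[of "{x}"]) (auto simp: emeasure_eq_measure)
  then have "(\<integral>u. indicator {0..y} u * k u \<partial>size_law I i) =
      (\<integral>u. indicator {0..x} u * k u + indicator {x..y} u * k u \<partial>size_law I i)"
    using xy by (intro integral_cong_AE) (auto elim!: eventually_mono simp: indicator_def)
  then show ?thesis by (simp add: int)
qed

lemma P_diff: "i \<in> types I \<Longrightarrow> 0 \<le> x \<Longrightarrow> x \<le> y \<Longrightarrow> P i y - P i x = partial_mean I i x y"
  using split_at[of i "\<lambda>u. u" x y] partial_integrable by (simp add: partial_mean_eq)

lemma indicator_integrable [simp]: "integrable (size_law I i) (indicat_real {x..y})"
  by (rule size_law_integrable_bounded[where B = 1]) (auto simp: indicator_def)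

lemma F_diff:
  assumes "i \<in> types I" "0 \<le> x" "x \<le> y"
  shows "F i y - F i x = (\<integral>u. indicator {x..y} u \<partial>size_law I i)"
  using split_at[of i "\<lambda>u. 1" x y] assms by (simp add: F_eq_integral)

lemma P_diff_bounds:
  assumes "i \<in> types I" "0 \<le> x" "x \<le> y"
  shows "x * (F i y - F i x) \<le> P i y - P i x" "P i y - P i x \<le> y * (F i y - F i x)"
proof -
  have "(\<integral>u. x * indicator {x..y} u \<partial>size_law I i) \<le> (\<integral>u. indicator {x..y} u * u \<partial>size_law I i)"
    by (intro integral_mono partial_integrable integrable_mult_right indicator_integrable)
       (auto simp: indicator_def)
  then show "x * (F i y - F i x) \<le> P i y - P i x"
    unfolding P_diff[OF assms] F_diff[OF assms] unfolding partial_mean_eq by simp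
  have "(\<integral>u. indicator {x..y} u * u \<partial>size_law I i) \<le> (\<integral>u. y * indicator {x..y} u \<partial>size_law I i)"
    by (intro integral_mono partial_integrable integrable_mult_right indicator_integrable)
       (auto simp: indicator_def)
  then show "P i y - P i x \<le> y * (F i y - F i x)"
    unfolding P_diff[OF assms] F_diff[OF assms] unfolding partial_mean_eq by simp
qed

lemma P_mono: "i \<in> types I \<Longrightarrow> 0 \<le> x \<Longrightarrow> x \<le> y \<Longrightarrow> P i x \<le> P i y"
  using P_diff_bounds(1)[of i x y] F_mono[of x y i]
  by (smt (verit) mult_nonneg_nonneg)

lemma P_0 [simp]: "P i 0 = 0"
proof -
  have "(\<lambda>u. indicator {0..0} u * u) = (\<lambda>u::real. 0::real)" by (auto simp: indicator_def)
  then show ?thesis by (simp only: partial_mean_eq) simp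
qed

lemma P_nonneg: "i \<in> types I \<Longrightarrow> 0 \<le> x \<Longrightarrow> 0 \<le> P i x"
  using P_mono[of i 0 x] by simp

lemma P_cont:
  assumes i: "i \<in> types I"
  shows "continuous_on {0..b} (P i)"
  unfolding continuous_on_def
proof
  fix x assume x: "x \<in> {0..b}"
  have bound: "\<bar>P i y - P i x\<bar> \<le> b * \<bar>F i y - F i x\<bar>" if y: "y \<in> {0..b}" for y
  proof (cases "x \<le> y")
    case True
    have "y * (F i y - F i x) \<le> b * (F i y - F i x)"
      using y F_mono[OF True, of i] by (intro mult_right_mono) auto
    then show ?thesis using P_diff_bounds[OF i, of x y] x True F_mono[OF True, of i] P_mono[OF i, of x y]
      by auto
  next
    case False
    then have yx: "y \<le> x" by simp
    have "x * (F i x - F i y) \<le> b * (F i x - F i y)"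
      using x F_mono[OF yx, of i] by (intro mult_right_mono) auto
    then show ?thesis using P_diff_bounds[OF i, of y x] y yx F_mono[OF yx, of i] P_mono[OF i, of y x]
      by auto
  qed
  have "(F i \<longlongrightarrow> F i x) (at x within {0..b})"
    using isCont_F[OF i, of x] unfolding isCont_def by (rule tendsto_within_subset) simp
  then have "((\<lambda>y. b * \<bar>F i y - F i x\<bar>) \<longlongrightarrow> b * \<bar>F i x - F i x\<bar>) (at x within {0..b})"
    by (intro tendsto_intros)
  then have lim: "((\<lambda>y. b * \<bar>F i y - F i x\<bar>) \<longlongrightarrow> 0) (at x within {0..b})" by simp
  have "((\<lambda>y. P i y - P i x) \<longlongrightarrow> 0) (at x within {0..b})"
    by (rule Lim_null_comparison[OF _ lim]) (use bound in \<open>auto simp: eventually_at_filter\<close>)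
  then show "(P i \<longlongrightarrow> P i x) (at x within {0..b})" by (simp add: LIM_zero_iff)
qed

text \<open>
  The density is positive throughout \<open>(0, wbar)\<close>: a zero at \<open>w\<close> would, by monotonicity of
  \<open>w ^ 3 * f w\<close>, extend to all smaller sizes and leave no mass below \<open>w\<close>.
\<close>

lemma size_profile_size_law:
  assumes i: "i \<in> types I"
  shows "\<exists>f. size_profile (F i) (P i) f wbar M"
proof -
  obtain f where f [measurable]: "f \<in> borel_measurable borel" and f_nonneg: "\<And>w. 0 \<le> f w"
    and D: "size_law I i = density lborel (\<lambda>w. ennreal (f w))"
    and cont: "continuous_on {0<..<wbar} f" and cube: "mono_on {0<..<wbar} (\<lambda>w. w ^ 3 * f w)"
    using size_law_density[OF i] by blast
  have f_pos: "0 < f v" if v: "0 < v" "v < wbar" for v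
  proof (rule ccontr)
    assume "\<not> 0 < f v"
    then have "f v = 0" using f_nonneg[of v] by simp
    then have "f x = 0" if "0 < x" "x \<le> v" for x
      using mono_onD[OF cube, of x v] that v f_nonneg[of x] by (auto simp: mult_le_0_iff)
    then have zero: "f x * indicator {0..v} x = 0" if "x \<noteq> 0" for x
      using that by (auto simp: indicator_def)
    have "(\<integral>u. indicat_real {0..v} u \<partial>size_law I i) = (\<integral>u. f u * indicator {0..v} u \<partial>lborel)"
      unfolding D by (subst integral_density) (auto simp: f_nonneg)
    also have "\<dots> = integral\<^sup>L lborel (\<lambda>u :: real. 0 :: real)"
    proof (rule integral_cong_AE)
      show "AE u in lborel. f u * indicator {0..v} u = 0"
        using AE_not_in[OF finite_imp_null_set_lborel[of "{0}"], simplified]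
        by eventually_elim (rule zero)
    qed auto
    finally have "(\<integral>u. indicat_real {0..v} u \<partial>size_law I i) = 0" by simp
    then have "F i v = 0" using F_eq_integral[OF i, of v] v by simp
    then show False using regular i v by (force simp: regular_sizes_def)
  qed
  have diff: "(F i has_real_derivative f v) (at v) \<and> (P i has_real_derivative v * f v) (at v)"
    if v: "0 < v" "v < wbar" for v
  proof -
    define a b where "a = v / 2" and "b = (v + wbar) / 2"
    have ab: "0 < a" "a < v" "v < b" "b < wbar" using v by (auto simp: a_def b_def)
    have cf: "continuous_on {a..b} f" using cont by (rule continuous_on_subset) (use ab in auto)
    have FG: "F i y = F i a + (\<integral>u. indicator {a..y} u * 1 \<partial>size_law I i)" if "a \<le> y" "y \<le> b" for y
      using F_diff[OF i, of a y] ab that by simp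
    have PG: "P i y = P i a + (\<integral>u. indicator {a..y} u * u \<partial>size_law I i)" if "a \<le> y" "y \<le> b" for y
      using P_diff[OF i, of a y] ab that by (simp add: partial_mean_eq)
    have "(F i has_real_derivative 1 * f v) (at v)"
      by (rule deriv_integral_density[where k = "\<lambda>_. 1", OF D f f_nonneg _ cf _ FG]) (use ab in auto)
    moreover have "(P i has_real_derivative v * f v) (at v)"
      by (rule deriv_integral_density[where k = "\<lambda>u. u", OF D f f_nonneg _ cf _ PG]) (use ab in auto)
    ultimately show ?thesis by simp
  qed
  show ?thesis
  proof (intro exI[of _ f], unfold_locales)
    show "continuous_on {0..wbar} (F i)"
      using isCont_F[OF i] by (simp add: continuous_at_imp_continuous_on)
    show "w2 * (F i w2 - F i w1) / (P i w2 - P i w1) \<le> M" if "0 < w1" "w1 < w2" "w2 < wbar" for w1 w2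
      using ratio i that P_diff[OF i, of w1 w2] by (simp add: ratio_const_def)
  qed (use wbar_pos M_gt_1 f_pos cube diff P_cont[OF i] F_0[OF i] F_le_1 in auto)
qed

end

section \<open>Integration over requests and over request sequences\<close>

\<comment> \<open>keeps index sets in the form \<open>{1..n}\<close>\<close>
declare One_nat_def [simp del]

context regular_instance
begin

definition good :: "request \<Rightarrow> bool" where
  "good q \<longleftrightarrow> fst q \<in> types I \<and> 0 < snd q"

abbreviation request_space :: "request measure" where
  "request_space \<equiv> count_space UNIV \<Otimes>\<^sub>M borel"

lemma Pair_measurable_request: "Pair i \<in> size_law I i \<rightarrow>\<^sub>M request_space"
  by measurable

lemma request_kernel:
  "(\<lambda>i. distr (size_law I i) request_space (Pair i)) \<in> measurable (measure_pmf (type_pmf I)) (subprob_algebra request_space)"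
  by (auto intro!: prob_space_imp_subprob_space prob_space.prob_space_distr prob_size_law Pair_measurable_request
      simp: space_subprob_algebra)

lemma sets_request_law [simp, measurable_cong]: "sets (request_law I) = sets request_space"
  unfolding request_law_def by (rule sets_bind[OF sets_kernel[OF request_kernel]]) auto

lemma space_request_law [simp]: "space (request_law I) = UNIV"
  using sets_eq_imp_space_eq[OF sets_request_law] by (simp add: space_pair_measure)

lemma nn_integral_request_law:
  assumes [measurable]: "g \<in> borel_measurable request_space"
  shows "(\<integral>\<^sup>+q. g q \<partial>request_law I) = (\<Sum>i\<in>types I. ennreal (p i) * (\<integral>\<^sup>+u. g (i, u) \<partial>size_law I i))"
proof -
  have "(\<integral>\<^sup>+q. g q \<partial>request_law I) =
      (\<integral>\<^sup>+i. \<integral>\<^sup>+u. g (i, u) \<partial>size_law I i \<partial>measure_pmf (type_pmf I))"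
    unfolding request_law_def
    by (subst nn_integral_bind[OF assms request_kernel])
       (intro nn_integral_cong nn_integral_distr Pair_measurable_request, simp)
  also have "\<dots> = (\<Sum>i\<in>types I. (\<integral>\<^sup>+u. g (i, u) \<partial>size_law I i) * ennreal (p i))"
  proof (rule nn_integral_measure_pmf_support)
    fix i assume "i \<in> set_pmf (type_pmf I)" "i \<notin> types I"
    then show "(\<integral>\<^sup>+u. g (i, u) \<partial>size_law I i) = 0" using valid by (simp add: valid_instance_def)
  qed (auto intro: zero_le)
  finally show ?thesis by (simp add: mult.commute)
qed

lemma sum_type_prob: "(\<Sum>i\<in>types I. p i) = 1"
  using valid by (intro sum_pmf_eq_1) (auto simp: valid_instance_def)

lemma prob_request_law: "prob_space (request_law I)"
proof
  have "emeasure (size_law I i) UNIV = 1" for i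
    using prob_space.emeasure_space_1[OF prob_size_law[of i]] by simp
  then have "(\<integral>\<^sup>+q. 1 \<partial>request_law I) = (\<Sum>i\<in>types I. ennreal (p i))"
    by (subst nn_integral_request_law) auto
  also have "\<dots> = 1" using sum_type_prob by (simp add: sum_ennreal)
  finally show "emeasure (request_law I) (space (request_law I)) = 1" by simp
qed

lemma integral_request_law:
  fixes g :: "request \<Rightarrow> real"
  assumes g: "integrable (request_law I) g"
  shows "(\<integral>q. g q \<partial>request_law I) = (\<Sum>i\<in>types I. p i * (\<integral>u. g (i, u) \<partial>size_law I i))"
    and "i \<in> types I \<Longrightarrow> integrable (size_law I i) (\<lambda>u. g (i, u))"
proof -
  have gm [measurable]: "g \<in> borel_measurable request_space"
    using borel_measurable_integrable[OF g] by (simp cong: measurable_cong_sets)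
  have part: "enn2real (\<integral>\<^sup>+q. ennreal (h q) \<partial>request_law I) =
        (\<Sum>i\<in>types I. p i * enn2real (\<integral>\<^sup>+u. ennreal (h (i, u)) \<partial>size_law I i)) \<and>
      (\<forall>i\<in>types I. (\<integral>\<^sup>+u. ennreal (h (i, u)) \<partial>size_law I i) \<noteq> \<infinity>)"
    if [measurable]: "h \<in> borel_measurable request_space"
      and fin: "(\<integral>\<^sup>+q. ennreal (h q) \<partial>request_law I) \<noteq> \<infinity>" for h :: "request \<Rightarrow> real"
  proof -
    let ?A = "\<lambda>i. \<integral>\<^sup>+u. ennreal (h (i, u)) \<partial>size_law I i"
    have eq: "(\<integral>\<^sup>+q. ennreal (h q) \<partial>request_law I) = (\<Sum>i\<in>types I. ennreal (p i) * ?A i)"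
      by (subst nn_integral_request_law) auto
    then have fin_i: "ennreal (p i) * ?A i < \<infinity>" if "i \<in> types I" for i
      using fin that by (auto simp: less_top)
    then have "?A i \<noteq> \<infinity>" if "i \<in> types I" for i
      using that p_pos[OF that] by (fastforce simp: ennreal_mult_less_top)
    moreover have "enn2real (\<Sum>i\<in>types I. ennreal (p i) * ?A i) = (\<Sum>i\<in>types I. p i * enn2real (?A i))"
      by (subst enn2real_sum) (use fin_i in \<open>auto simp: enn2real_mult\<close>)
    ultimately show ?thesis unfolding eq by blast
  qed
  have plus: "(\<integral>\<^sup>+q. ennreal (g q) \<partial>request_law I) \<noteq> \<infinity>"
    and minus: "(\<integral>\<^sup>+q. ennreal (- g q) \<partial>request_law I) \<noteq> \<infinity>"
    using g by (auto simp: real_integrable_def)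
  show int: "integrable (size_law I i) (\<lambda>u. g (i, u))" if "i \<in> types I" for i
    using part[OF gm plus] part[OF _ minus] that by (auto simp: real_integrable_def)
  show "(\<integral>q. g q \<partial>request_law I) = (\<Sum>i\<in>types I. p i * (\<integral>u. g (i, u) \<partial>size_law I i))"
    using part[OF gm plus] part[OF _ minus] int
    by (simp add: real_lebesgue_integral_def[OF g] real_lebesgue_integral_def
        right_diff_distrib sum_subtractf)
qed

lemma integral_request_law_type:
  fixes g :: "real \<Rightarrow> real"
  assumes i: "i \<in> types I" and [measurable]: "g \<in> borel_measurable borel"
    and bounded: "AE u in size_law I i. \<bar>g u\<bar> \<le> B"
  shows "integrable (request_law I) (\<lambda>q. if fst q = i then g (snd q) else 0)"
    and "(\<integral>q. (if fst q = i then g (snd q) else 0) \<partial>request_law I) = p i * (\<integral>u. g u \<partial>size_law I i)"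
proof -
  let ?h = "\<lambda>q. if fst q = i then g (snd q) else 0"
  interpret prob_space "size_law I i" by (rule prob_size_law)
  have "(\<integral>\<^sup>+u. ennreal \<bar>g u\<bar> \<partial>size_law I i) \<le> (\<integral>\<^sup>+u. ennreal B \<partial>size_law I i)"
    using bounded by (intro nn_integral_mono_AE) (auto elim!: eventually_mono simp: ennreal_leI)
  also have "\<dots> < \<infinity>" using emeasure_space_1 by simp
  finally have fin: "(\<integral>\<^sup>+u. ennreal \<bar>g u\<bar> \<partial>size_law I i) < \<infinity>" .
  have [measurable]: "?h \<in> borel_measurable request_space" by measurable
  have "(\<integral>\<^sup>+q. ennreal \<bar>?h q\<bar> \<partial>request_law I) =
      (\<Sum>k\<in>types I. ennreal (p k) * (\<integral>\<^sup>+u. ennreal \<bar>?h (k, u)\<bar> \<partial>size_law I k))"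
    by (rule nn_integral_request_law) measurable
  also have "\<dots> = (\<Sum>k\<in>types I. if k = i then ennreal (p i) * (\<integral>\<^sup>+u. ennreal \<bar>g u\<bar> \<partial>size_law I i) else 0)"
    by (intro sum.cong refl) simp
  also have "\<dots> < \<infinity>" using fin i by (simp add: ennreal_mult_less_top)
  finally show int: "integrable (request_law I) ?h"
    by (intro integrableI_bounded) simp_all
  have "(\<integral>q. ?h q \<partial>request_law I) = (\<Sum>k\<in>types I. if k = i then p i * (\<integral>u. g u \<partial>size_law I i) else 0)"
    unfolding integral_request_law(1)[OF int] by (intro sum.cong refl) simp
  then show "(\<integral>q. ?h q \<partial>request_law I) = p i * (\<integral>u. g u \<partial>size_law I i)"
    using i by simp
qed

lemma good_measurable [measurable]: "Measurable.pred request_space good"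
proof -
  have "{q \<in> space request_space. good q} = types I \<times> {0<..}"
    by (auto simp: good_def space_pair_measure)
  then show ?thesis by (simp add: pred_def)
qed

lemma AE_good: "AE q in request_law I. good q"
proof -
  have bad [measurable]: "(\<lambda>q. indicator {q. \<not> good q} q :: ennreal) \<in> borel_measurable request_space"
    by measurable
  have "(\<integral>\<^sup>+u. indicator {q. \<not> good q} (i, u) \<partial>size_law I i) = 0" if "i \<in> types I" for i
  proof -
    have "(\<integral>\<^sup>+u. indicator {q. \<not> good q} (i, u) \<partial>size_law I i) = (\<integral>\<^sup>+u. 0 \<partial>size_law I i)"
      using size_law_AE_pos[OF that] that
      by (intro nn_integral_cong_AE) (auto elim!: eventually_mono simp: good_def indicator_def)
    then show ?thesis by simp
  qed
  then have "(\<integral>\<^sup>+q. indicator {q. \<not> good q} q \<partial>request_law I) = 0"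
    by (simp add: nn_integral_request_law[OF bad])
  then show ?thesis
    by (subst (asm) nn_integral_0_iff_AE) (auto elim!: eventually_mono simp: indicator_eq_0_iff)
qed

lemma prob_sequences: "prob_space (\<Pi>\<^sub>M t\<in>J. request_law I)"
  by (intro prob_space_PiM prob_request_law)

lemma AE_good_sequence:
  assumes "finite J"
  shows "AE X in (\<Pi>\<^sub>M t\<in>J. request_law I). \<forall>t\<in>J. good (X t)"
  using assms by (intro eventually_ball_finite ballI AE_PiM_component prob_request_law AE_good)

lemma prob_sample_space: "prob_space (sample_space I)"
  unfolding sample_space_def by (rule prob_sequences)

lemma AE_good_sample: "AE \<omega> in sample_space I. \<forall>t\<in>periods I. good (\<omega> t)"
  unfolding sample_space_def by (rule AE_good_sequence) simp

lemma update_measurable: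
  assumes "t \<in> periods I"
  shows "(\<lambda>(q, X). X(t := q)) \<in> request_law I \<Otimes>\<^sub>M (\<Pi>\<^sub>M s\<in>periods I - {t}. request_law I)
    \<rightarrow>\<^sub>M sample_space I"
proof -
  have ins: "insert t (periods I - {t}) = periods I" using assms by auto
  show ?thesis
    unfolding sample_space_def
    using measurable_pair_swap_iff[THEN iffD1,
        OF measurable_add_dim[of t "periods I - {t}" "\<lambda>_. request_law I", unfolded ins]]
    by (simp only: split_def fst_conv snd_conv)
qed

text \<open>
  Resampling the request of period \<open>t\<close> independently of the others: the form in which
  independence of the requests is used.
\<close>

lemma sample_space_resample:
  fixes h :: "(nat \<Rightarrow> request) \<Rightarrow> real"
  assumes t: "t \<in> periods I" and h: "integrable (sample_space I) h"
  defines "rest \<equiv> (\<Pi>\<^sub>M s\<in>periods I - {t}. request_law I)"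
  shows "integrable rest (\<lambda>X. \<integral>q. h (X(t := q)) \<partial>request_law I)"
    and "(\<integral>\<omega>. h \<omega> \<partial>sample_space I) = (\<integral>X. \<integral>q. h (X(t := q)) \<partial>request_law I \<partial>rest)"
    and "integrable (request_law I) (\<lambda>q. \<integral>X. h (X(t := q)) \<partial>rest)"
    and "(\<integral>\<omega>. h \<omega> \<partial>sample_space I) = (\<integral>q. \<integral>X. h (X(t := q)) \<partial>rest \<partial>request_law I)"
proof -
  interpret R: prob_space "request_law I" by (rule prob_request_law)
  interpret X: prob_space rest unfolding rest_def by (rule prob_sequences)
  interpret pair_sigma_finite "request_law I" rest ..
  have ins: "insert t (periods I - {t}) = periods I" using t by auto
  note upd = update_measurable[OF t, folded rest_def]
  have eq: "distr (request_law I \<Otimes>\<^sub>M rest) (sample_space I) (\<lambda>(q, X). X(t := q)) = sample_space I"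
    using distr_pair_PiM_eq_PiM[of "periods I - {t}" "\<lambda>_. request_law I" t] prob_request_law
    unfolding sample_space_def rest_def ins by simp
  have hm: "h \<in> borel_measurable (sample_space I)" using h by auto
  have int: "integrable (request_law I \<Otimes>\<^sub>M rest) (\<lambda>(q, X). h (X(t := q)))"
    using iffD1[OF integrable_distr_eq[OF upd hm, unfolded eq] h] by (simp only: split_def)
  have E: "(\<integral>\<omega>. h \<omega> \<partial>sample_space I) = (\<integral>(q, X). h (X(t := q)) \<partial>(request_law I \<Otimes>\<^sub>M rest))"
    using integral_distr[OF upd hm, unfolded eq] by (simp only: split_def)
  show "integrable rest (\<lambda>X. \<integral>q. h (X(t := q)) \<partial>request_law I)"
    by (rule integrable_snd[OF int])
  show "integrable (request_law I) (\<lambda>q. \<integral>X. h (X(t := q)) \<partial>rest)"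
    by (rule integrable_fst[OF int])
  show "(\<integral>\<omega>. h \<omega> \<partial>sample_space I) = (\<integral>X. \<integral>q. h (X(t := q)) \<partial>request_law I \<partial>rest)"
    unfolding E by (rule integral_snd[OF int, symmetric])
  show "(\<integral>\<omega>. h \<omega> \<partial>sample_space I) = (\<integral>q. \<integral>X. h (X(t := q)) \<partial>rest \<partial>request_law I)"
    unfolding E by (rule integral_fst[OF int, symmetric])
qed

lemma sample_space_resample_ge:
  fixes h :: "(nat \<Rightarrow> request) \<Rightarrow> real"
  assumes t: "t \<in> periods I" and h: "integrable (sample_space I) h"
    and ge: "\<And>X. \<forall>s\<in>periods I - {t}. good (X s) \<Longrightarrow>
      L \<le> (\<integral>q. h (X(t := q)) \<partial>request_law I)"
  shows "L \<le> (\<integral>\<omega>. h \<omega> \<partial>sample_space I)"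
proof -
  let ?rest = "\<Pi>\<^sub>M s\<in>periods I - {t}. request_law I"
  interpret X: prob_space ?rest by (rule prob_sequences)
  have "L = (\<integral>X. L \<partial>?rest)" using X.prob_space by simp
  also have "\<dots> \<le> (\<integral>X. \<integral>q. h (X(t := q)) \<partial>request_law I \<partial>?rest)"
  proof (rule integral_mono_AE)
    show "AE X in ?rest. L \<le> (\<integral>q. h (X(t := q)) \<partial>request_law I)"
      using AE_good_sequence[OF finite_Diff[OF finite_atLeastAtMost]] by eventually_elim (rule ge)
  qed (simp_all add: sample_space_resample(1)[OF t h])
  finally show ?thesis using sample_space_resample(2)[OF t h] by simp
qed

end

section \<open>The fluid relaxation bounds the prophet\<close>

context regular_instance
begin

text \<open>Encoding allocations as sets of period-resource pairs makes the candidates a finite set.\<close>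

definition alloc_of :: "(nat \<times> nat) set \<Rightarrow> nat \<Rightarrow> nat \<Rightarrow> real" where
  "alloc_of A t j = of_bool ((t, j) \<in> A)"

definition prophet_optimal :: "(nat \<Rightarrow> request) \<Rightarrow> (nat \<times> nat) set \<Rightarrow> bool" where
  "prophet_optimal \<omega> A \<longleftrightarrow> A \<in> Pow (periods I \<times> resources I) \<and> feasible_alloc I \<omega> (alloc_of A) \<and>
     (\<forall>B\<in>Pow (periods I \<times> resources I). feasible_alloc I \<omega> (alloc_of B) \<longrightarrow>
        alloc_value I \<omega> (alloc_of B) \<le> alloc_value I \<omega> (alloc_of A))"

lemma feasible_alloc_cong:
  assumes "\<And>t j. t \<in> periods I \<Longrightarrow> j \<in> resources I \<Longrightarrow> x t j = y t j"
  shows "feasible_alloc I \<omega> x \<longleftrightarrow> feasible_alloc I \<omega> y" "alloc_value I \<omega> x = alloc_value I \<omega> y"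
proof -
  have "(\<Sum>t\<in>periods I. coef I (fst (\<omega> t)) j * snd (\<omega> t) * x t j) =
      (\<Sum>t\<in>periods I. coef I (fst (\<omega> t)) j * snd (\<omega> t) * y t j)" if "j \<in> resources I" for j
    using assms that by (intro sum.cong) auto
  moreover have "(\<Sum>j\<in>resources I. x t j) = (\<Sum>j\<in>resources I. y t j)" if "t \<in> periods I" for t
    using assms that by (intro sum.cong) auto
  ultimately show "feasible_alloc I \<omega> x \<longleftrightarrow> feasible_alloc I \<omega> y"
    using assms by (auto simp: feasible_alloc_def)
  show "alloc_value I \<omega> x = alloc_value I \<omega> y"
    unfolding alloc_value_def using assms by (intro sum.cong refl) auto
qed

lemma feasible_alloc_as_set:
  assumes "feasible_alloc I \<omega> x"
  obtains A where "A \<in> Pow (periods I \<times> resources I)" "feasible_alloc I \<omega> (alloc_of A)"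
    "alloc_value I \<omega> x = alloc_value I \<omega> (alloc_of A)"
proof
  let ?A = "{(t, j). t \<in> periods I \<and> j \<in> resources I \<and> x t j = 1}"
  show "?A \<in> Pow (periods I \<times> resources I)" by auto
  have eq: "x t j = alloc_of ?A t j" if "t \<in> periods I" "j \<in> resources I" for t j
  proof -
    have "x t j \<in> {0, 1}" using assms that unfolding feasible_alloc_def by blast
    then show ?thesis using that by (auto simp: alloc_of_def)
  qed
  show "feasible_alloc I \<omega> (alloc_of ?A)" using assms feasible_alloc_cong(1)[where x = x and y = "alloc_of ?A", OF eq] by blast
  show "alloc_value I \<omega> x = alloc_value I \<omega> (alloc_of ?A)" by (rule feasible_alloc_cong(2)[OF eq])
qed

lemma prophet_value_eq:
  assumes "prophet_optimal \<omega> A"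
  shows "prophet_value I \<omega> = alloc_value I \<omega> (alloc_of A)"
  unfolding prophet_value_def
proof (rule Max_eqI)
  have "{alloc_value I \<omega> x | x. feasible_alloc I \<omega> x} \<subseteq>
      (\<lambda>B. alloc_value I \<omega> (alloc_of B)) ` Pow (periods I \<times> resources I)"
  proof
    fix v assume "v \<in> {alloc_value I \<omega> x | x. feasible_alloc I \<omega> x}"
    then obtain x where x: "feasible_alloc I \<omega> x" "v = alloc_value I \<omega> x" by blast
    show "v \<in> (\<lambda>B. alloc_value I \<omega> (alloc_of B)) ` Pow (periods I \<times> resources I)"
      by (rule feasible_alloc_as_set[OF x(1)]) (simp add: x(2))
  qed
  then show "finite {alloc_value I \<omega> x | x. feasible_alloc I \<omega> x}"
    by (rule finite_subset) simp
next
  fix v assume "v \<in> {alloc_value I \<omega> x | x. feasible_alloc I \<omega> x}"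
  then obtain x where x: "feasible_alloc I \<omega> x" "v = alloc_value I \<omega> x" by blast
  show "v \<le> alloc_value I \<omega> (alloc_of A)"
    by (rule feasible_alloc_as_set[OF x(1)]) (use assms x(2) in \<open>simp add: prophet_optimal_def\<close>)
qed (use assms in \<open>auto simp: prophet_optimal_def\<close>)

lemma prophet_optimal_exists: "\<exists>A. prophet_optimal \<omega> A"
proof -
  let ?C = "{A \<in> Pow (periods I \<times> resources I). feasible_alloc I \<omega> (alloc_of A)}"
  let ?v = "\<lambda>A. alloc_value I \<omega> (alloc_of A)"
  have "finite ?C" by simp
  moreover have "{} \<in> ?C"
    using valid by (auto simp: feasible_alloc_def alloc_of_def valid_instance_def)
  ultimately have "Max (?v ` ?C) \<in> ?v ` ?C" by (intro Max_in) auto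
  then obtain A where A: "A \<in> ?C" "?v A = Max (?v ` ?C)" by auto
  then have "?v B \<le> ?v A" if "B \<in> ?C" for B
    using that \<open>finite ?C\<close> by simp
  with A(1) show ?thesis unfolding prophet_optimal_def by blast
qed

text \<open>
  A measurable choice of an optimal allocation: the first optimal one in an enumeration.  On the
  null set of sequences with an invalid request nothing is served, which keeps consumption bounded.
\<close>

definition prophet_choice :: "(nat \<Rightarrow> request) \<Rightarrow> nat \<Rightarrow> nat \<Rightarrow> real" where
  "prophet_choice \<omega> t j = (if \<forall>s\<in>periods I. good (\<omega> s) then
     alloc_of (from_nat_into (Pow (periods I \<times> resources I))
       (LEAST n. prophet_optimal \<omega> (from_nat_into (Pow (periods I \<times> resources I)) n))) t j else 0)"

lemma prophet_optimal_index:
  "\<exists>n. prophet_optimal \<omega> (from_nat_into (Pow (periods I \<times> resources I)) n)"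
proof -
  obtain A where A: "prophet_optimal \<omega> A" using prophet_optimal_exists by blast
  then have "A \<in> Pow (periods I \<times> resources I)" by (simp add: prophet_optimal_def)
  then obtain n where "from_nat_into (Pow (periods I \<times> resources I)) n = A"
    using from_nat_into_surj[OF countable_finite] by (metis finite_Pow_iff finite_SigmaI finite_atLeastAtMost)
  then show ?thesis using A by auto
qed

lemma prophet_choice_optimal:
  assumes "\<forall>s\<in>periods I. good (\<omega> s)"
  obtains A where "prophet_optimal \<omega> A" "prophet_choice \<omega> = alloc_of A"
  using LeastI_ex[OF prophet_optimal_index[of \<omega>]] assms
  by (intro that) (auto simp: prophet_choice_def fun_eq_iff)

lemma request_component_measurable [measurable]:
  assumes "t \<in> periods I"
  shows "(\<lambda>\<omega>. \<omega> t) \<in> sample_space I \<rightarrow>\<^sub>M request_space"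
    and "(\<lambda>\<omega>. fst (\<omega> t)) \<in> sample_space I \<rightarrow>\<^sub>M count_space UNIV"
    and "(\<lambda>\<omega>. snd (\<omega> t)) \<in> borel_measurable (sample_space I)"
proof -
  show c: "(\<lambda>\<omega>. \<omega> t) \<in> sample_space I \<rightarrow>\<^sub>M request_space"
    unfolding sample_space_def
    using measurable_component_singleton[OF assms, of "\<lambda>_. request_law I"]
    by (simp cong: measurable_cong_sets)
  show "(\<lambda>\<omega>. fst (\<omega> t)) \<in> sample_space I \<rightarrow>\<^sub>M count_space UNIV"
    by (rule measurable_compose[OF c measurable_fst])
  show "(\<lambda>\<omega>. snd (\<omega> t)) \<in> borel_measurable (sample_space I)"
    by (rule measurable_compose[OF c measurable_snd])
qed

lemma type_function_measurable [measurable]: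
  fixes g :: "nat \<Rightarrow> real"
  assumes "t \<in> periods I"
  shows "(\<lambda>\<omega>. g (fst (\<omega> t))) \<in> borel_measurable (sample_space I)"
  by (rule measurable_compose[OF request_component_measurable(2)[OF assms]]) simp

lemma good_sequence_measurable: "Measurable.pred (sample_space I) (\<lambda>\<omega>. \<forall>s\<in>periods I. good (\<omega> s))"
  by (intro pred_intros_finite measurable_compose[OF request_component_measurable(1) good_measurable]) auto

lemma alloc_value_measurable: "(\<lambda>\<omega>. alloc_value I \<omega> (alloc_of A)) \<in> borel_measurable (sample_space I)"
  unfolding alloc_value_def
  by (intro borel_measurable_sum borel_measurable_times type_function_measurable) auto

lemma pred_le_real:
  fixes f g :: "_ \<Rightarrow> real"
  assumes "f \<in> borel_measurable N" "g \<in> borel_measurable N"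
  shows "Measurable.pred N (\<lambda>w. f w \<le> g w)"
  using assms unfolding pred_def by (rule borel_measurable_le)

lemma prophet_optimal_measurable: "Measurable.pred (sample_space I) (\<lambda>\<omega>. prophet_optimal \<omega> A)"
proof -
  have feas: "Measurable.pred (sample_space I) (\<lambda>\<omega>. feasible_alloc I \<omega> (alloc_of B))" for B
    unfolding feasible_alloc_def
    by (intro pred_intros_logic pred_intros_finite pred_le_real borel_measurable_sum
        borel_measurable_times type_function_measurable
        request_component_measurable(3) borel_measurable_const | simp)+
  show ?thesis
    unfolding prophet_optimal_def
    by (intro pred_intros_logic pred_intros_finite feas alloc_value_measurable
        pred_le_real | simp)+
qed

lemma first_optimal_measurable:
  "(\<lambda>\<omega>. LEAST n. prophet_optimal \<omega> (from_nat_into (Pow (periods I \<times> resources I)) n))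
    \<in> sample_space I \<rightarrow>\<^sub>M count_space UNIV"
  by (intro measurable_Least prophet_optimal_measurable)

lemma prophet_value_measurable: "prophet_value I \<in> borel_measurable (sample_space I)"
proof -
  have "prophet_value I = (\<lambda>\<omega>. alloc_value I \<omega> (alloc_of (from_nat_into (Pow (periods I \<times> resources I))
      (LEAST n. prophet_optimal \<omega> (from_nat_into (Pow (periods I \<times> resources I)) n)))))"
    by (rule ext) (rule prophet_value_eq[OF LeastI_ex[OF prophet_optimal_index]])
  then show ?thesis
    using measurable_compose_countable[OF alloc_value_measurable first_optimal_measurable] by simp
qed

lemma prophet_choice_measurable [measurable]:
  "(\<lambda>\<omega>. prophet_choice \<omega> t j) \<in> borel_measurable (sample_space I)"
  unfolding prophet_choice_def
proof (rule measurable_If)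
  show "(\<lambda>\<omega>. alloc_of (from_nat_into (Pow (periods I \<times> resources I))
      (LEAST n. prophet_optimal \<omega> (from_nat_into (Pow (periods I \<times> resources I)) n))) t j)
      \<in> borel_measurable (sample_space I)"
    by (rule measurable_compose[OF first_optimal_measurable]) simp
qed (rule borel_measurable_const predE[OF good_sequence_measurable])+

lemma prophet_choice_bounds: "0 \<le> prophet_choice \<omega> t j" "prophet_choice \<omega> t j \<le> 1"
  by (auto simp: prophet_choice_def alloc_of_def)

lemma prophet_choice_zero: "\<not> (\<forall>s\<in>periods I. good (\<omega> s)) \<Longrightarrow> prophet_choice \<omega> t j = 0"
  by (simp only: prophet_choice_def if_False)

lemma prophet_choice_feasible:
  assumes "\<forall>s\<in>periods I. good (\<omega> s)"
  shows "feasible_alloc I \<omega> (prophet_choice \<omega>)"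
  by (rule prophet_choice_optimal[OF assms]) (simp add: prophet_optimal_def)

lemma prophet_choice_sum_le:
  assumes "t \<in> periods I"
  shows "(\<Sum>j\<in>resources I. prophet_choice \<omega> t j) \<le> 1"
proof (cases "\<forall>s\<in>periods I. good (\<omega> s)")
  case True
  then show ?thesis using prophet_choice_feasible[OF True] assms by (simp add: feasible_alloc_def)
qed (simp add: prophet_choice_zero)

lemma coef_pos: "i \<in> types I \<Longrightarrow> j \<in> resources I \<Longrightarrow> 0 < coef I i j"
  using valid by (simp add: valid_instance_def)

lemma rew_nonneg: "i \<in> types I \<Longrightarrow> j \<in> resources I \<Longrightarrow> 0 \<le> rew I i j"
  using valid by (simp add: valid_instance_def)

lemma cap_nonneg: "j \<in> resources I \<Longrightarrow> 0 \<le> cap I j"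
  using valid by (simp add: valid_instance_def)

lemma num_res_pos: "1 \<le> num_res I" and horizon_pos: "1 \<le> horizon I"
  using valid by (simp_all add: valid_instance_def)

lemma max_reward_ge: "j \<in> resources I \<Longrightarrow> rew I i j \<le> max_reward I i"
  by (simp add: max_reward_def)

lemma max_reward_nonneg: "i \<in> types I \<Longrightarrow> 0 \<le> max_reward I i"
  using rew_nonneg[of i 1] max_reward_ge[of 1 i] num_res_pos by force

lemma consumption_bounded:
  assumes t: "t \<in> periods I" and j: "j \<in> resources I"
  shows "0 \<le> coef I (fst (\<omega> t)) j * snd (\<omega> t) * prophet_choice \<omega> t j"
    and "coef I (fst (\<omega> t)) j * snd (\<omega> t) * prophet_choice \<omega> t j \<le> cap I j"
    and "(\<Sum>s\<in>periods I. coef I (fst (\<omega> s)) j * snd (\<omega> s) * prophet_choice \<omega> s j) \<le> cap I j"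
proof -
  let ?f = "\<lambda>s. coef I (fst (\<omega> s)) j * snd (\<omega> s) * prophet_choice \<omega> s j"
  have nn: "0 \<le> ?f s" if "s \<in> periods I" for s
  proof (cases "\<forall>s\<in>periods I. good (\<omega> s)")
    case True
    then have "good (\<omega> s)" using that by blast
    then show ?thesis
      using coef_pos[of "fst (\<omega> s)" j] j prophet_choice_bounds(1)[of \<omega> s j]
      by (intro mult_nonneg_nonneg) (auto simp: good_def)
  qed (simp add: prophet_choice_zero)
  then show "0 \<le> ?f t" using t by blast
  show sum: "(\<Sum>s\<in>periods I. ?f s) \<le> cap I j"
  proof (cases "\<forall>s\<in>periods I. good (\<omega> s)")
    case True
    then show ?thesis using prophet_choice_feasible[OF True] j by (simp add: feasible_alloc_def)
  qed (simp add: prophet_choice_zero cap_nonneg[OF j])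
  have "?f t \<le> (\<Sum>s\<in>periods I. ?f s)" using t nn by (intro member_le_sum) auto
  with sum show "?f t \<le> cap I j" by simp
qed

lemma prophet_reward_bounded:
  assumes t: "t \<in> periods I" and j: "j \<in> resources I"
  shows "\<bar>rew I (fst (\<omega> t)) j * prophet_choice \<omega> t j\<bar> \<le> (\<Sum>i\<in>types I. rew I i j)"
proof (cases "\<forall>s\<in>periods I. good (\<omega> s)")
  case True
  then have g: "fst (\<omega> t) \<in> types I" using t by (auto simp: good_def)
  have "rew I (fst (\<omega> t)) j * prophet_choice \<omega> t j \<le> rew I (fst (\<omega> t)) j * 1"
    using rew_nonneg[OF g j] prophet_choice_bounds by (intro mult_left_mono) auto
  also have "\<dots> \<le> (\<Sum>i\<in>types I. rew I i j)"
    using g rew_nonneg[OF _ j] by (auto intro!: member_le_sum[of _ "types I" "\<lambda>i. rew I i j"])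
  finally show ?thesis
    using rew_nonneg[OF g j] prophet_choice_bounds[of \<omega> t j] by simp
qed (simp add: prophet_choice_zero, intro sum_nonneg rew_nonneg j)

text \<open>
  The conditional probability, given that the request of period \<open>t\<close> is \<open>q\<close>, that the prophet
  serves it with resource \<open>j\<close>.
\<close>

definition prophet_response :: "nat \<Rightarrow> nat \<Rightarrow> request \<Rightarrow> real" where
  "prophet_response t j q =
     (\<integral>X. prophet_choice (X(t := q)) t j \<partial>(\<Pi>\<^sub>M s\<in>periods I - {t}. request_law I))"

lemma update_section_measurable:
  assumes "t \<in> periods I"
  shows "(\<lambda>X. X(t := q)) \<in> (\<Pi>\<^sub>M s\<in>periods I - {t}. request_law I) \<rightarrow>\<^sub>M sample_space I"
  using measurable_compose[OF measurable_Pair1' update_measurable[OF assms], of q]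
  by (simp add: space_pair_measure)

lemma prophet_response_measurable:
  assumes "t \<in> periods I"
  shows "prophet_response t j \<in> borel_measurable request_space"
proof -
  interpret X: prob_space "\<Pi>\<^sub>M s\<in>periods I - {t}. request_law I" by (rule prob_sequences)
  have "(\<lambda>(q, X). prophet_choice (X(t := q)) t j) \<in>
      borel_measurable (request_law I \<Otimes>\<^sub>M (\<Pi>\<^sub>M s\<in>periods I - {t}. request_law I))"
    using measurable_compose[OF update_measurable[OF assms] prophet_choice_measurable]
    by (simp only: split_def)
  then have "prophet_response t j \<in> borel_measurable (request_law I)"
    unfolding prophet_response_def by (rule X.borel_measurable_lebesgue_integral)
  then show ?thesis by (simp cong: measurable_cong_sets)
qed

lemma prophet_response_bounds:
  assumes t: "t \<in> periods I"
  shows "0 \<le> prophet_response t j q" "(\<Sum>j\<in>resources I. prophet_response t j q) \<le> 1"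
proof -
  let ?rest = "\<Pi>\<^sub>M s\<in>periods I - {t}. request_law I"
  interpret X: prob_space ?rest by (rule prob_sequences)
  show "0 \<le> prophet_response t j q"
    unfolding prophet_response_def by (intro Bochner_Integration.integral_nonneg prophet_choice_bounds)
  have int: "integrable ?rest (\<lambda>X. prophet_choice (X(t := q)) t j)" for j
    by (rule X.integrable_const_bound[of _ 1])
       (auto simp: prophet_choice_bounds
        intro: measurable_compose[OF update_section_measurable[OF t] prophet_choice_measurable])
  have "(\<Sum>j\<in>resources I. prophet_response t j q) =
      (\<integral>X. (\<Sum>j\<in>resources I. prophet_choice (X(t := q)) t j) \<partial>?rest)"
    unfolding prophet_response_def by (rule Bochner_Integration.integral_sum[symmetric, OF int])
  also have "\<dots> \<le> (\<integral>X. 1 \<partial>?rest)"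
    by (intro integral_mono Bochner_Integration.integrable_sum int) (auto intro: prophet_choice_sum_le[OF t])
  finally show "(\<Sum>j\<in>resources I. prophet_response t j q) \<le> 1"
    using X.prob_space by simp
qed

lemma prophet_response_le_1: "t \<in> periods I \<Longrightarrow> j \<in> resources I \<Longrightarrow> prophet_response t j q \<le> 1"
  using member_le_sum[of j "resources I" "\<lambda>j. prophet_response t j q"]
    prophet_response_bounds[where t = t and q = q] by force

lemma prophet_response_expectation:
  fixes g :: "request \<Rightarrow> real"
  assumes t: "t \<in> periods I" and int: "integrable (sample_space I) (\<lambda>\<omega>. g (\<omega> t) * prophet_choice \<omega> t j)"
  shows "(\<integral>\<omega>. g (\<omega> t) * prophet_choice \<omega> t j \<partial>sample_space I) =
      (\<Sum>i\<in>types I. p i * (\<integral>u. g (i, u) * prophet_response t j (i, u) \<partial>size_law I i))"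
    and "i \<in> types I \<Longrightarrow> integrable (size_law I i) (\<lambda>u. g (i, u) * prophet_response t j (i, u))"
proof -
  have eq: "(\<integral>X. g ((X(t := q)) t) * prophet_choice (X(t := q)) t j
      \<partial>(\<Pi>\<^sub>M s\<in>periods I - {t}. request_law I)) = g q * prophet_response t j q" for q
    by (simp add: prophet_response_def)
  have int_q: "integrable (request_law I) (\<lambda>q. g q * prophet_response t j q)"
    using sample_space_resample(3)[OF t int] by (simp only: eq)
  show "(\<integral>\<omega>. g (\<omega> t) * prophet_choice \<omega> t j \<partial>sample_space I) =
      (\<Sum>i\<in>types I. p i * (\<integral>u. g (i, u) * prophet_response t j (i, u) \<partial>size_law I i))"
    using sample_space_resample(4)[OF t int] integral_request_law(1)[OF int_q] by (simp only: eq)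
  show "i \<in> types I \<Longrightarrow> integrable (size_law I i) (\<lambda>u. g (i, u) * prophet_response t j (i, u))"
    by (rule integral_request_law(2)[OF int_q])
qed

lemma sub_lp_reward_integrable:
  assumes i: "i \<in> types I" and x: "sub_lp_feasible I i ct t x" and j: "j \<in> resources I"
  shows "integrable (size_law I i) (x j)"
  using x j by (intro size_law_integrable_bounded[where B = 1]) (auto simp: sub_lp_feasible_def)

lemma sub_lp_value_le:
  assumes i: "i \<in> types I" and x: "sub_lp_feasible I i ct t x" and t: "0 \<le> periods_left I t"
  shows "periods_left I t * p i * (\<integral>u. (\<Sum>j\<in>resources I. rew I i j * x j u) \<partial>size_law I i)
    \<le> periods_left I t * p i * max_reward I i"
proof -
  interpret prob_space "size_law I i" by (rule prob_size_law)
  have "(\<integral>u. (\<Sum>j\<in>resources I. rew I i j * x j u) \<partial>size_law I i) \<le> (\<integral>u. max_reward I i \<partial>size_law I i)"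
  proof (rule integral_mono)
    show "integrable (size_law I i) (\<lambda>u. \<Sum>j\<in>resources I. rew I i j * x j u)"
      by (intro Bochner_Integration.integrable_sum integrable_mult_right sub_lp_reward_integrable[OF i x])
    fix u
    have "(\<Sum>j\<in>resources I. rew I i j * x j u) \<le> (\<Sum>j\<in>resources I. max_reward I i * x j u)"
      using x by (intro sum_mono mult_right_mono max_reward_ge) (auto simp: sub_lp_feasible_def)
    also have "\<dots> \<le> max_reward I i * 1"
      unfolding sum_distrib_left[symmetric]
      using x max_reward_nonneg[OF i] by (intro mult_left_mono) (auto simp: sub_lp_feasible_def)
    finally show "(\<Sum>j\<in>resources I. rew I i j * x j u) \<le> max_reward I i" by simp
  qed simp
  then show ?thesis
    using t p_pos[OF i] prob_space by (intro mult_left_mono) auto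
qed

lemma sub_lp_le:
  assumes "\<And>j. j \<in> resources I \<Longrightarrow> 0 \<le> ct j"
    and "\<And>x. sub_lp_feasible I i ct t x \<Longrightarrow>
      periods_left I t * p i * (\<integral>u. (\<Sum>j\<in>resources I. rew I i j * x j u) \<partial>size_law I i) \<le> V"
  shows "sub_lp I i ct t \<le> V"
  unfolding sub_lp_def
proof (rule cSup_least)
  have "sub_lp_feasible I i ct t (\<lambda>_ _. 0)" using assms(1) by (simp add: sub_lp_feasible_def)
  then show "{periods_left I t * p i * (\<integral>u. (\<Sum>j\<in>resources I. rew I i j * x j u) \<partial>size_law I i) | x.
      sub_lp_feasible I i ct t x} \<noteq> {}" by blast
qed (use assms(2) in blast)

lemma sub_lp_ge:
  assumes "i \<in> types I" "sub_lp_feasible I i ct t x" "0 \<le> periods_left I t"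
  shows "periods_left I t * p i * (\<integral>u. (\<Sum>j\<in>resources I. rew I i j * x j u) \<partial>size_law I i) \<le> sub_lp I i ct t"
  unfolding sub_lp_def
  using assms sub_lp_value_le[OF assms(1) _ assms(3)]
  by (intro cSup_upper bdd_aboveI[of _ "periods_left I t * p i * max_reward I i"]) blast+

text \<open>
  Averaging the prophet's response over the periods gives a feasible point of the sub-problems for
  the split in which every type receives its expected consumption under the prophet.
\<close>

lemma prophet_le_sub_lp:
  assumes opt: "optimal_split I cs"
  shows "(\<integral>\<omega>. prophet_value I \<omega> \<partial>sample_space I) \<le> (\<Sum>i\<in>types I. sub_lp I i (cs i) 1)"
proof -
  interpret S: prob_space "sample_space I" by (rule prob_sample_space)
  let ?T = "real (horizon I)"
  have T: "0 < ?T" using horizon_pos by simp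
  let ?y = "\<lambda>t i j u. prophet_response t j (i, u)"
  \<comment> \<open>the response averaged over the periods, and the expected consumption of each type\<close>
  define x where "x i j u = (\<Sum>t\<in>periods I. ?y t i j u) / ?T" for i j u
  define ct where "ct i j = (\<Sum>t\<in>periods I. p i * (\<integral>u. coef I i j * u * ?y t i j u \<partial>size_law I i))" for i j
  have int_size: "integrable (sample_space I) (\<lambda>\<omega>. coef I (fst (\<omega> t)) j * snd (\<omega> t) * prophet_choice \<omega> t j)"
    if "t \<in> periods I" "j \<in> resources I" for t j
    using consumption_bounded(1,2)[OF that] that(1)
    by (intro S.integrable_const_bound[of _ "cap I j"])
       (auto intro!: borel_measurable_times type_function_measurable request_component_measurable)
  have int_rew: "integrable (sample_space I) (\<lambda>\<omega>. rew I (fst (\<omega> t)) j * prophet_choice \<omega> t j)"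
    if "t \<in> periods I" "j \<in> resources I" for t j
    using prophet_reward_bounded[OF that] that(1)
    by (intro S.integrable_const_bound[of _ "\<Sum>i\<in>types I. rew I i j"])
       (auto intro!: borel_measurable_times type_function_measurable)
  have E_size: "(\<integral>\<omega>. coef I (fst (\<omega> t)) j * snd (\<omega> t) * prophet_choice \<omega> t j \<partial>sample_space I) =
      (\<Sum>i\<in>types I. p i * (\<integral>u. coef I i j * u * ?y t i j u \<partial>size_law I i))"
    and I_size: "\<And>i. i \<in> types I \<Longrightarrow> integrable (size_law I i) (\<lambda>u. coef I i j * u * ?y t i j u)"
    if "t \<in> periods I" "j \<in> resources I" for t j
    using prophet_response_expectation[of t "\<lambda>q. coef I (fst q) j * snd q", OF that(1) int_size[OF that]]
    by simp_all
  have E_rew: "(\<integral>\<omega>. rew I (fst (\<omega> t)) j * prophet_choice \<omega> t j \<partial>sample_space I) =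
      (\<Sum>i\<in>types I. p i * (\<integral>u. rew I i j * ?y t i j u \<partial>size_law I i))"
    and I_rew: "\<And>i. i \<in> types I \<Longrightarrow> integrable (size_law I i) (\<lambda>u. rew I i j * ?y t i j u)"
    if "t \<in> periods I" "j \<in> resources I" for t j
    using prophet_response_expectation[of t "\<lambda>q. rew I (fst q) j", OF that(1) int_rew[OF that]]
    by simp_all
  have y_meas: "?y t i j \<in> borel_measurable borel" if "t \<in> periods I" for t i j
    by (rule measurable_compose[OF _ prophet_response_measurable[OF that]]) simp
  have x_size: "integrable (size_law I i) (\<lambda>u. u * x i j u)"
    "?T * p i * coef I i j * (\<integral>u. u * x i j u \<partial>size_law I i) = ct i j"
    if "i \<in> types I" "j \<in> resources I" for i j
  proof -
    have eq: "u * x i j u = (\<Sum>t\<in>periods I. coef I i j * u * ?y t i j u) / (?T * coef I i j)" for u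
      using coef_pos[OF that] by (simp add: x_def sum_distrib_left sum_divide_distrib)
    show "integrable (size_law I i) (\<lambda>u. u * x i j u)"
      unfolding eq using I_size that by (intro integrable_divide Bochner_Integration.integrable_sum) auto
    have "(\<integral>u. u * x i j u \<partial>size_law I i) =
        (\<Sum>t\<in>periods I. \<integral>u. coef I i j * u * ?y t i j u \<partial>size_law I i) / (?T * coef I i j)"
      unfolding eq using I_size that
      by (subst integral_divide_zero, subst Bochner_Integration.integral_sum) auto
    then show "?T * p i * coef I i j * (\<integral>u. u * x i j u \<partial>size_law I i) = ct i j"
      using coef_pos[OF that] T by (simp add: ct_def flip: sum_distrib_left)
  qed
  have x_rew: "?T * p i * (\<integral>u. (\<Sum>j\<in>resources I. rew I i j * x i j u) \<partial>size_law I i) =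
      (\<Sum>t\<in>periods I. \<Sum>j\<in>resources I. p i * (\<integral>u. rew I i j * ?y t i j u \<partial>size_law I i))"
    if "i \<in> types I" for i
  proof -
    have eq: "(\<Sum>j\<in>resources I. rew I i j * x i j u) =
        (\<Sum>t\<in>periods I. \<Sum>j\<in>resources I. rew I i j * ?y t i j u) / ?T" for u
    proof -
      have "(\<Sum>j\<in>resources I. rew I i j * x i j u) =
          (\<Sum>j\<in>resources I. (\<Sum>t\<in>periods I. rew I i j * ?y t i j u)) / ?T"
        unfolding x_def by (simp only: sum_distrib_left times_divide_eq_right sum_divide_distrib)
      then show ?thesis by (simp only: sum.swap[of _ "resources I" "periods I"])
    qed
    define S where "S = (\<Sum>t\<in>periods I. \<Sum>j\<in>resources I. \<integral>u. rew I i j * ?y t i j u \<partial>size_law I i)"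
    have "(\<integral>u. (\<Sum>t\<in>periods I. \<Sum>j\<in>resources I. rew I i j * ?y t i j u) \<partial>size_law I i) =
        (\<Sum>t\<in>periods I. \<integral>u. (\<Sum>j\<in>resources I. rew I i j * ?y t i j u) \<partial>size_law I i)"
      by (rule Bochner_Integration.integral_sum) (rule Bochner_Integration.integrable_sum[OF I_rew[OF _ _ that]])
    also have "\<dots> = S"
      unfolding S_def by (rule sum.cong[OF refl]) (rule Bochner_Integration.integral_sum[OF I_rew[OF _ _ that]])
    finally have "(\<integral>u. (\<Sum>j\<in>resources I. rew I i j * x i j u) \<partial>size_law I i) = S / ?T"
      unfolding eq by (simp only: integral_divide_zero)
    moreover have "(\<Sum>t\<in>periods I. \<Sum>j\<in>resources I. p i * (\<integral>u. rew I i j * ?y t i j u \<partial>size_law I i)) = p i * S"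
      by (simp only: S_def sum_distrib_left)
    ultimately show ?thesis using T by simp
  qed
  have "feasible_split I ct"
    unfolding feasible_split_def
  proof (intro conjI ballI)
    fix j assume j: "j \<in> resources I"
    have "(\<Sum>i\<in>types I. ct i j) =
        (\<Sum>t\<in>periods I. \<integral>\<omega>. coef I (fst (\<omega> t)) j * snd (\<omega> t) * prophet_choice \<omega> t j \<partial>sample_space I)"
      unfolding ct_def by (subst sum.swap) (use E_size j in simp)
    also have "\<dots> = (\<integral>\<omega>. (\<Sum>t\<in>periods I. coef I (fst (\<omega> t)) j * snd (\<omega> t) * prophet_choice \<omega> t j) \<partial>sample_space I)"
      using int_size j by (subst Bochner_Integration.integral_sum) auto
    also have "\<dots> \<le> (\<integral>\<omega>. cap I j \<partial>sample_space I)"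
      using int_size j horizon_pos
      by (intro integral_mono Bochner_Integration.integrable_sum) (auto intro!: consumption_bounded(3)[of 1])
    finally show "(\<Sum>i\<in>types I. ct i j) \<le> cap I j" using S.prob_space by simp
  next
    fix i j assume ij: "i \<in> types I" "j \<in> resources I"
    have "0 \<le> (\<integral>u. coef I i j * u * ?y t i j u \<partial>size_law I i)" if "t \<in> periods I" for t
      using size_law_AE_pos[OF ij(1)] coef_pos[OF ij] prophet_response_bounds(1)[OF that]
      by (intro integral_nonneg_AE) (auto elim!: eventually_mono)
    then show "0 \<le> ct i j"
      unfolding ct_def using p_pos[OF ij(1)] by (intro sum_nonneg mult_nonneg_nonneg) auto
  qed
  then have opt_le: "(\<Sum>i\<in>types I. sub_lp I i (ct i) 1) \<le> (\<Sum>i\<in>types I. sub_lp I i (cs i) 1)"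
    using opt by (simp add: optimal_split_def)
  have lp: "?T * p i * (\<integral>u. (\<Sum>j\<in>resources I. rew I i j * x i j u) \<partial>size_law I i) \<le> sub_lp I i (ct i) 1"
    if i: "i \<in> types I" for i
  proof -
    have "sub_lp_feasible I i (ct i) 1 (x i)"
      unfolding sub_lp_feasible_def
    proof (intro conjI ballI allI)
      fix j u assume j: "j \<in> resources I"
      show "x i j \<in> borel_measurable borel"
        unfolding x_def using y_meas by (intro borel_measurable_divide borel_measurable_sum) auto
      show "0 \<le> x i j u" unfolding x_def by (intro divide_nonneg_nonneg sum_nonneg prophet_response_bounds) auto
      have "(\<Sum>t\<in>periods I. ?y t i j u) \<le> (\<Sum>t\<in>periods I. 1)"
        using j by (intro sum_mono prophet_response_le_1) auto
      then show "x i j u \<le> 1" using T by (simp add: x_def divide_le_eq)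
      show "integrable (size_law I i) (\<lambda>u. u * x i j u)" using x_size i j by blast
      show "periods_left I 1 * p i * coef I i j * (\<integral>u. u * x i j u \<partial>size_law I i) \<le> ct i j"
        using x_size(2)[OF i j] by simp
    next
      fix u
      have "(\<Sum>j\<in>resources I. x i j u) = (\<Sum>t\<in>periods I. \<Sum>j\<in>resources I. ?y t i j u) / ?T"
        unfolding x_def by (subst sum.swap) (simp add: sum_divide_distrib)
      also have "\<dots> \<le> (\<Sum>t\<in>periods I. 1) / ?T"
        using T by (intro divide_right_mono sum_mono prophet_response_bounds(2)) auto
      finally show "(\<Sum>j\<in>resources I. x i j u) \<le> 1" using T by simp
    qed
    from sub_lp_ge[OF i this] show ?thesis by simp
  qed
  have "(\<integral>\<omega>. prophet_value I \<omega> \<partial>sample_space I) = (\<integral>\<omega>. alloc_value I \<omega> (prophet_choice \<omega>) \<partial>sample_space I)"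
  proof (rule integral_cong_AE)
    have eq: "AE \<omega> in sample_space I. prophet_value I \<omega> = alloc_value I \<omega> (prophet_choice \<omega>)"
      using AE_good_sample by eventually_elim (metis prophet_choice_optimal prophet_value_eq)
    then show "AE \<omega> in sample_space I. prophet_value I \<omega> = alloc_value I \<omega> (prophet_choice \<omega>)" .
    show meas: "(\<lambda>\<omega>. alloc_value I \<omega> (prophet_choice \<omega>)) \<in> borel_measurable (sample_space I)"
      unfolding alloc_value_def by (intro borel_measurable_sum borel_measurable_times type_function_measurable) auto
  qed (rule prophet_value_measurable)
  also have "\<dots> = (\<Sum>t\<in>periods I. \<integral>\<omega>. (\<Sum>j\<in>resources I. rew I (fst (\<omega> t)) j * prophet_choice \<omega> t j) \<partial>sample_space I)"
    unfolding alloc_value_def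
    by (rule Bochner_Integration.integral_sum) (rule Bochner_Integration.integrable_sum[OF int_rew])
  also have "\<dots> = (\<Sum>t\<in>periods I. \<Sum>j\<in>resources I.
      \<integral>\<omega>. rew I (fst (\<omega> t)) j * prophet_choice \<omega> t j \<partial>sample_space I)"
    by (rule sum.cong[OF refl]) (rule Bochner_Integration.integral_sum[OF int_rew])
  also have "\<dots> = (\<Sum>t\<in>periods I. \<Sum>j\<in>resources I. \<Sum>i\<in>types I.
      p i * (\<integral>u. rew I i j * ?y t i j u \<partial>size_law I i))"
    by (intro sum.cong refl E_rew)
  also have "\<dots> = (\<Sum>i\<in>types I. \<Sum>t\<in>periods I. \<Sum>j\<in>resources I.
      p i * (\<integral>u. rew I i j * ?y t i j u \<partial>size_law I i))"
    by (simp only: sum.swap[of _ "types I" "resources I"] sum.swap[of _ "types I" "periods I"])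
  also have "\<dots> = (\<Sum>i\<in>types I. ?T * p i * (\<integral>u. (\<Sum>j\<in>resources I. rew I i j * x i j u) \<partial>size_law I i))"
    by (rule sum.cong[OF refl x_rew[symmetric]])
  also have "\<dots> \<le> (\<Sum>i\<in>types I. sub_lp I i (ct i) 1)" by (rule sum_mono[OF lp])
  finally show ?thesis using opt_le by linarith
qed

end

section \<open>The potential of a type\<close>

lemma sum_mult_by_parts:
  fixes r a :: "nat \<Rightarrow> real"
  shows "(\<Sum>j=1..m. r j * a j) =
    (\<Sum>j=1..m. (r j - r (j + 1)) * (\<Sum>k=1..j. a k)) + r (m + 1) * (\<Sum>k=1..m. a k)"
  by (induction m) (simp_all add: algebra_simps flip: Suc_eq_plus1)

context regular_instance
begin

abbreviation acc :: "nat \<Rightarrow> real \<Rightarrow> real" where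
  "acc i \<equiv> size_profile.accept (F i) (P i) wbar"

lemma size_profile_obtain:
  assumes "i \<in> types I"
  obtains f where "size_profile (F i) (P i) f wbar M"
  using size_profile_size_law[OF assms] by blast

lemma P_wbar_pos: "i \<in> types I \<Longrightarrow> 0 < P i wbar"
  by (rule size_profile_obtain) (use size_profile.P_pos wbar_pos in blast)+

text \<open>
  Weak duality for the knapsack with one resource: \<open>v\<close> is the multiplier, since
  \<open>(v - u) * y\<close> is largest when exactly the sizes below \<open>v\<close> are accepted.
\<close>

lemma accept_optimal:
  fixes y :: "real \<Rightarrow> real"
  assumes i: "i \<in> types I" and y [measurable]: "y \<in> borel_measurable borel"
    and y01: "\<And>u. 0 \<le> y u" "\<And>u. y u \<le> 1"
    and int: "integrable (size_law I i) (\<lambda>u. u * y u)"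
    and B: "(\<integral>u. u * y u \<partial>size_law I i) \<le> B" "0 \<le> B" "B \<le> P i wbar"
  shows "(\<integral>u. y u \<partial>size_law I i) \<le> acc i B"
proof -
  interpret prob_space "size_law I i" by (rule prob_size_law)
  obtain f where "size_profile (F i) (P i) f wbar M" using i by (rule size_profile_obtain)
  then interpret sp: size_profile "F i" "P i" f wbar M .
  obtain v where v: "0 \<le> v" "v \<le> wbar" "P i v = B" using sp.P_surj[of B] B by auto
  have int_y: "integrable (size_law I i) y"
    by (rule size_law_integrable_bounded[where B = 1]) (auto simp: y01 abs_le_iff order_trans[OF _ y01(1)])
  show ?thesis
  proof (cases "v = 0")
    case True
    then have "B = 0" using v by simp
    have nn: "AE u in size_law I i. 0 \<le> u * y u"
      using size_law_AE_pos[OF i] by eventually_elim (simp add: y01)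
    then have "(\<integral>u. u * y u \<partial>size_law I i) = 0"
      using integral_nonneg_AE[OF nn] B \<open>B = 0\<close> by simp
    then have "AE u in size_law I i. u * y u = 0"
      using integral_nonneg_eq_0_iff_AE[OF int nn] by simp
    then have "AE u in size_law I i. y u = 0"
      using size_law_AE_pos[OF i] by eventually_elim simp
    then have "(\<integral>u. y u \<partial>size_law I i) = (\<integral>u. 0 \<partial>size_law I i)"
      by (intro integral_cong_AE) auto
    then show ?thesis using sp.accept_nonneg by simp
  next
    case False
    then have "0 < v" using v by simp
    have "(\<integral>u. v * y u - u * y u \<partial>size_law I i) \<le>
        (\<integral>u. v * indicator {0..v} u - indicator {0..v} u * u \<partial>size_law I i)"
    proof (rule integral_mono_AE)
      show "AE u in size_law I i. v * y u - u * y u \<le> v * indicator {0..v} u - indicator {0..v} u * u"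
        using size_law_AE_pos[OF i]
      proof eventually_elim
        fix u :: real assume "0 < u"
        show "v * y u - u * y u \<le> v * indicator {0..v} u - indicator {0..v} u * u"
        proof (cases "u \<le> v")
          case True
          then have "(v - u) * y u \<le> (v - u) * 1" using y01 by (intro mult_left_mono) auto
          then show ?thesis using True \<open>0 < u\<close> by (simp add: algebra_simps)
        next
          case False
          then have "(v - u) * y u \<le> 0" using y01(1)[of u] by (intro mult_nonpos_nonneg) auto
          then show ?thesis using False by (simp add: algebra_simps)
        qed
      qed
    qed (intro Bochner_Integration.integrable_diff integrable_mult_right int int_y partial_integrable
        indicator_integrable)+
    then have "v * (\<integral>u. y u \<partial>size_law I i) - (\<integral>u. u * y u \<partial>size_law I i) \<le> v * F i v - P i v"
      using int int_y partial_integrable[of i 0 v] F_eq_integral[OF i v(1)] partial_mean_eq[of i 0 v] by simp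
    then have "v * (\<integral>u. y u \<partial>size_law I i) \<le> v * F i v" using B v by simp
    then have "(\<integral>u. y u \<partial>size_law I i) \<le> F i v" using \<open>0 < v\<close> by simp
    then show ?thesis using sp.accept_P[OF v(1,2)] v by simp
  qed
qed

end

locale atp_instance = regular_instance +
  fixes cs :: "nat \<Rightarrow> nat \<Rightarrow> real" and \<sigma> :: "nat \<Rightarrow> nat \<Rightarrow> nat"
  assumes optimal: "optimal_split I cs" and order: "reward_order I \<sigma>"
begin

text \<open>The zero after the last rank makes the decrements from rank \<open>j\<close> on sum to the \<open>j\<close>-th reward.\<close>

definition rank_reward :: "nat \<Rightarrow> nat \<Rightarrow> real" where
  "rank_reward i j = (if j \<le> num_res I then rew I i (\<sigma> i j) else 0)"

definition weight :: "nat \<Rightarrow> nat \<Rightarrow> real" where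
  "weight i j = rank_reward i j - rank_reward i (j + 1)"

definition budget :: "nat \<Rightarrow> (nat \<Rightarrow> real) \<Rightarrow> nat \<Rightarrow> real" where
  "budget i ct j = (\<Sum>k=1..j. ct (\<sigma> i k) / coef I i (\<sigma> i k))"

text \<open>
  The value of the relaxed problem of type \<open>i\<close> with \<open>N\<close> periods to go: since the best resources
  take the smallest sizes, each group of best \<open>j\<close> resources acts as a single resource.
\<close>

definition potential :: "nat \<Rightarrow> real \<Rightarrow> (nat \<Rightarrow> real) \<Rightarrow> real" where
  "potential i N ct = N * p i * (\<Sum>j\<in>resources I. weight i j * acc i (budget i ct j / (N * p i)))"

lemma order_bij: "i \<in> types I \<Longrightarrow> bij_betw (\<sigma> i) (resources I) (resources I)"
  using order by (simp add: reward_order_def)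

lemma order_mem: "i \<in> types I \<Longrightarrow> j \<in> resources I \<Longrightarrow> \<sigma> i j \<in> resources I"
  using order_bij bij_betwE by blast

lemma rank_reward_nonneg: "i \<in> types I \<Longrightarrow> 1 \<le> j \<Longrightarrow> 0 \<le> rank_reward i j"
  using rew_nonneg order_mem[of i j] by (auto simp: rank_reward_def)

lemma weight_nonneg:
  assumes i: "i \<in> types I" and j: "j \<in> resources I"
  shows "0 \<le> weight i j"
proof (cases "j + 1 \<le> num_res I")
  case True
  then show ?thesis
    using order i j unfolding reward_order_def weight_def rank_reward_def monotone_on_def by auto
next
  case False
  then show ?thesis using j rank_reward_nonneg[OF i, of j] by (simp add: weight_def rank_reward_def)
qed

lemma sum_weight:
  assumes k: "k \<in> resources I"
  shows "(\<Sum>j=k..num_res I. weight i j) = rew I i (\<sigma> i k)"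
proof -
  have "(\<Sum>j=k..n. weight i j) = rank_reward i k - rank_reward i (n + 1)" if "k \<le> n" for n
    using that by (induction n rule: dec_induct) (simp_all add: weight_def flip: Suc_eq_plus1)
  then show ?thesis using k by (simp add: rank_reward_def)
qed

lemma sum_ranks_by_parts:
  "(\<Sum>j\<in>resources I. rew I i (\<sigma> i j) * y j) = (\<Sum>j\<in>resources I. weight i j * (\<Sum>k=1..j. y k))"
proof -
  have "(\<Sum>j\<in>resources I. rew I i (\<sigma> i j) * y j) = (\<Sum>j=1..num_res I. rank_reward i j * y j)"
    by (intro sum.cong) (auto simp: rank_reward_def)
  moreover have "rank_reward i (num_res I + 1) = 0" by (simp add: rank_reward_def)
  ultimately show ?thesis
    using sum_mult_by_parts[of "rank_reward i" y "num_res I"] by (simp add: weight_def)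
qed

lemma sum_rew_by_rank:
  assumes i: "i \<in> types I"
  shows "(\<Sum>j\<in>resources I. rew I i j * x j) = (\<Sum>j\<in>resources I. weight i j * (\<Sum>k=1..j. x (\<sigma> i k)))"
  using sum.reindex_bij_betw[OF order_bij[OF i], of "\<lambda>j. rew I i j * x j"]
    sum_ranks_by_parts[of i "\<lambda>j. x (\<sigma> i j)"] by simp

lemma sum_by_rank:
  assumes "i \<in> types I"
  shows "(\<Sum>k=1..num_res I. x (\<sigma> i k)) = (\<Sum>j\<in>resources I. x j)"
  using sum.reindex_bij_betw[OF order_bij[OF assms]] .

lemma budget_nonneg:
  assumes "i \<in> types I" "\<And>k. k \<in> resources I \<Longrightarrow> 0 \<le> ct k" "j \<le> num_res I"
  shows "0 \<le> budget i ct j"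
  unfolding budget_def using assms order_mem coef_pos
  by (intro sum_nonneg divide_nonneg_pos) auto

lemma budget_mono:
  assumes "i \<in> types I" "\<And>k. k \<in> resources I \<Longrightarrow> 0 \<le> ct k" "j \<le> k" "k \<le> num_res I"
  shows "budget i ct j \<le> budget i ct k"
  unfolding budget_def using assms order_mem coef_pos
  by (intro sum_mono2 divide_nonneg_pos) auto

text \<open>
  Abel summation turns the reward into a combination, with nonnegative weights, of the acceptance
  probabilities of the first \<open>j\<close> ranks, and each of these is bounded through its own budget.
\<close>

lemma sub_lp_le_potential:
  assumes i: "i \<in> types I" and ct: "\<And>j. j \<in> resources I \<Longrightarrow> 0 \<le> ct j"
    and t: "0 < periods_left I t"
    and small: "budget i ct (num_res I) \<le> periods_left I t * p i * P i wbar"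
  shows "sub_lp I i ct t \<le> potential i (periods_left I t) ct"
proof (rule sub_lp_le[OF ct])
  fix x assume x: "sub_lp_feasible I i ct t x"
  let ?N = "periods_left I t"
  have Np: "0 < ?N * p i" using t p_pos[OF i] by simp
  define y where "y j u = (\<Sum>k=1..j. x (\<sigma> i k) u)" for j u
  have x_meas: "x (\<sigma> i k) \<in> borel_measurable borel"
    and x01: "0 \<le> x (\<sigma> i k) u"
    and x_int: "integrable (size_law I i) (\<lambda>u. u * x (\<sigma> i k) u)"
    and x_cap: "?N * p i * coef I i (\<sigma> i k) * (\<integral>u. u * x (\<sigma> i k) u \<partial>size_law I i) \<le> ct (\<sigma> i k)"
    if "k \<in> resources I" for k u
    using x order_mem[OF i that] by (auto simp: sub_lp_feasible_def)
  have x_sum: "(\<Sum>j\<in>resources I. x j u) \<le> 1" for u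
    using x by (simp add: sub_lp_feasible_def)
  have y_le: "(\<integral>u. y j u \<partial>size_law I i) \<le> acc i (budget i ct j / (?N * p i))" if j: "j \<in> resources I" for j
  proof (rule accept_optimal[OF i])
    show "y j \<in> borel_measurable borel"
      unfolding y_def using x_meas j by (intro borel_measurable_sum) auto
    show "0 \<le> y j u" for u unfolding y_def using x01 j by (intro sum_nonneg) auto
    show "y j u \<le> 1" for u
    proof -
      have "y j u \<le> (\<Sum>k=1..num_res I. x (\<sigma> i k) u)"
        unfolding y_def using x01 j by (intro sum_mono2) auto
      also have "\<dots> \<le> 1" using x_sum[of u] sum_by_rank[OF i, of "\<lambda>j. x j u"] by simp
      finally show ?thesis .
    qed
    have eq: "u * y j u = (\<Sum>k=1..j. u * x (\<sigma> i k) u)" for u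
      by (simp add: y_def sum_distrib_left)
    have x_int': "integrable (size_law I i) (\<lambda>u. u * x (\<sigma> i k) u)" if "k \<in> {1..j}" for k
      using x_int[of k] that j by auto
    show "integrable (size_law I i) (\<lambda>u. u * y j u)"
      unfolding eq by (rule Bochner_Integration.integrable_sum[OF x_int'])
    have "(\<integral>u. u * y j u \<partial>size_law I i) = (\<Sum>k=1..j. \<integral>u. u * x (\<sigma> i k) u \<partial>size_law I i)"
      unfolding eq by (rule Bochner_Integration.integral_sum[OF x_int'])
    also have "\<dots> \<le> (\<Sum>k=1..j. ct (\<sigma> i k) / coef I i (\<sigma> i k) / (?N * p i))"
    proof (rule sum_mono)
      fix k assume "k \<in> {1..j}"
      then have k: "k \<in> resources I" using j by auto
      show "(\<integral>u. u * x (\<sigma> i k) u \<partial>size_law I i) \<le> ct (\<sigma> i k) / coef I i (\<sigma> i k) / (?N * p i)"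
      proof -
        have pos: "0 < coef I i (\<sigma> i k) * (?N * p i)"
          using Np coef_pos[OF i order_mem[OF i k]] by simp
        show ?thesis
          unfolding divide_divide_eq_left pos_le_divide_eq[OF pos] using x_cap[OF k] by (simp add: mult_ac)
      qed
    qed
    finally show "(\<integral>u. u * y j u \<partial>size_law I i) \<le> budget i ct j / (?N * p i)"
      by (simp add: budget_def sum_divide_distrib)
    show "0 \<le> budget i ct j / (?N * p i)"
      using budget_nonneg[of i ct j, OF i ct] j Np by simp
    have "budget i ct j \<le> P i wbar * (?N * p i)"
      using budget_mono[of i ct j "num_res I", OF i ct] small j by (simp add: mult_ac)
    then show "budget i ct j / (?N * p i) \<le> P i wbar"
      using Np by (simp add: pos_divide_le_eq)
  qed
  have y_int: "integrable (size_law I i) (y j)" if "j \<in> resources I" for j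
    unfolding y_def using sub_lp_reward_integrable[OF i x] order_mem[OF i] that
    by (intro Bochner_Integration.integrable_sum) auto
  have "(\<integral>u. (\<Sum>j\<in>resources I. rew I i j * x j u) \<partial>size_law I i) =
      (\<integral>u. (\<Sum>j\<in>resources I. weight i j * y j u) \<partial>size_law I i)"
    by (simp only: sum_rew_by_rank[OF i] y_def)
  also have "\<dots> = (\<Sum>j\<in>resources I. \<integral>u. weight i j * y j u \<partial>size_law I i)"
    by (rule Bochner_Integration.integral_sum) (rule integrable_mult_right[OF y_int])
  also have "\<dots> \<le> (\<Sum>j\<in>resources I. weight i j * acc i (budget i ct j / (?N * p i)))"
    using y_le weight_nonneg[OF i] by (intro sum_mono) (simp add: mult_left_mono)
  finally show "?N * p i * (\<integral>u. (\<Sum>j\<in>resources I. rew I i j * x j u) \<partial>size_law I i)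
      \<le> potential i ?N ct"
    unfolding potential_def using Np by (intro mult_left_mono) auto
qed

lemma potential_bounds:
  assumes i: "i \<in> types I" and N: "0 \<le> N"
  shows "0 \<le> potential i N ct" "potential i N ct \<le> N * p i * max_reward I i"
proof -
  obtain f where "size_profile (F i) (P i) f wbar M" using i by (rule size_profile_obtain)
  then interpret sp: size_profile "F i" "P i" f wbar M .
  show "0 \<le> potential i N ct"
    unfolding potential_def using N p_pos[OF i] weight_nonneg[OF i] sp.accept_nonneg
    by (intro mult_nonneg_nonneg sum_nonneg) auto
  have "(\<Sum>j\<in>resources I. weight i j * acc i (budget i ct j / (N * p i))) \<le> (\<Sum>j\<in>resources I. weight i j * 1)"
    using weight_nonneg[OF i] sp.accept_le_1 by (intro sum_mono mult_left_mono) auto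
  also have "\<dots> \<le> max_reward I i"
    using sum_weight[of 1 i] num_res_pos max_reward_ge[OF order_mem[OF i], of 1] by simp
  finally show "potential i N ct \<le> N * p i * max_reward I i"
    unfolding potential_def using N p_pos[OF i] by (intro mult_left_mono) auto
qed

end

section \<open>One period of the policy\<close>

context atp_instance
begin

definition gain :: "nat \<Rightarrow> request \<Rightarrow> nat option \<Rightarrow> real" where
  "gain i q d = (if fst q = i then (case d of None \<Rightarrow> 0 | Some k \<Rightarrow> rew I i k) else 0)"

text \<open>
  The service loss plus the curvature loss.  With one period to go the second quotient is \<open>0\<close>, as it
  should be: no budget is carried over.
\<close>

definition step_loss :: "nat \<Rightarrow> real \<Rightarrow> real" where
  "step_loss i N = (\<Sum>j\<in>resources I. weight i j * (real j * M / N + (M - 1) / (N - 1)))"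

end

text \<open>
  The state \<open>c\<close> of the capacities at the start of period \<open>t\<close>, seen from type \<open>i\<close>.  The bound on
  the total budget keeps all thresholds below \<open>wbar\<close> in this period and at most \<open>wbar\<close> in the next one.
\<close>

locale atp_step = atp_instance +
  fixes i t :: nat and c :: "nat \<Rightarrow> nat \<Rightarrow> real"
  assumes i: "i \<in> types I" and t: "t \<in> periods I"
    and c_nonneg: "\<And>k. k \<in> resources I \<Longrightarrow> 0 \<le> c i k"
    and small: "budget i (c i) (num_res I) \<le> (periods_left I t - 1) * p i * P i wbar"
begin

definition N :: real where "N = periods_left I t"

text \<open>
  Budgets are measured in units of size: \<open>a k\<close> is what the resource of rank \<open>k\<close> has left, \<open>B j\<close> what
  the first \<open>j\<close> ranks have left per expected request.  A size is accepted at one of the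
  first \<open>j\<close> ranks iff it is at most \<open>H j\<close>.
\<close>

definition a :: "nat \<Rightarrow> real" where "a k = c i (\<sigma> i k) / coef I i (\<sigma> i k)"
definition B :: "nat \<Rightarrow> real" where "B j = budget i (c i) j / (N * p i)"
definition \<mu> :: "nat \<Rightarrow> real" where "\<mu> j = (SOME v. 0 \<le> v \<and> v < wbar \<and> P i v = B j)"
definition h :: "nat \<Rightarrow> real" where "h k = min (a k) (\<mu> k)"
definition H :: "nat \<Rightarrow> real" where "H j = Max (h ` {1..j})"

lemma N_ge_1: "1 \<le> N"
  using t by (auto simp: N_def)

lemma budget_small: "budget i (c i) (num_res I) \<le> (N - 1) * p i * P i wbar"
  using small by (simp only: N_def)

lemma p_i_pos: "0 < p i"
  by (rule p_pos[OF i])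

lemma budget_eq: "budget i (c i) j = N * p i * B j"
  using N_ge_1 p_i_pos by (simp add: B_def)

lemma B_bounds:
  assumes "j \<le> num_res I"
  shows "0 \<le> B j" "B j < P i wbar"
proof -
  show "0 \<le> B j"
    unfolding B_def using budget_nonneg[of i "c i" j, OF i c_nonneg assms] N_ge_1 p_i_pos by simp
  have "budget i (c i) j \<le> (N - 1) * p i * P i wbar"
    using budget_mono[of i "c i" j "num_res I", OF i c_nonneg assms] budget_small by simp
  also have "\<dots> < N * p i * P i wbar"
    using p_i_pos P_wbar_pos[OF i] by (simp add: mult_strict_right_mono)
  finally show "B j < P i wbar"
    unfolding budget_eq using N_ge_1 p_i_pos by (simp add: mult_less_cancel_left_pos)
qed

lemma \<mu>:
  assumes "j \<le> num_res I"
  shows "0 \<le> \<mu> j" "\<mu> j < wbar" "P i (\<mu> j) = B j"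
proof -
  obtain f where "size_profile (F i) (P i) f wbar M" using i by (rule size_profile_obtain)
  then interpret sp: size_profile "F i" "P i" f wbar M .
  obtain v where v: "v \<in> {0..wbar}" "P i v = B j"
    using sp.P_surj[of "B j"] B_bounds[OF assms] by auto
  then have "0 \<le> v \<and> v < wbar \<and> P i v = B j"
    using B_bounds(2)[OF assms] by (cases "v = wbar") auto
  then have "0 \<le> \<mu> j \<and> \<mu> j < wbar \<and> P i (\<mu> j) = B j"
    unfolding \<mu>_def by (rule someI)
  then show "0 \<le> \<mu> j" "\<mu> j < wbar" "P i (\<mu> j) = B j" by auto
qed

lemma \<mu>_mono:
  assumes "j \<le> k" "k \<le> num_res I"
  shows "\<mu> j \<le> \<mu> k"
proof -
  obtain f where "size_profile (F i) (P i) f wbar M" using i by (rule size_profile_obtain)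
  then interpret sp: size_profile "F i" "P i" f wbar M .
  have "B j \<le> B k"
    unfolding B_def using budget_mono[of i "c i" j k, OF i c_nonneg assms] N_ge_1 p_i_pos
    by (intro divide_right_mono) auto
  then show ?thesis
    using \<mu>[of j] \<mu>[of k] assms sp.P_le_iff[of "\<mu> j" "\<mu> k"] by simp
qed

lemma size_threshold_eq:
  assumes "j \<le> num_res I"
  shows "size_threshold I \<sigma> t i j (c i) = ereal (\<mu> j)"
proof -
  obtain f where "size_profile (F i) (P i) f wbar M" using i by (rule size_profile_obtain)
  then interpret sp: size_profile "F i" "P i" f wbar M .
  have "1 / N * (\<Sum>k=1..j. c i (\<sigma> i k) / coef I i (\<sigma> i k)) = p i * B j"
    using budget_eq[of j] N_ge_1 by (simp add: budget_def)
  then have iff: "p i * P i w = 1 / N * (\<Sum>k=1..j. c i (\<sigma> i k) / coef I i (\<sigma> i k)) \<longleftrightarrow> P i w = B j" for w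
    using p_i_pos by simp
  show ?thesis
    unfolding size_threshold_def N_def[symmetric] iff
  proof (rule Inf_eqI)
    fix x assume "x \<in> {ereal w | w. 0 \<le> w \<and> P i w = B j}"
    then obtain w where w: "x = ereal w" "0 \<le> w" "P i w = B j" by blast
    have "\<mu> j \<le> w"
    proof (rule ccontr)
      assume "\<not> \<mu> j \<le> w"
      then show False
        using w \<mu>[OF assms] sp.P_strict_mono[of w "\<mu> j"] by auto
    qed
    then show "ereal (\<mu> j) \<le> x" using w by simp
  next
    fix y assume "\<And>x. x \<in> {ereal w | w. 0 \<le> w \<and> P i w = B j} \<Longrightarrow> y \<le> x"
    then show "y \<le> ereal (\<mu> j)" using \<mu>[OF assms] by blast
  qed
qed

lemma a_nonneg: "k \<in> resources I \<Longrightarrow> 0 \<le> a k"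
  unfolding a_def using c_nonneg order_mem[OF i] coef_pos[OF i] by (intro divide_nonneg_pos) auto

lemma h_nonneg: "k \<in> resources I \<Longrightarrow> 0 \<le> h k"
  using a_nonneg \<mu>(1) by (simp add: h_def)

lemma H_ge: "k \<in> {1..j} \<Longrightarrow> h k \<le> H j"
  by (simp add: H_def)

lemma le_H_iff: "1 \<le> j \<Longrightarrow> u \<le> H j \<longleftrightarrow> (\<exists>k\<in>{1..j}. u \<le> h k)"
  unfolding H_def by (subst Max_ge_iff) auto

lemma H_nonneg: "j \<in> resources I \<Longrightarrow> 0 \<le> H j"
  using h_nonneg[of 1] H_ge[of 1 j] by auto

lemma H_le_\<mu>: "j \<in> resources I \<Longrightarrow> H j \<le> \<mu> j"
  unfolding H_def using \<mu>_mono by (subst Max_le_iff) (auto simp: h_def intro: min.coboundedI2)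

text \<open>
  If no acceptance level exceeds \<open>w\<close>, full service up to \<open>w\<close> accounts for the budget up to \<open>w\<close> per rank:
  either the threshold binds, and the whole budget so far matches the consumption at the threshold,
  or the resource itself has little left.
\<close>

lemma budget_le_level:
  assumes "j \<le> num_res I" "0 \<le> w" "\<And>k. k \<in> {1..j} \<Longrightarrow> h k \<le> w"
  shows "budget i (c i) j \<le> N * p i * P i w + real j * w"
  using assms
proof (induction j)
  case 0
  then show ?case using N_ge_1 p_i_pos P_nonneg[OF i, of w] by (simp add: budget_def)
next
  case (Suc j)
  have Np: "0 \<le> N * p i" using N_ge_1 p_i_pos by simp
  show ?case
  proof (cases "\<mu> (Suc j) \<le> a (Suc j)")
    case True
    then have "\<mu> (Suc j) \<le> w" using Suc.prems(3)[of "Suc j"] by (simp add: h_def)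
    then have "B (Suc j) \<le> P i w"
      using P_mono[OF i, of "\<mu> (Suc j)" w] \<mu>[OF Suc.prems(1)] by simp
    then have "N * p i * B (Suc j) \<le> N * p i * P i w" using Np by (rule mult_left_mono)
    then show ?thesis using budget_eq[of "Suc j"] Suc.prems(2)
      by (smt (verit) mult_nonneg_nonneg of_nat_0_le_iff)
  next
    case False
    then have "a (Suc j) \<le> w" using Suc.prems(3)[of "Suc j"] by (simp add: h_def)
    moreover have "budget i (c i) (Suc j) = budget i (c i) j + a (Suc j)"
      by (simp add: budget_def a_def)
    moreover have "budget i (c i) j \<le> N * p i * P i w + real j * w"
      using Suc.prems by (intro Suc.IH) auto
    ultimately show ?thesis by (simp add: algebra_simps)
  qed
qed

text \<open>
  Requests of size between \<open>H j\<close> and \<open>\<mu> j\<close> are lost because the resources run low; by the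
  previous lemma they consume little, and by the ratio constant they are rare.
\<close>

lemma service_loss:
  assumes j: "j \<in> resources I"
  shows "F i (\<mu> j) - F i (H j) \<le> real j * M / (N * p i)"
proof (cases "\<mu> j = H j")
  case True
  then show ?thesis using N_ge_1 p_i_pos M_gt_1 by simp
next
  case False
  obtain f where "size_profile (F i) (P i) f wbar M" using i by (rule size_profile_obtain)
  then interpret sp: size_profile "F i" "P i" f wbar M .
  have j': "j \<le> num_res I" using j by simp
  have less: "H j < \<mu> j" using False H_le_\<mu>[OF j] by simp
  then have pos: "0 < \<mu> j" using H_nonneg[OF j] by simp
  have Np: "0 < N * p i" using N_ge_1 p_i_pos by simp
  have "N * p i * B j \<le> N * p i * P i (H j) + real j * H j"
    using budget_le_level[OF j' H_nonneg[OF j] H_ge] budget_eq by simp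
  also have "\<dots> \<le> N * p i * P i (H j) + real j * \<mu> j"
    using less by (intro add_left_mono mult_left_mono) auto
  finally have "N * p i * (P i (\<mu> j) - P i (H j)) \<le> real j * \<mu> j"
    using \<mu>(3)[OF j'] by (simp add: algebra_simps)
  then have diff: "P i (\<mu> j) - P i (H j) \<le> real j * \<mu> j / (N * p i)"
    using Np by (simp add: pos_le_divide_eq mult.commute)
  have "\<mu> j * (F i (\<mu> j) - F i (H j)) \<le> M * (P i (\<mu> j) - P i (H j))"
    using sp.ratio_le[of "H j" "\<mu> j"] H_nonneg[OF j] less \<mu>(2)[OF j'] by simp
  also have "\<dots> \<le> M * (real j * \<mu> j / (N * p i))"
    using diff M_gt_1 by (intro mult_left_mono) auto
  also have "\<dots> = \<mu> j * (real j * M / (N * p i))" by simp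
  finally show ?thesis using pos by (rule mult_left_le_imp_le)
qed

definition choice :: "request \<Rightarrow> nat option" where
  "choice q = atp1_choice I \<sigma> t c q"

lemma choice_eq:
  "choice (i, u) = (let J = {j\<in>resources I. u \<le> h j} in if J = {} then None else Some (\<sigma> i (Min J)))"
proof -
  have "ereal u \<le> acceptance_level I \<sigma> t i j (c i) \<longleftrightarrow> u \<le> h j" if "j \<in> resources I" for j
    using that size_threshold_eq[of j] by (simp add: acceptance_level_def h_def a_def)
  then have "{j\<in>resources I. ereal u \<le> acceptance_level I \<sigma> t i j (c i)} = {j\<in>resources I. u \<le> h j}"
    by blast
  then show ?thesis by (simp only: choice_def atp1_choice_def prod.case)
qed

lemma choice_cases:
  obtains (reject) "choice (i, u) = None" "\<And>j. j \<in> resources I \<Longrightarrow> \<not> u \<le> H j"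
  | (serve) k where "choice (i, u) = Some (\<sigma> i k)" "k \<in> resources I"
      "\<And>j. j \<in> resources I \<Longrightarrow> u \<le> H j \<longleftrightarrow> k \<le> j"
proof (cases "{j\<in>resources I. u \<le> h j} = {}")
  case True
  then show thesis by (intro reject) (auto simp: choice_eq le_H_iff)
next
  case False
  define k where "k = Min {j\<in>resources I. u \<le> h j}"
  have k: "k \<in> resources I" "u \<le> h k"
    using Min_in[OF _ False] by (auto simp: k_def)
  have least: "k \<le> j" if "j \<in> resources I" "u \<le> h j" for j
    using that by (simp add: k_def)
  show thesis
  proof (rule serve[OF _ k(1)])
    show "choice (i, u) = Some (\<sigma> i k)" using False by (simp add: choice_eq k_def)
    show "u \<le> H j \<longleftrightarrow> k \<le> j" if "j \<in> resources I" for j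
      using that k least by (force simp: le_H_iff)
  qed
qed

lemma gain_eq:
  "gain i (i, u) (choice (i, u)) = (\<Sum>j\<in>resources I. weight i j * of_bool (u \<le> H j))"
proof (cases u rule: choice_cases)
  case reject
  then show ?thesis by (simp add: gain_def)
next
  case (serve k)
  have "(\<Sum>j\<in>resources I. weight i j * of_bool (u \<le> H j)) = (\<Sum>j\<in>resources I. if k \<le> j then weight i j else 0)"
    using serve(3) by (intro sum.cong) auto
  also have "\<dots> = (\<Sum>j=k..num_res I. weight i j)"
    using serve(2) by (intro sum.mono_neutral_cong_right) auto
  finally show ?thesis using sum_weight[OF serve(2)] serve(1) by (simp add: gain_def)
qed

lemma budget_consume:
  assumes j: "j \<in> resources I"
  shows "budget i (consume I c (i, u) (choice (i, u)) i) j = budget i (c i) j - u * of_bool (u \<le> H j)"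
proof (cases u rule: choice_cases)
  case reject
  then show ?thesis using j by (simp add: consume_def)
next
  case (serve k)
  have inj: "\<sigma> i l = \<sigma> i k \<longleftrightarrow> l = k" if "l \<in> {1..j}" for l
    by (rule inj_on_eq_iff[OF bij_betw_imp_inj_on[OF order_bij[OF i]]]) (use that j serve(2) in auto)
  have "budget i (consume I c (i, u) (choice (i, u)) i) j =
      (\<Sum>l=1..j. c i (\<sigma> i l) / coef I i (\<sigma> i l) - (if l = k then u else 0))"
    unfolding budget_def
  proof (rule sum.cong[OF refl])
    fix l assume l: "l \<in> {1..j}"
    then have "0 < coef I i (\<sigma> i l)" using j coef_pos[OF i order_mem[OF i]] by auto
    then show "consume I c (i, u) (choice (i, u)) i (\<sigma> i l) / coef I i (\<sigma> i l) =
        c i (\<sigma> i l) / coef I i (\<sigma> i l) - (if l = k then u else 0)"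
      using inj[OF l] by (cases "l = k") (auto simp: serve(1) consume_def diff_divide_distrib)
  qed
  also have "\<dots> = budget i (c i) j - (if k \<in> {1..j} then u else 0)"
    by (simp add: sum_subtractf budget_def)
  finally show ?thesis using serve(2,3) j by simp
qed

lemma consume_other_type: "fst q \<noteq> i \<Longrightarrow> consume I c q d i = c i"
  by (cases d) (auto simp: consume_def)

text \<open>
  An upper bound for the consumption of the first \<open>j\<close> ranks in this period, since all of them only
  accept sizes up to \<open>\<mu> j\<close>; its expectation is a fraction \<open>1 / N\<close> of their budget.
\<close>

definition use_to :: "nat \<Rightarrow> request \<Rightarrow> real" where
  "use_to j q = (if fst q = i then indicator {0..\<mu> j} (snd q) * snd q else 0)"

text \<open>
  The quadratic minorant of \<open>acc i\<close> at \<open>B j\<close>, evaluated at the relative budget left after this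
  period.  If \<open>\<mu> j = 0\<close> the divisions by zero make it vanish, which is the intended minorant.
\<close>

definition minorant :: "nat \<Rightarrow> request \<Rightarrow> real" where
  "minorant j q = (let y = (p i * B j - use_to j q) / ((N - 1) * p i) in
     F i (\<mu> j) + y / \<mu> j - (M - 1) / (\<mu> j * B j) * y ^ 2)"

text \<open>
  The true budget left is at least the one used in the minorant, by the choice of \<open>use_to\<close>, and the
  latter lies in the range of the quadratic bound because the capacities are small enough.
\<close>

lemma acc_next_ge_minorant:
  assumes j: "j \<in> resources I" and q: "good q" and N: "1 < N"
  shows "minorant j q \<le> acc i (budget i (consume I c q (choice q) i) j / ((N - 1) * p i))"
proof -
  obtain f where "size_profile (F i) (P i) f wbar M" using i by (rule size_profile_obtain)
  then interpret sp: size_profile "F i" "P i" f wbar M .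
  have j': "j \<le> num_res I" using j by simp
  have n1: "0 < (N - 1) * p i" using N p_i_pos by simp
  show ?thesis
  proof (cases "\<mu> j = 0")
    case True
    then show ?thesis using sp.accept_nonneg F_0[OF i] by (simp add: minorant_def Let_def)
  next
    case False
    then have \<mu>_pos: "0 < \<mu> j" using \<mu>(1)[OF j'] by simp
    define y where "y = (p i * B j - use_to j q) / ((N - 1) * p i)"
    have y: "B j + y = (budget i (c i) j - use_to j q) / ((N - 1) * p i)"
      using n1 N p_i_pos unfolding y_def budget_eq by (simp add: field_simps)
    have use_nonneg: "0 \<le> use_to j q" by (auto simp: use_to_def indicator_def)
    have "B j + y \<le> P i wbar"
    proof -
      have "budget i (c i) j \<le> P i wbar * ((N - 1) * p i)"
        using budget_mono[of i "c i" j "num_res I", OF i c_nonneg j'] budget_small by (simp add: mult_ac)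
      then show ?thesis unfolding y using n1 use_nonneg by (simp add: pos_divide_le_eq)
    qed
    from sp.accept_quadratic_lower_bound[OF \<mu>_pos \<mu>(2)[OF j'] this]
    have "minorant j q \<le> acc i (B j + y)"
      unfolding minorant_def Let_def y_def[symmetric] using \<mu>(3)[OF j'] by simp
    also have "\<dots> \<le> acc i (budget i (consume I c q (choice q) i) j / ((N - 1) * p i))"
    proof (rule sp.accept_mono)
      have "budget i (c i) j - use_to j q \<le> budget i (consume I c q (choice q) i) j"
      proof (cases "fst q = i")
        case True
        then have q_eq: "q = (i, snd q)" by (simp add: prod_eq_iff)
        have "snd q * of_bool (snd q \<le> H j) \<le> use_to j q"
          using True q H_le_\<mu>[OF j] by (auto simp: use_to_def good_def)
        then show ?thesis using budget_consume[OF j, of "snd q"] q_eq by simp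
      next
        case False
        then show ?thesis using use_nonneg by (simp add: consume_other_type)
      qed
      then show "B j + y \<le> budget i (consume I c q (choice q) i) j / ((N - 1) * p i)"
        unfolding y using n1 by (intro divide_right_mono) auto
    qed
    finally show ?thesis .
  qed
qed

lemma use_to_integrals:
  assumes j: "j \<in> resources I"
  shows "integrable (request_law I) (use_to j)"
    and "(\<integral>q. use_to j q \<partial>request_law I) = p i * B j"
    and "integrable (request_law I) (\<lambda>q. use_to j q ^ 2)"
    and "(\<integral>q. use_to j q ^ 2 \<partial>request_law I) \<le> p i * (\<mu> j * B j)"
proof -
  have j': "j \<le> num_res I" using j by simp
  have b1: "\<bar>indicator {0..\<mu> j} u * u\<bar> \<le> \<mu> j" for u
    using \<mu>(1)[OF j'] by (auto simp: indicator_def)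
  have b2: "\<bar>(indicator {0..\<mu> j} u * u) ^ 2\<bar> \<le> \<mu> j ^ 2" for u
    using power_mono[OF b1[of u] abs_ge_zero, of 2] by simp
  have sq: "use_to j q ^ 2 = (if fst q = i then (indicator {0..\<mu> j} (snd q) * snd q) ^ 2 else 0)" for q
    by (simp add: use_to_def)
  show "integrable (request_law I) (use_to j)"
    unfolding use_to_def[abs_def] using b1
    by (intro integral_request_law_type(1)[OF i, where B = "\<mu> j"]) auto
  show "(\<integral>q. use_to j q \<partial>request_law I) = p i * B j"
    unfolding use_to_def using b1 \<mu>(3)[OF j']
    by (subst integral_request_law_type(2)[OF i, where B = "\<mu> j"]) (auto simp: partial_mean_eq)
  show "integrable (request_law I) (\<lambda>q. use_to j q ^ 2)"
    unfolding sq using b2 by (intro integral_request_law_type(1)[OF i, where B = "\<mu> j ^ 2"]) auto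
  have "(\<integral>u. (indicator {0..\<mu> j} u * u) ^ 2 \<partial>size_law I i) \<le> (\<integral>u. \<mu> j * (indicator {0..\<mu> j} u * u) \<partial>size_law I i)"
  proof (rule integral_mono)
    show "integrable (size_law I i) (\<lambda>u. (indicator {0..\<mu> j} u * u) ^ 2)"
      using b2 by (intro size_law_integrable_bounded[where B = "\<mu> j ^ 2"]) auto
    show "(indicator {0..\<mu> j} u * u) ^ 2 \<le> \<mu> j * (indicator {0..\<mu> j} u * u)" for u
      using \<mu>(1)[OF j'] by (auto simp: indicator_def power2_eq_square mult_right_mono)
  qed (intro integrable_mult_right partial_integrable)
  also have "\<dots> = \<mu> j * B j"
    using \<mu>(3)[OF j'] by (simp add: partial_mean_eq)
  finally have "p i * (\<integral>u. (indicator {0..\<mu> j} u * u) ^ 2 \<partial>size_law I i) \<le> p i * (\<mu> j * B j)"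
    using p_i_pos by (intro mult_left_mono) auto
  then show "(\<integral>q. use_to j q ^ 2 \<partial>request_law I) \<le> p i * (\<mu> j * B j)"
    unfolding sq using b2 by (subst integral_request_law_type(2)[OF i, where B = "\<mu> j ^ 2"]) auto
qed

text \<open>
  The relative budget is a martingale under full acceptance, so only the quadratic term is lost;
  the second moment of the consumption is at most \<open>p i * \<mu> j * B j\<close>, and the factor \<open>\<mu> j * B j\<close>
  cancels against the curvature.
\<close>

lemma minorant_expectation:
  assumes j: "j \<in> resources I" and N: "1 < N"
  shows "integrable (request_law I) (minorant j)"
    and "(N - 1) * p i * F i (\<mu> j) - (M - 1) / (N - 1) \<le>
      (N - 1) * p i * (\<integral>q. minorant j q \<partial>request_law I)"
proof -
  interpret R: prob_space "request_law I" by (rule prob_request_law)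
  note U = use_to_integrals[OF j]
  have j': "j \<le> num_res I" using j by simp
  define n where "n = (N - 1) * p i"
  define \<kappa> where "\<kappa> = (M - 1) / (\<mu> j * B j)"
  have n: "0 < n" using N p_i_pos by (simp add: n_def)
  have \<kappa>: "0 \<le> \<kappa>" using M_gt_1 \<mu>(1)[OF j'] B_bounds(1)[OF j'] by (simp add: \<kappa>_def)
  define Y where "Y q = (p i * B j - use_to j q) / n" for q
  have int_y: "integrable (request_law I) Y"
    unfolding Y_def
    by (intro integrable_divide Bochner_Integration.integrable_diff U(1)) simp
  have y2: "Y q ^ 2 = ((p i * B j) ^ 2 - 2 * (p i * B j) * use_to j q + use_to j q ^ 2) / n ^ 2" for q
    by (simp add: Y_def power_divide power2_diff)
  have int_y2: "integrable (request_law I) (\<lambda>q. Y q ^ 2)"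
    unfolding y2
    by (intro integrable_divide Bochner_Integration.integrable_add Bochner_Integration.integrable_diff
        integrable_mult_right U) simp
  have eq: "minorant j q = F i (\<mu> j) + Y q / \<mu> j - \<kappa> * Y q ^ 2" for q
    by (simp add: minorant_def Let_def Y_def n_def \<kappa>_def)
  show "integrable (request_law I) (minorant j)"
    unfolding eq[abs_def]
    by (intro Bochner_Integration.integrable_diff Bochner_Integration.integrable_add integrable_mult_right
        integrable_divide int_y int_y2) simp
  have E_y: "(\<integral>q. Y q \<partial>request_law I) = 0"
    unfolding Y_def using U(1,2) R.prob_space by simp
  have "(\<integral>q. Y q ^ 2 \<partial>request_law I) =
      ((p i * B j) ^ 2 - 2 * (p i * B j) * (p i * B j) + (\<integral>q. use_to j q ^ 2 \<partial>request_law I)) / n ^ 2"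
    unfolding y2 using U R.prob_space by simp
  also have "\<dots> \<le> p i * (\<mu> j * B j) / n ^ 2"
  proof (rule divide_right_mono)
    have "2 * (p i * B j) * (p i * B j) = 2 * (p i * B j) ^ 2"
      by (simp only: power2_eq_square mult.assoc)
    then show "(p i * B j) ^ 2 - 2 * (p i * B j) * (p i * B j) + (\<integral>q. use_to j q ^ 2 \<partial>request_law I)
        \<le> p i * (\<mu> j * B j)"
      using U(4) zero_le_power2[of "p i * B j"] by linarith
  qed simp
  finally have E_y2: "(\<integral>q. Y q ^ 2 \<partial>request_law I) \<le> p i * (\<mu> j * B j) / n ^ 2" .
  have "(\<integral>q. minorant j q \<partial>request_law I) = F i (\<mu> j) + 0 / \<mu> j - \<kappa> * (\<integral>q. Y q ^ 2 \<partial>request_law I)"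
    unfolding eq using int_y int_y2 R.prob_space E_y by simp
  then have "n * (\<integral>q. minorant j q \<partial>request_law I) = n * F i (\<mu> j) - n * (\<kappa> * (\<integral>q. Y q ^ 2 \<partial>request_law I))"
    by (simp add: right_diff_distrib)
  moreover have "n * (\<kappa> * (\<integral>q. Y q ^ 2 \<partial>request_law I)) \<le> n * (\<kappa> * (p i * (\<mu> j * B j) / n ^ 2))"
    using n \<kappa> E_y2 by (intro mult_left_mono) auto
  \<comment> \<open>an equality unless \<open>\<mu> j * B j = 0\<close>, in which case the left side is zero\<close>
  moreover have "n * (\<kappa> * (p i * (\<mu> j * B j) / n ^ 2)) \<le> (M - 1) / (N - 1)"
    using n N p_i_pos M_gt_1 by (auto simp: \<kappa>_def n_def power2_eq_square)
  ultimately show "(N - 1) * p i * F i (\<mu> j) - (M - 1) / (N - 1) \<le>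
      (N - 1) * p i * (\<integral>q. minorant j q \<partial>request_law I)"
    by (simp add: n_def)
qed

definition next_value :: "request \<Rightarrow> real" where
  "next_value q = potential i (N - 1) (consume I c q (choice q) i) + gain i q (choice q)"

lemma next_value_ge:
  assumes q: "good q"
  shows "(\<Sum>j\<in>resources I. weight i j * ((N - 1) * p i * minorant j q +
      (if fst q = i then indicator {0..H j} (snd q) else 0))) \<le> next_value q"
proof -
  have pot: "(\<Sum>j\<in>resources I. weight i j * ((N - 1) * p i * minorant j q))
      \<le> potential i (N - 1) (consume I c q (choice q) i)"
  proof (cases "N = 1")
    case False
    then have N: "1 < N" using N_ge_1 by simp
    have "(\<Sum>j\<in>resources I. weight i j * minorant j q) \<le>
        (\<Sum>j\<in>resources I. weight i j * acc i (budget i (consume I c q (choice q) i) j / ((N - 1) * p i)))"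
      using acc_next_ge_minorant[OF _ q N] weight_nonneg[OF i] by (intro sum_mono mult_left_mono) auto
    then have "(N - 1) * p i * (\<Sum>j\<in>resources I. weight i j * minorant j q) \<le>
        potential i (N - 1) (consume I c q (choice q) i)"
      unfolding potential_def using N p_i_pos by (intro mult_left_mono) auto
    then show ?thesis by (simp add: sum_distrib_left mult_ac)
  qed (simp add: potential_def)
  have "(\<Sum>j\<in>resources I. weight i j * (if fst q = i then indicator {0..H j} (snd q) else 0)) = gain i q (choice q)"
  proof (cases "fst q = i")
    case True
    then have "q = (i, snd q)" by (simp add: prod_eq_iff)
    moreover have "(indicator {0..H j} (snd q) :: real) = of_bool (snd q \<le> H j)" for j
      using q by (auto simp: good_def indicator_def)
    ultimately show ?thesis using gain_eq[of "snd q"] True by simp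
  qed (simp add: gain_def)
  with pot show ?thesis
    unfolding next_value_def distrib_left sum.distrib by linarith
qed

lemma next_value_bounded:
  assumes "good q"
  shows "\<bar>next_value q\<bar> \<le> (N - 1) * p i * max_reward I i + max_reward I i"
proof -
  have "0 \<le> gain i q (choice q) \<and> gain i q (choice q) \<le> max_reward I i"
  proof (cases "fst q = i")
    case True
    then have q_eq: "q = (i, snd q)" by (simp add: prod_eq_iff)
    show ?thesis
    proof (cases "snd q" rule: choice_cases)
      case reject
      then show ?thesis using q_eq max_reward_nonneg[OF i] by (metis gain_def option.simps(4) order_refl)
    next
      case (serve k)
      then have "gain i q (choice q) = rew I i (\<sigma> i k)" using q_eq by (metis True gain_def option.simps(5))
      then show ?thesis
        using rew_nonneg[OF i] max_reward_ge order_mem[OF i serve(2)] by simp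
    qed
  qed (simp add: gain_def max_reward_nonneg[OF i])
  then show ?thesis
    using potential_bounds[OF i, of "N - 1" "consume I c q (choice q) i"] N_ge_1
    by (simp add: next_value_def)
qed

lemma expected_next_value:
  assumes meas: "next_value \<in> borel_measurable request_space"
  shows "potential i N (c i) - step_loss i N \<le> (\<integral>q. next_value q \<partial>request_law I)"
proof -
  interpret R: prob_space "request_law I" by (rule prob_request_law)
  obtain f where "size_profile (F i) (P i) f wbar M" using i by (rule size_profile_obtain)
  then interpret sp: size_profile "F i" "P i" f wbar M .
  let ?serve = "\<lambda>j q. if fst q = i then indicat_real {0..H j} (snd q) else 0"
  have serve: "integrable (request_law I) (?serve j)"
    "(\<integral>q. ?serve j q \<partial>request_law I) = p i * F i (H j)" if j: "j \<in> resources I" for j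
    using integral_request_law_type[OF i, where g = "indicat_real {0..H j}" and B = 1]
      F_eq_integral[OF i H_nonneg[OF j]] by (auto simp: indicator_def)
  have min_int: "integrable (request_law I) (\<lambda>q. (N - 1) * p i * minorant j q)" if j: "j \<in> resources I" for j
  proof (cases "N = 1")
    case False
    then show ?thesis using minorant_expectation(1)[OF j] N_ge_1 by simp
  qed simp
  have min_ge: "(N - 1) * p i * F i (\<mu> j) - (M - 1) / (N - 1) \<le>
      (\<integral>q. (N - 1) * p i * minorant j q \<partial>request_law I)" if j: "j \<in> resources I" for j
  proof (cases "N = 1")
    case False
    then show ?thesis using minorant_expectation(2)[OF j] N_ge_1 by simp
  qed simp
  have int_j: "integrable (request_law I) (\<lambda>q. weight i j * ((N - 1) * p i * minorant j q + ?serve j q))"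
    if "j \<in> resources I" for j
    by (rule integrable_mult_right[OF Bochner_Integration.integrable_add[OF min_int[OF that] serve(1)[OF that]]])
  have level: "N * p i * F i (\<mu> j) - (real j * M / N + (M - 1) / (N - 1)) \<le>
      (\<integral>q. (N - 1) * p i * minorant j q + ?serve j q \<partial>request_law I)" if j: "j \<in> resources I" for j
  proof -
    have "p i * (F i (\<mu> j) - F i (H j)) \<le> p i * (real j * M / (N * p i))"
      using service_loss[OF j] p_i_pos by (intro mult_left_mono) auto
    also have "\<dots> = real j * M / N" using p_i_pos by simp
    finally have "p i * F i (\<mu> j) - real j * M / N \<le> p i * F i (H j)" by (simp add: right_diff_distrib)
    moreover have "(\<integral>q. (N - 1) * p i * minorant j q + ?serve j q \<partial>request_law I) =
        (\<integral>q. (N - 1) * p i * minorant j q \<partial>request_law I) + p i * F i (H j)"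
      using Bochner_Integration.integral_add[OF min_int[OF j] serve(1)[OF j]] serve(2)[OF j] by simp
    ultimately show ?thesis using min_ge[OF j] by (simp add: algebra_simps)
  qed
  have acc: "acc i (budget i (c i) j / (N * p i)) = F i (\<mu> j)" if "j \<in> resources I" for j
  proof -
    have j': "j \<le> num_res I" using that by simp
    have "acc i (P i (\<mu> j)) = F i (\<mu> j)"
      using \<mu>[OF j'] by (intro sp.accept_P) auto
    then show ?thesis using \<mu>(3)[OF j'] by (simp add: B_def)
  qed
  have "potential i N (c i) - step_loss i N =
      (\<Sum>j\<in>resources I. weight i j * (N * p i * F i (\<mu> j) - (real j * M / N + (M - 1) / (N - 1))))"
    unfolding potential_def step_loss_def sum_distrib_left sum_subtractf[symmetric]
    by (intro sum.cong refl) (simp add: acc right_diff_distrib mult_ac)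
  also have "\<dots> \<le> (\<Sum>j\<in>resources I. weight i j *
      (\<integral>q. (N - 1) * p i * minorant j q + ?serve j q \<partial>request_law I))"
    using level weight_nonneg[OF i] by (intro sum_mono mult_left_mono) auto
  also have "\<dots> = (\<Sum>j\<in>resources I. \<integral>q. weight i j * ((N - 1) * p i * minorant j q + ?serve j q) \<partial>request_law I)"
    by (simp only: integral_mult_right_zero)
  also have "\<dots> = (\<integral>q. (\<Sum>j\<in>resources I. weight i j * ((N - 1) * p i * minorant j q + ?serve j q)) \<partial>request_law I)"
    by (rule Bochner_Integration.integral_sum[OF int_j, symmetric])
  also have "\<dots> \<le> (\<integral>q. next_value q \<partial>request_law I)"
  proof (rule integral_mono_AE)
    show "integrable (request_law I) (\<lambda>q. \<Sum>j\<in>resources I. weight i j * ((N - 1) * p i * minorant j q + ?serve j q))"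
      by (rule Bochner_Integration.integrable_sum[OF int_j])
    have "AE q in request_law I. norm (next_value q) \<le> (N - 1) * p i * max_reward I i + max_reward I i"
      using AE_good by eventually_elim (simp only: real_norm_def next_value_bounded)
    then show "integrable (request_law I) next_value"
      by (rule R.integrable_const_bound) (simp add: meas cong: measurable_cong_sets)
    show "AE q in request_law I. (\<Sum>j\<in>resources I. weight i j * ((N - 1) * p i * minorant j q + ?serve j q))
        \<le> next_value q"
      using AE_good by eventually_elim (rule next_value_ge)
  qed
  finally show ?thesis .
qed

end

section \<open>Measurability of the policy\<close>

lemma borel_down_closed:
  fixes A :: "real set"
  assumes "\<And>x y. x \<in> A \<Longrightarrow> y \<le> x \<Longrightarrow> y \<in> A"
  shows "A \<in> sets borel"
proof -
  have "mono (\<lambda>x. if x \<in> A then 0 else 1 :: real)"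
    using assms by (auto simp: mono_def)
  then have [measurable]: "(\<lambda>x. if x \<in> A then 0 else 1 :: real) \<in> borel_measurable borel"
    by (rule borel_measurable_mono)
  have "{x \<in> space borel. (if x \<in> A then 0 else 1 :: real) < 1} \<in> sets borel"
    by measurable
  moreover have "{x \<in> space borel. (if x \<in> A then 0 else 1 :: real) < 1} = A" by auto
  ultimately show ?thesis by (simp only:)
qed

context atp_instance
begin

text \<open>
  By continuity of \<open>P i\<close>, a threshold below \<open>y\<close> exists for every budget up to the consumption at
  some level below \<open>y\<close>.  For indices that are not types the equation reads \<open>0 = s\<close>.
\<close>

lemma threshold_measurable:
  assumes t: "t \<in> periods I"
  shows "(\<lambda>s. Inf {ereal w | w. 0 \<le> w \<and> p i * P i w = 1 / periods_left I t * s}) \<in> borel_measurable borel"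
proof (rule borel_measurableI_less)
  fix y :: ereal
  let ?N = "periods_left I t"
  have N: "0 < ?N" using t by auto
  have eq: "p i * P i w = 1 / ?N * s \<longleftrightarrow> ?N * p i * P i w = s" for w s
    using N by (auto simp: field_simps)
  have Inf_less: "Inf {ereal w | w. 0 \<le> w \<and> p i * P i w = 1 / ?N * s} < y \<longleftrightarrow>
      (\<exists>w\<ge>0. ereal w < y \<and> ?N * p i * P i w = s)" for s
    unfolding Inf_less_iff eq by blast
  show "{s \<in> space borel. Inf {ereal w | w. 0 \<le> w \<and> p i * P i w = 1 / ?N * s} < y} \<in> sets borel"
  proof (cases "i \<in> types I")
    case True
    have Np: "0 < ?N * p i" using N p_pos[OF True] by simp
    have "(\<exists>w\<ge>0. ereal w < y \<and> ?N * p i * P i w = s) \<longleftrightarrow>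
        0 \<le> s \<and> (\<exists>w\<ge>0. ereal w < y \<and> s \<le> ?N * p i * P i w)" (is "?L \<longleftrightarrow> ?R") for s
    proof
      assume ?L
      then show ?R using Np P_nonneg[OF True] by (metis mult_nonneg_nonneg less_imp_le order_refl)
    next
      assume ?R
      then obtain w where w: "0 \<le> s" "0 \<le> w" "ereal w < y" "s \<le> ?N * p i * P i w" by blast
      have "\<exists>v\<ge>0. v \<le> w \<and> ?N * p i * P i v = s"
        using w P_cont[OF True, of w] by (intro IVT') (auto intro!: continuous_intros)
      then obtain v where "0 \<le> v" "v \<le> w" "?N * p i * P i v = s" by blast
      then show ?L using w(3) by (metis ereal_less_eq(3) order_le_less_trans)
    qed
    then have set_eq: "{s \<in> space borel. Inf {ereal w | w. 0 \<le> w \<and> p i * P i w = 1 / ?N * s} < y} =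
        {0..} \<inter> {s. \<exists>w\<ge>0. ereal w < y \<and> s \<le> ?N * p i * P i w}"
      unfolding Inf_less by auto
    show ?thesis
      unfolding set_eq by (rule sets.Int[OF _ borel_down_closed]) (auto intro: order_trans)
  next
    case False
    then have "{s \<in> space borel. Inf {ereal w | w. 0 \<le> w \<and> p i * P i w = 1 / ?N * s} < y} \<subseteq> {0}"
      unfolding Inf_less by (auto simp: p_zero)
    then have "finite {s \<in> space borel. Inf {ereal w | w. 0 \<le> w \<and> p i * P i w = 1 / ?N * s} < y}"
      by (rule finite_subset) simp
    then show ?thesis by (rule borel_closed[OF finite_imp_closed])
  qed
qed

text \<open>
  The state and the measure space are arbitrary, so that the lemma applies both along the random path
  and to a single period with a fixed state.
\<close>

lemma choice_measurable:
  assumes t: "t \<in> periods I"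
    and C: "\<And>i k. (\<lambda>\<omega>. C \<omega> i k) \<in> borel_measurable S"
    and Q: "Q \<in> S \<rightarrow>\<^sub>M request_space"
  shows "(\<lambda>\<omega>. atp1_choice I \<sigma> t (C \<omega>) (Q \<omega>)) \<in> S \<rightarrow>\<^sub>M count_space UNIV"
proof -
  have Q1: "(\<lambda>\<omega>. fst (Q \<omega>)) \<in> S \<rightarrow>\<^sub>M count_space UNIV"
    by (rule measurable_compose[OF Q measurable_fst])
  have Q2: "(\<lambda>\<omega>. snd (Q \<omega>)) \<in> borel_measurable S"
    by (rule measurable_compose[OF Q measurable_snd])
  have fixed_type: "(\<lambda>\<omega>. atp1_choice I \<sigma> t (C \<omega>) (i, snd (Q \<omega>))) \<in> S \<rightarrow>\<^sub>M count_space UNIV" for i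
  proof -
    let ?A = "\<lambda>j \<omega>. ereal (snd (Q \<omega>)) \<le> acceptance_level I \<sigma> t i j (C \<omega> i)"
    have level: "(\<lambda>\<omega>. acceptance_level I \<sigma> t i j (C \<omega> i)) \<in> borel_measurable S" for j
    proof -
      have "(\<lambda>\<omega>. \<Sum>k=1..j. C \<omega> i (\<sigma> i k) / coef I i (\<sigma> i k)) \<in> borel_measurable S"
        by (intro borel_measurable_sum borel_measurable_divide C borel_measurable_const)
      from measurable_compose[OF this threshold_measurable[OF t, of i]]
      have "(\<lambda>\<omega>. size_threshold I \<sigma> t i j (C \<omega> i)) \<in> borel_measurable S"
        by (simp only: size_threshold_def)
      then show ?thesis
        unfolding acceptance_level_def
        by (intro borel_measurable_min borel_measurable_ereal borel_measurable_divide C borel_measurable_const)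
    qed
    have A: "Measurable.pred S (?A j)" for j
      unfolding pred_def by (intro borel_measurable_le borel_measurable_ereal Q2 level)
    have ex: "Measurable.pred S (\<lambda>\<omega>. \<exists>j\<in>resources I. ?A j \<omega>)"
      by (intro pred_intros_finite A) simp
    have least: "(\<lambda>\<omega>. LEAST j. j \<in> resources I \<and> ?A j \<omega>) \<in> S \<rightarrow>\<^sub>M count_space UNIV"
      by (intro measurable_Least pred_intros_logic A) simp
    have eq: "atp1_choice I \<sigma> t (C \<omega>) (i, snd (Q \<omega>)) =
        (if \<exists>j\<in>resources I. ?A j \<omega> then Some (\<sigma> i (LEAST j. j \<in> resources I \<and> ?A j \<omega>)) else None)" for \<omega>
    proof (cases "\<exists>j\<in>resources I. ?A j \<omega>")
      case True
      then have "(LEAST j. j \<in> resources I \<and> ?A j \<omega>) = Min {j\<in>resources I. ?A j \<omega>}"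
        by (intro Least_Min) auto
      with True show ?thesis by (auto simp: atp1_choice_def Let_def)
    next
      case False
      then have "{j\<in>resources I. ?A j \<omega>} = {}" by blast
      with False show ?thesis by (simp only: atp1_choice_def prod.case Let_def simp_thms if_True if_False)
    qed
    show ?thesis
      unfolding eq
      by (intro measurable_If predE[OF ex] measurable_compose[OF least]) auto
  qed
  from measurable_compose_countable[where f = "\<lambda>i \<omega>. atp1_choice I \<sigma> t (C \<omega>) (i, snd (Q \<omega>))", OF fixed_type Q1]
  show ?thesis by simp
qed

lemma consume_eq:
  "consume I c q d i k =
    c i k - (if d = Some k \<and> fst q = i then coef I i k * snd q else 0)"
  by (cases d) (auto simp: consume_def)

lemma consume_measurable:
  assumes C: "\<And>i k. (\<lambda>\<omega>. C \<omega> i k) \<in> borel_measurable S"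
    and Q: "Q \<in> S \<rightarrow>\<^sub>M request_space"
    and d: "d \<in> S \<rightarrow>\<^sub>M count_space UNIV"
  shows "(\<lambda>\<omega>. consume I (C \<omega>) (Q \<omega>) (d \<omega>) i k) \<in> borel_measurable S"
proof -
  have "Measurable.pred S (\<lambda>\<omega>. d \<omega> = Some k)"
    by (rule measurable_compose[OF d]) simp
  moreover have "Measurable.pred S (\<lambda>\<omega>. fst (Q \<omega>) = i)"
    by (rule measurable_compose[OF measurable_compose[OF Q measurable_fst]]) simp
  ultimately have "{\<omega> \<in> space S. d \<omega> = Some k \<and> fst (Q \<omega>) = i} \<in> sets S"
    by (intro predE pred_intros_logic)
  then show ?thesis
    unfolding consume_eq
    by (intro borel_measurable_diff C measurable_If borel_measurable_times borel_measurable_const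
        measurable_compose[OF Q measurable_snd])
qed

lemma gain_measurable:
  assumes Q: "Q \<in> S \<rightarrow>\<^sub>M request_space" and d: "d \<in> S \<rightarrow>\<^sub>M count_space UNIV"
  shows "(\<lambda>\<omega>. gain i (Q \<omega>) (d \<omega>)) \<in> borel_measurable S"
proof -
  have "Measurable.pred S (\<lambda>\<omega>. fst (Q \<omega>) = i)"
    by (rule measurable_compose[OF measurable_compose[OF Q measurable_fst]]) simp
  then show ?thesis
    unfolding gain_def
    by (intro measurable_If predE measurable_compose[OF d]) auto
qed

lemma potential_measurable:
  assumes i: "i \<in> types I" and C: "\<And>k. (\<lambda>\<omega>. C \<omega> i k) \<in> borel_measurable S"
  shows "(\<lambda>\<omega>. potential i N (C \<omega> i)) \<in> borel_measurable S"
proof -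
  obtain f where "size_profile (F i) (P i) f wbar M" using i by (rule size_profile_obtain)
  then interpret sp: size_profile "F i" "P i" f wbar M .
  show ?thesis
    unfolding potential_def budget_def
    by (intro borel_measurable_times borel_measurable_const borel_measurable_sum
        measurable_compose[OF _ sp.accept_measurable] borel_measurable_divide C)
qed

abbreviation state :: "nat \<Rightarrow> (nat \<Rightarrow> request) \<Rightarrow> nat \<Rightarrow> nat \<Rightarrow> real" where
  "state t \<omega> \<equiv> atp1_cap I \<sigma> cs \<omega> t"

abbreviation decision :: "nat \<Rightarrow> (nat \<Rightarrow> request) \<Rightarrow> nat option" where
  "decision t \<omega> \<equiv> atp1_choice I \<sigma> t (state t \<omega>) (\<omega> t)"

lemma state_1: "state 1 \<omega> = cs"
  by (simp add: One_nat_def)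

lemma state_Suc: "1 \<le> t \<Longrightarrow> state (Suc t) \<omega> = consume I (state t \<omega>) (\<omega> t) (decision t \<omega>)"
  by simp

lemma state_measurable:
  assumes "1 \<le> t" "t \<le> Suc (horizon I)"
  shows "(\<lambda>\<omega>. state t \<omega> i k) \<in> borel_measurable (sample_space I)"
  using assms
proof (induction t arbitrary: i k rule: dec_induct)
  case base
  show ?case by (simp only: state_1 borel_measurable_const)
next
  case (step t)
  then have t: "t \<in> periods I" and C: "\<And>i k. (\<lambda>\<omega>. state t \<omega> i k) \<in> borel_measurable (sample_space I)"
    by auto
  show ?case
    unfolding state_Suc[OF step.hyps(1)]
    by (intro consume_measurable choice_measurable C t request_component_measurable(1))
qed

lemma decision_measurable:
  assumes t: "t \<in> periods I"
  shows "decision t \<in> sample_space I \<rightarrow>\<^sub>M count_space UNIV"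
proof -
  have "(\<lambda>\<omega>. state t \<omega> i k) \<in> borel_measurable (sample_space I)" for i k
    using t by (intro state_measurable) auto
  from choice_measurable[OF t this request_component_measurable(1)[OF t]]
  show ?thesis by simp
qed

section \<open>The regret bound\<close>

lemma cs_nonneg: "i \<in> types I \<Longrightarrow> k \<in> resources I \<Longrightarrow> 0 \<le> cs i k"
  using optimal by (simp add: optimal_split_def feasible_split_def)

lemma decision_SomeD:
  assumes "good (\<omega> t)" "decision t \<omega> = Some k"
  shows "k \<in> resources I" "coef I (fst (\<omega> t)) k * snd (\<omega> t) \<le> state t \<omega> (fst (\<omega> t)) k"
proof -
  have i: "fst (\<omega> t) \<in> types I" using assms by (simp add: good_def)
  show k: "k \<in> resources I" using atp1_choice_SomeD(1)[OF order i assms(2)] .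
  show "coef I (fst (\<omega> t)) k * snd (\<omega> t) \<le> state t \<omega> (fst (\<omega> t)) k"
    using atp1_choice_SomeD(2)[OF order i assms(2)] coef_pos[OF i k]
    by (simp add: pos_le_divide_eq mult.commute)
qed

lemma state_bounds:
  assumes "1 \<le> t" "\<And>s. 1 \<le> s \<Longrightarrow> s < t \<Longrightarrow> good (\<omega> s)" "i \<in> types I" "k \<in> resources I"
  shows "0 \<le> state t \<omega> i k \<and> state t \<omega> i k \<le> cs i k"
  using assms
proof (induction t rule: dec_induct)
  case base
  then show ?case unfolding state_1 using cs_nonneg by simp
next
  case (step t)
  have IH: "0 \<le> state t \<omega> i k \<and> state t \<omega> i k \<le> cs i k"
    using step by auto
  have g: "good (\<omega> t)" using step by auto
  show ?case
  proof (cases "decision t \<omega> = Some k \<and> fst (\<omega> t) = i")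
    case True
    then have "0 \<le> coef I i k * snd (\<omega> t)"
      using g coef_pos[OF step.prems(2,3)] by (simp add: good_def)
    then show ?thesis
      using decision_SomeD(2)[of \<omega> t k, OF g] True IH
      unfolding state_Suc[OF step.hyps(1)] consume_eq by auto
  next
    case False
    then show ?thesis using IH unfolding state_Suc[OF step.hyps(1)] consume_eq by auto
  qed
qed

lemma gain_bounds:
  assumes i: "i \<in> types I" and g: "good (\<omega> t)"
  shows "0 \<le> gain i (\<omega> t) (decision t \<omega>)" "gain i (\<omega> t) (decision t \<omega>) \<le> max_reward I i"
  using decision_SomeD(1)[of \<omega> t, OF g] rew_nonneg[OF i] max_reward_ge[of _ i] max_reward_nonneg[OF i]
  by (auto simp: gain_def split: option.split)

lemma gain_integrable:
  assumes i: "i \<in> types I" and t: "t \<in> periods I"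
  shows "integrable (sample_space I) (\<lambda>\<omega>. gain i (\<omega> t) (decision t \<omega>))"
proof -
  interpret prob_space "sample_space I" by (rule prob_sample_space)
  have "AE \<omega> in sample_space I. norm (gain i (\<omega> t) (decision t \<omega>)) \<le> max_reward I i"
    using AE_good_sample
  proof eventually_elim
    case (elim \<omega>)
    then have "good (\<omega> t)" using t by blast
    from gain_bounds[of i \<omega> t, OF i this] show ?case by simp
  qed
  then show ?thesis
    by (rule integrable_const_bound)
       (intro gain_measurable request_component_measurable(1) decision_measurable t)
qed

lemma potential_integrable:
  assumes i: "i \<in> types I" and N: "0 \<le> N" and t: "1 \<le> t" "t \<le> Suc (horizon I)"
  shows "integrable (sample_space I) (\<lambda>\<omega>. potential i N (state t \<omega> i))"
proof -
  interpret prob_space "sample_space I" by (rule prob_sample_space)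
  show ?thesis
    using potential_bounds[OF i N]
    by (intro integrable_const_bound[of _ "N * p i * max_reward I i"] potential_measurable i
        state_measurable t) auto
qed

text \<open>
  The state at the start of period \<open>t\<close> is a function of the earlier requests, so resampling the
  request of period \<open>t\<close> reduces the claim to a fixed state.
\<close>

lemma expected_period:
  assumes i: "i \<in> types I" and t: "t \<in> periods I"
    and small: "budget i (cs i) (num_res I) \<le> (periods_left I t - 1) * p i * P i wbar"
  shows "- step_loss i (periods_left I t) \<le>
    (\<integral>\<omega>. potential i (periods_left I t - 1) (state (Suc t) \<omega> i) + gain i (\<omega> t) (decision t \<omega>)
      - potential i (periods_left I t) (state t \<omega> i) \<partial>sample_space I)"
proof (rule sample_space_resample_ge[OF t])
  have "0 \<le> periods_left I t - 1" "1 \<le> t" using t by auto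
  then show "integrable (sample_space I) (\<lambda>\<omega>. potential i (periods_left I t - 1) (state (Suc t) \<omega> i) +
      gain i (\<omega> t) (decision t \<omega>) - potential i (periods_left I t) (state t \<omega> i))"
    using t i by (intro Bochner_Integration.integrable_diff Bochner_Integration.integrable_add
        potential_integrable gain_integrable) auto
next
  fix X assume X: "\<forall>s\<in>periods I - {t}. good (X s)"
  let ?c = "state t X"
  have t1: "1 \<le> t" using t by simp
  have c_eq: "state t (X(t := q)) = ?c" for q
    by (rule atp1_cap_cong) auto
  have c: "0 \<le> ?c i k \<and> ?c i k \<le> cs i k" if "k \<in> resources I" for k
    using t X by (intro state_bounds[OF t1 _ i that]) auto
  have "budget i (?c i) (num_res I) \<le> budget i (cs i) (num_res I)"
    unfolding budget_def using c order_mem[OF i] coef_pos[OF i]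
    by (intro sum_mono divide_right_mono) (auto intro: less_imp_le)
  with small interpret atp_step I wbar M cs \<sigma> i t ?c
    using i t c by unfold_locales auto
  have eq: "potential i (periods_left I t - 1) (state (Suc t) (X(t := q)) i) +
      gain i ((X(t := q)) t) (decision t (X(t := q))) - potential i (periods_left I t) (state t (X(t := q)) i) =
      next_value q - potential i N (?c i)" for q
    unfolding state_Suc[OF t1] c_eq fun_upd_same next_value_def choice_def N_def ..
  have id: "(\<lambda>q. q) \<in> request_space \<rightarrow>\<^sub>M request_space" by (rule measurable_ident_sets[OF refl])
  have ch: "choice \<in> request_space \<rightarrow>\<^sub>M count_space UNIV"
    unfolding choice_def[abs_def] by (rule choice_measurable[OF t borel_measurable_const id])
  have meas: "next_value \<in> borel_measurable request_space"
    unfolding next_value_def[abs_def]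
    by (intro borel_measurable_add potential_measurable i consume_measurable gain_measurable
        borel_measurable_const id ch)
  interpret R: prob_space "request_law I" by (rule prob_request_law)
  have "AE q in request_law I. norm (next_value q) \<le> (N - 1) * p i * max_reward I i + max_reward I i"
    using AE_good by eventually_elim (simp only: real_norm_def next_value_bounded)
  then have int: "integrable (request_law I) next_value"
    by (rule R.integrable_const_bound) (simp add: meas cong: measurable_cong_sets)
  have "- step_loss i N \<le> (\<integral>q. next_value q \<partial>request_law I) - potential i N (?c i)"
    using expected_next_value[OF meas] by simp
  also have "\<dots> = (\<integral>q. next_value q - potential i N (?c i) \<partial>request_law I)"
    using int R.prob_space by simp
  finally show "- step_loss i (periods_left I t) \<le>
      (\<integral>q. potential i (periods_left I t - 1) (state (Suc t) (X(t := q)) i) +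
        gain i ((X(t := q)) t) (decision t (X(t := q))) -
        potential i (periods_left I t) (state t (X(t := q)) i) \<partial>request_law I)"
    unfolding eq by (simp only: N_def)
qed

lemma step_loss_nonneg:
  assumes i: "i \<in> types I" and N: "1 \<le> N"
  shows "0 \<le> step_loss i N"
  unfolding step_loss_def using N M_gt_1 weight_nonneg[OF i]
  by (intro sum_nonneg mult_nonneg_nonneg add_nonneg_nonneg divide_nonneg_nonneg) auto

text \<open>
  The sum stops after period \<open>s\<close>, before the thresholds can leave the range in which the size laws are
  regular.
\<close>

lemma expected_gain_telescope:
  assumes i: "i \<in> types I" and s: "s \<le> horizon I"
    and small: "budget i (cs i) (num_res I) \<le> (real (horizon I) - real s) * p i * P i wbar"
  shows "potential i (real (horizon I)) (cs i) - (\<Sum>t=1..s. step_loss i (periods_left I t)) \<le>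
    (\<Sum>t=1..s. \<integral>\<omega>. gain i (\<omega> t) (decision t \<omega>) \<partial>sample_space I) +
    (\<integral>\<omega>. potential i (real (horizon I) - real s) (state (Suc s) \<omega> i) \<partial>sample_space I)"
  using s small
proof (induction s)
  case 0
  interpret prob_space "sample_space I" by (rule prob_sample_space)
  have "state (Suc 0) \<omega> = cs" for \<omega> by simp
  then show ?case using prob_space by simp
next
  case (Suc s)
  let ?t = "Suc s"
  have t: "?t \<in> periods I" using Suc.prems by auto
  have left: "periods_left I ?t = real (horizon I) - real s"
    "real (horizon I) - real s - 1 = real (horizon I) - real (Suc s)" by simp_all
  have small_t: "budget i (cs i) (num_res I) \<le> (periods_left I ?t - 1) * p i * P i wbar"
    using Suc.prems(2) unfolding left .
  have wbar: "0 \<le> p i * P i wbar" using p_pos[OF i] P_nonneg[OF i, of wbar] wbar_pos by simp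
  have "(real (horizon I) - real (Suc s)) * (p i * P i wbar) \<le> (real (horizon I) - real s) * (p i * P i wbar)"
    using wbar by (intro mult_right_mono) auto
  then have small': "budget i (cs i) (num_res I) \<le> (real (horizon I) - real s) * p i * P i wbar"
    using Suc.prems(2) by (simp only: mult.assoc)
  have IH: "potential i (real (horizon I)) (cs i) - (\<Sum>t=1..s. step_loss i (periods_left I t)) \<le>
      (\<Sum>t=1..s. \<integral>\<omega>. gain i (\<omega> t) (decision t \<omega>) \<partial>sample_space I) +
      (\<integral>\<omega>. potential i (real (horizon I) - real s) (state ?t \<omega> i) \<partial>sample_space I)"
    using Suc.IH small' Suc.prems(1) by simp
  have int: "integrable (sample_space I) (\<lambda>\<omega>. potential i (periods_left I ?t - 1) (state (Suc ?t) \<omega> i))"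
    by (rule potential_integrable[OF i]) (use t in auto)
  have int': "integrable (sample_space I) (\<lambda>\<omega>. potential i (periods_left I ?t) (state ?t \<omega> i))"
    by (rule potential_integrable[OF i]) (use t in auto)
  note int_gain = gain_integrable[OF i t]
  have "- step_loss i (periods_left I ?t) \<le>
      (\<integral>\<omega>. potential i (periods_left I ?t - 1) (state (Suc ?t) \<omega> i) \<partial>sample_space I) +
      (\<integral>\<omega>. gain i (\<omega> ?t) (decision ?t \<omega>) \<partial>sample_space I) -
      (\<integral>\<omega>. potential i (periods_left I ?t) (state ?t \<omega> i) \<partial>sample_space I)"
    using expected_period[OF i t small_t]
    unfolding Bochner_Integration.integral_diff[OF Bochner_Integration.integrable_add[OF int int_gain] int']
      Bochner_Integration.integral_add[OF int int_gain] .
  moreover have sum_Suc: "(\<Sum>t=1..Suc s. g t) = (\<Sum>t=1..s. g t) + g (Suc s)" for g :: "nat \<Rightarrow> real"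
    by simp
  ultimately show ?case using IH unfolding left sum_Suc by linarith
qed

end

lemma harm_le: "1 \<le> n \<Longrightarrow> (\<Sum>k=1..n. 1 / real k) \<le> ln (real n) + 1"
  using euler_mascheroni_sequence_decreasing[of 1 n] by (simp add: harm_def inverse_eq_divide)

context atp_instance
begin

text \<open>
  The service losses of the single periods sum to a harmonic sum, and so do the curvature losses;
  the latter do not occur in the last period.
\<close>

lemma total_step_loss:
  assumes i: "i \<in> types I"
  shows "(\<Sum>t\<in>periods I. step_loss i (periods_left I t)) \<le>
    (\<Sum>j\<in>resources I. rew I i (\<sigma> i j) * (real (j + 1) * M - real j) * (ln (real (horizon I)) + 1))"
proof -
  let ?T = "horizon I" and ?L = "ln (real (horizon I)) + 1"
  have T: "1 \<le> ?T" by (rule horizon_pos)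
  \<comment> \<open>the number of periods to go runs through the same range as the period\<close>
  have rev: "(\<Sum>t\<in>periods I. g (periods_left I t)) = (\<Sum>k=1..?T. g (real k))" for g :: "real \<Rightarrow> real"
    by (rule sum.reindex_bij_witness[of _ "\<lambda>k. ?T + 1 - k" "\<lambda>t. ?T + 1 - t"])
       (auto simp: of_nat_diff diff_add_eq)
  have h1: "(\<Sum>k=1..?T. 1 / real k) \<le> ?L" by (rule harm_le[OF T])
  have "(\<Sum>k=1..?T. 1 / (real k - 1)) = (\<Sum>k=0..<?T. 1 / real k)"
    by (rule sum.reindex_bij_witness[of _ Suc "\<lambda>k. k - 1"]) (auto simp: of_nat_diff)
  also have "\<dots> \<le> (\<Sum>k=0..?T. 1 / real k)" by (intro sum_mono2) auto
  also have "\<dots> = (\<Sum>k=1..?T. 1 / real k)" by (intro sum.mono_neutral_right) auto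
  finally have h2: "(\<Sum>k=1..?T. 1 / (real k - 1)) \<le> ?L" using h1 by simp
  have level: "(\<Sum>k=1..?T. real j * M / real k + (M - 1) / (real k - 1)) \<le> (real j * M + (M - 1)) * ?L" for j
  proof -
    have "(\<Sum>k=1..?T. real j * M / real k + (M - 1) / (real k - 1)) =
        real j * M * (\<Sum>k=1..?T. 1 / real k) + (M - 1) * (\<Sum>k=1..?T. 1 / (real k - 1))"
      by (simp add: sum.distrib sum_distrib_left)
    also have "\<dots> \<le> real j * M * ?L + (M - 1) * ?L"
      using h1 h2 M_gt_1 by (intro add_mono mult_left_mono) auto
    finally show ?thesis by (simp add: distrib_right)
  qed
  have L: "0 \<le> ?L" using T by simp
  have "(\<Sum>t\<in>periods I. step_loss i (periods_left I t)) =
      (\<Sum>j\<in>resources I. weight i j * (\<Sum>k=1..?T. real j * M / real k + (M - 1) / (real k - 1)))"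
    unfolding rev[of "step_loss i"] unfolding step_loss_def sum_distrib_left by (rule sum.swap)
  also have "\<dots> \<le> (\<Sum>j\<in>resources I. weight i j * ((real j * M + (M - 1)) * ?L))"
    using level weight_nonneg[OF i] by (intro sum_mono mult_left_mono) auto
  \<comment> \<open>increments of \<open>j * M + (M - 1)\<close>, prepared for summation by parts back to the rewards\<close>
  also have "\<dots> = (\<Sum>j\<in>resources I. weight i j * (\<Sum>k=1..j. (if k = 1 then 2 * M - 1 else M) * ?L))"
  proof (intro sum.cong refl)
    fix j assume "j \<in> resources I"
    then have "1 \<le> j" by simp
    then have "(\<Sum>k=1..j. (if k = 1 then 2 * M - 1 else M)) = real j * M + (M - 1)"
      by (induction j rule: dec_induct) (auto simp: algebra_simps)
    then show "weight i j * ((real j * M + (M - 1)) * ?L) =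
        weight i j * (\<Sum>k=1..j. (if k = 1 then 2 * M - 1 else M) * ?L)"
      by (simp only: sum_distrib_right[symmetric])
  qed
  also have "\<dots> = (\<Sum>j\<in>resources I. rew I i (\<sigma> i j) * ((if j = 1 then 2 * M - 1 else M) * ?L))"
    by (rule sum_ranks_by_parts[symmetric])
  also have "\<dots> \<le> (\<Sum>j\<in>resources I. rew I i (\<sigma> i j) * ((real (j + 1) * M - real j) * ?L))"
  proof (intro sum_mono mult_left_mono mult_right_mono L)
    fix j assume j: "j \<in> resources I"
    show "0 \<le> rew I i (\<sigma> i j)" by (rule rew_nonneg[OF i order_mem[OF i j]])
    have "0 \<le> real j * (M - 1)" using M_gt_1 by simp
    then show "(if j = 1 then 2 * M - 1 else M) \<le> real (j + 1) * M - real j"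
      by (auto simp: algebra_simps)
  qed
  finally show ?thesis by (simp add: mult.assoc)
qed

text \<open>
  In the last \<open>K_const\<close> periods the thresholds may exceed \<open>wbar\<close>; there the trivial bound of one
  maximal reward per period is used instead of the potential argument.
\<close>

lemma type_regret:
  assumes i: "i \<in> types I"
  shows "sub_lp I i (cs i) 1 \<le> (\<Sum>t\<in>periods I. \<integral>\<omega>. gain i (\<omega> t) (decision t \<omega>) \<partial>sample_space I) +
    (\<Sum>t\<in>periods I. step_loss i (periods_left I t)) +
    max_reward I i * of_int (K_const I \<sigma> cs wbar i)"
proof -
  interpret S: prob_space "sample_space I" by (rule prob_sample_space)
  let ?T = "horizon I" and ?K = "K_const I \<sigma> cs wbar i" and ?r = "max_reward I i"
  let ?E = "\<lambda>t. \<integral>\<omega>. gain i (\<omega> t) (decision t \<omega>) \<partial>sample_space I"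
  have E_nonneg: "0 \<le> ?E t" if "t \<in> periods I" for t
  proof (rule integral_nonneg_AE)
    show "AE \<omega> in sample_space I. 0 \<le> gain i (\<omega> t) (decision t \<omega>)"
      using AE_good_sample
    proof eventually_elim
      case (elim \<omega>)
      then have "good (\<omega> t)" using that by blast
      then show ?case by (rule gain_bounds(1)[OF i])
    qed
  qed
  have loss_nonneg: "0 \<le> step_loss i (periods_left I t)" if "t \<in> periods I" for t
    using that by (intro step_loss_nonneg i) auto
  have r: "0 \<le> ?r" by (rule max_reward_nonneg[OF i])
  have p1: "p i \<le> 1" by (rule pmf_le_1)
  have pP: "0 < p i * P i wbar" using p_pos[OF i] P_wbar_pos[OF i] by simp
  have nn: "0 \<le> budget i (cs i) (num_res I)" by (rule budget_nonneg[OF i cs_nonneg[OF i]]) auto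
  have K_ge: "budget i (cs i) (num_res I) / (p i * P i wbar) \<le> of_int ?K"
    by (simp add: K_const_def budget_def)
  then have budget_K: "budget i (cs i) (num_res I) \<le> of_int ?K * p i * P i wbar"
    using pP by (simp add: pos_divide_le_eq mult.assoc)
  have K0: "0 \<le> ?K" using K_ge nn pP by (smt (verit) divide_nonneg_pos of_int_0_le_iff)
  show ?thesis
  proof (cases "int ?T \<le> ?K")
    case True
    have "sub_lp I i (cs i) 1 \<le> periods_left I 1 * p i * ?r"
      using cs_nonneg[OF i] by (intro sub_lp_le sub_lp_value_le i) auto
    also have "\<dots> \<le> real ?T * 1 * ?r"
      using p1 r by (intro mult_right_mono) (auto simp: mult_left_le)
    also have "\<dots> \<le> of_int ?K * ?r"
      using True r by (intro mult_right_mono) (auto simp: of_int_le_iff[symmetric, of "int ?T", where 'a = real] simp del: of_int_le_iff)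
    finally have "sub_lp I i (cs i) 1 \<le> ?r * of_int ?K" by (simp add: mult.commute)
    moreover have "0 \<le> (\<Sum>t\<in>periods I. ?E t)" "0 \<le> (\<Sum>t\<in>periods I. step_loss i (periods_left I t))"
      using E_nonneg loss_nonneg by (auto intro!: sum_nonneg)
    ultimately show ?thesis by linarith
  next
    case False
    \<comment> \<open>the potential argument covers the first \<open>T - K\<close> periods\<close>
    define s where "s = ?T - nat ?K"
    have s: "s \<le> ?T" and left: "real ?T - real s = of_int ?K"
      using False K0 by (auto simp: s_def of_nat_diff)
    have "of_int ?K * (p i * P i wbar) \<le> real ?T * (p i * P i wbar)"
      using False pP by (intro mult_right_mono) auto
    then have budget_T: "budget i (cs i) (num_res I) \<le> real ?T * p i * P i wbar"
      using budget_K by (simp only: mult.assoc)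
    have "sub_lp I i (cs i) 1 \<le> potential i (periods_left I 1) (cs i)"
      using budget_T cs_nonneg[OF i] horizon_pos by (intro sub_lp_le_potential i) auto
    then have lp: "sub_lp I i (cs i) 1 \<le> potential i (real ?T) (cs i)" by simp
    note tele = expected_gain_telescope[OF i s, unfolded left, OF budget_K]
    have "(\<integral>\<omega>. potential i (of_int ?K) (state (Suc s) \<omega> i) \<partial>sample_space I) \<le> (\<integral>\<omega>. ?r * of_int ?K \<partial>sample_space I)"
    proof (rule integral_mono)
      show "integrable (sample_space I) (\<lambda>\<omega>. potential i (of_int ?K) (state (Suc s) \<omega> i))"
        using K0 s by (intro potential_integrable i) auto
      fix \<omega>
      have "potential i (of_int ?K) (state (Suc s) \<omega> i) \<le> of_int ?K * p i * ?r"
        using K0 by (intro potential_bounds(2) i) auto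
      also have "\<dots> \<le> of_int ?K * 1 * ?r"
        using K0 p1 r by (intro mult_right_mono mult_left_mono) auto
      finally show "potential i (of_int ?K) (state (Suc s) \<omega> i) \<le> ?r * of_int ?K"
        by (simp only: mult_1_right mult.commute)
    qed simp
    then have tail: "(\<integral>\<omega>. potential i (of_int ?K) (state (Suc s) \<omega> i) \<partial>sample_space I) \<le> ?r * of_int ?K"
      using S.prob_space by simp
    have "(\<Sum>t=1..s. ?E t) \<le> (\<Sum>t\<in>periods I. ?E t)"
      using s E_nonneg by (intro sum_mono2) auto
    moreover have "(\<Sum>t=1..s. step_loss i (periods_left I t)) \<le> (\<Sum>t\<in>periods I. step_loss i (periods_left I t))"
      using s loss_nonneg by (intro sum_mono2) auto
    ultimately show ?thesis using lp tele tail by linarith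
  qed
qed

text \<open>Almost surely every served request belongs to exactly one type.\<close>

lemma policy_value_eq:
  "(\<integral>\<omega>. alloc_value I \<omega> (atp1 I \<sigma> cs \<omega>) \<partial>sample_space I) =
    (\<Sum>i\<in>types I. \<Sum>t\<in>periods I. \<integral>\<omega>. gain i (\<omega> t) (decision t \<omega>) \<partial>sample_space I)"
proof -
  have pointwise: "alloc_value I \<omega> (atp1 I \<sigma> cs \<omega>) = (\<Sum>i\<in>types I. \<Sum>t\<in>periods I. gain i (\<omega> t) (decision t \<omega>))"
    if good: "\<forall>t\<in>periods I. good (\<omega> t)" for \<omega>
  proof -
    have "(\<Sum>k\<in>resources I. rew I (fst (\<omega> t)) k * atp1 I \<sigma> cs \<omega> t k) = (\<Sum>i\<in>types I. gain i (\<omega> t) (decision t \<omega>))"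
      if t: "t \<in> periods I" for t
    proof -
      have g: "good (\<omega> t)" using good t by blast
      then have ty: "fst (\<omega> t) \<in> types I" by (simp add: good_def)
      have "(\<Sum>k\<in>resources I. rew I (fst (\<omega> t)) k * atp1 I \<sigma> cs \<omega> t k) =
          (case decision t \<omega> of None \<Rightarrow> 0 | Some k \<Rightarrow> rew I (fst (\<omega> t)) k)"
      proof (cases "decision t \<omega>")
        case None
        then show ?thesis by (simp add: atp1_def)
      next
        case (Some k)
        have "(\<Sum>l\<in>resources I. rew I (fst (\<omega> t)) l * atp1 I \<sigma> cs \<omega> t l) =
            (\<Sum>l\<in>resources I. if l = k then rew I (fst (\<omega> t)) k else 0)"
          using Some by (intro sum.cong) (auto simp: atp1_def)
        then show ?thesis using decision_SomeD(1)[of \<omega> t, OF g Some] Some by simp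
      qed
      also have "\<dots> = (\<Sum>i\<in>types I. gain i (\<omega> t) (decision t \<omega>))"
        using ty by (simp add: gain_def)
      finally show ?thesis .
    qed
    then have "alloc_value I \<omega> (atp1 I \<sigma> cs \<omega>) = (\<Sum>t\<in>periods I. \<Sum>i\<in>types I. gain i (\<omega> t) (decision t \<omega>))"
      unfolding alloc_value_def by (rule sum.cong[OF refl])
    then show ?thesis by (simp only: sum.swap[of _ "types I" "periods I"])
  qed
  have x_meas: "(\<lambda>\<omega>. atp1 I \<sigma> cs \<omega> t k) \<in> borel_measurable (sample_space I)" if "t \<in> periods I" for t k
    unfolding atp1_def by (rule measurable_compose[OF decision_measurable[OF that]]) simp
  have "(\<integral>\<omega>. alloc_value I \<omega> (atp1 I \<sigma> cs \<omega>) \<partial>sample_space I) =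
      (\<integral>\<omega>. (\<Sum>i\<in>types I. \<Sum>t\<in>periods I. gain i (\<omega> t) (decision t \<omega>)) \<partial>sample_space I)"
  proof (rule integral_cong_AE)
    show "(\<lambda>\<omega>. alloc_value I \<omega> (atp1 I \<sigma> cs \<omega>)) \<in> borel_measurable (sample_space I)"
      unfolding alloc_value_def
      by (intro borel_measurable_sum borel_measurable_times type_function_measurable x_meas) auto
    show "(\<lambda>\<omega>. \<Sum>i\<in>types I. \<Sum>t\<in>periods I. gain i (\<omega> t) (decision t \<omega>)) \<in> borel_measurable (sample_space I)"
      by (intro borel_measurable_sum borel_measurable_integrable gain_integrable)
    show "AE \<omega> in sample_space I. alloc_value I \<omega> (atp1 I \<sigma> cs \<omega>) =
        (\<Sum>i\<in>types I. \<Sum>t\<in>periods I. gain i (\<omega> t) (decision t \<omega>))"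
      using AE_good_sample by eventually_elim (rule pointwise)
  qed
  also have "\<dots> = (\<Sum>i\<in>types I. \<integral>\<omega>. (\<Sum>t\<in>periods I. gain i (\<omega> t) (decision t \<omega>)) \<partial>sample_space I)"
    by (rule Bochner_Integration.integral_sum) (rule Bochner_Integration.integrable_sum[OF gain_integrable])
  also have "\<dots> = (\<Sum>i\<in>types I. \<Sum>t\<in>periods I. \<integral>\<omega>. gain i (\<omega> t) (decision t \<omega>) \<partial>sample_space I)"
    by (rule sum.cong[OF refl]) (rule Bochner_Integration.integral_sum[OF gain_integrable])
  finally show ?thesis .
qed

lemma regret_le: "regret I (atp1 I \<sigma> cs) \<le> atp1_bound I \<sigma> cs wbar M"
proof -
  let ?E = "\<lambda>i. \<Sum>t\<in>periods I. \<integral>\<omega>. gain i (\<omega> t) (decision t \<omega>) \<partial>sample_space I"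
  let ?L = "\<lambda>i. \<Sum>j\<in>resources I. rew I i (\<sigma> i j) * (real (j + 1) * M - real j) * (ln (real (horizon I)) + 1)"
  let ?R = "\<lambda>i. max_reward I i * of_int (K_const I \<sigma> cs wbar i)"
  have "(\<Sum>i\<in>types I. sub_lp I i (cs i) 1) \<le> (\<Sum>i\<in>types I. ?E i + ?L i + ?R i)"
  proof (rule sum_mono)
    fix i assume "i \<in> types I"
    then show "sub_lp I i (cs i) 1 \<le> ?E i + ?L i + ?R i"
      using type_regret[of i] total_step_loss[of i] by linarith
  qed
  also have "\<dots> = (\<Sum>i\<in>types I. ?E i) + (\<Sum>i\<in>types I. ?L i) + (\<Sum>i\<in>types I. ?R i)"
    by (simp only: sum.distrib)
  finally show ?thesis
    using prophet_le_sub_lp[OF optimal] unfolding regret_def policy_value_eq atp1_bound_def by linarith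
qed

section \<open>The order of the bound\<close>

lemma types_nonempty: "1 \<in> types I"
  using valid set_pmf_not_empty[of "type_pmf I"] by (auto simp: valid_instance_def)

lemma max_reward_le:
  assumes "bounded_data I wbar R \<kappa>" "i \<in> types I"
  shows "max_reward I i \<le> R"
  using assms num_res_pos by (auto simp: max_reward_def bounded_data_def)

lemma K_const_le:
  assumes bd: "bounded_data I wbar R \<kappa>" and i: "i \<in> types I"
  shows "of_int (K_const I \<sigma> cs wbar i) \<le> \<kappa> + 1"
proof -
  have pP: "0 < p i * P i wbar" using p_pos[OF i] P_wbar_pos[OF i] by simp
  have "cs i j \<le> cap I j" if j: "j \<in> resources I" for j
  proof -
    have "cs i j \<le> (\<Sum>k\<in>types I. cs k j)"
      using i cs_nonneg j by (intro member_le_sum[of i "types I" "\<lambda>k. cs k j"]) auto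
    also have "\<dots> \<le> cap I j"
      using optimal j by (simp add: optimal_split_def feasible_split_def)
    finally show ?thesis .
  qed
  then have "(\<Sum>j\<in>resources I. cs i j / coef I i j) \<le> (\<Sum>j\<in>resources I. cap I j / coef I i j)"
    using coef_pos[OF i] by (intro sum_mono divide_right_mono) (auto intro: less_imp_le)
  then have "budget i (cs i) (num_res I) / (p i * P i wbar) \<le> (\<Sum>j\<in>resources I. cap I j / coef I i j) / (p i * P i wbar)"
    unfolding budget_def sum_by_rank[OF i, of "\<lambda>j. cs i j / coef I i j"]
    using pP by (intro divide_right_mono) auto
  also have "\<dots> \<le> \<kappa>" using bd i by (simp add: bounded_data_def)
  finally show ?thesis
    unfolding K_const_def budget_def[symmetric]
    using of_int_ceiling_le_add_one[of "budget i (cs i) (num_res I) / (p i * P i wbar)"] by linarith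
qed

text \<open>
  Since \<open>ln T \<ge> ln 2\<close>, additive constants are at most \<open>ln T / ln 2\<close> times themselves; a factor
  \<open>num_res I\<close> comes from the sum over the ranks and another one from the coefficient of rank \<open>j\<close>.
\<close>

lemma bound_order:
  assumes bd: "bounded_data I wbar R \<kappa>" and T: "2 \<le> horizon I"
  shows "atp1_bound I \<sigma> cs wbar M \<le>
    (R * (2 * M) * (1 + 1 / ln 2) + R * (\<kappa> + 1) / ln 2) * real (num_types I) * real (num_res I) ^ 2 *
      ln (real (horizon I))"
proof -
  let ?n = "real (num_types I)" and ?m = "real (num_res I)" and ?l = "ln (real (horizon I))"
  have m: "1 \<le> ?m" using num_res_pos by simp
  have m2: "1 \<le> ?m ^ 2" using m by (simp add: one_le_power)
  have ln2: "0 < ln (2 :: real)" by simp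
  have l: "ln 2 \<le> ?l" using T by simp
  then have l1: "1 \<le> ?l / ln 2" using ln2 by (simp add: pos_le_divide_eq)
  have R: "0 \<le> R" using max_reward_le[OF bd types_nonempty] max_reward_nonneg[OF types_nonempty] by simp
  have \<kappa>: "0 \<le> \<kappa>"
  proof -
    have "0 \<le> (\<Sum>j\<in>resources I. cap I j / coef I 1 j) / (p 1 * P 1 wbar)"
      using cap_nonneg coef_pos[OF types_nonempty] p_pos[OF types_nonempty] P_wbar_pos[OF types_nonempty]
      by (intro divide_nonneg_nonneg sum_nonneg mult_nonneg_nonneg) (auto intro: less_imp_le)
    also have "\<dots> \<le> \<kappa>" using bd types_nonempty unfolding bounded_data_def by blast
    finally show ?thesis .
  qed
  have term_le: "rew I i (\<sigma> i j) * (real (j + 1) * M - real j) * (?l + 1) \<le> R * (2 * M * ?m) * (?l * (1 + 1 / ln 2))"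
    if i: "i \<in> types I" and j: "j \<in> resources I" for i j
  proof (intro mult_mono)
    have \<sigma>: "\<sigma> i j \<in> resources I" by (rule order_mem[OF i j])
    show "rew I i (\<sigma> i j) \<le> R" using max_reward_ge[OF \<sigma>, of i] max_reward_le[OF bd i] by simp
    have "real (j + 1) * M \<le> 2 * ?m * M" using j M_gt_1 by (intro mult_right_mono) auto
    then show "real (j + 1) * M - real j \<le> 2 * M * ?m" by (simp add: mult_ac)
    show "?l + 1 \<le> ?l * (1 + 1 / ln 2)" using l1 by (simp add: distrib_left)
    have "0 \<le> real j * (M - 1)" using M_gt_1 by simp
    then show "0 \<le> real (j + 1) * M - real j" using M_gt_1 by (simp add: algebra_simps)
    show "0 \<le> R * (2 * M * ?m)" using R M_gt_1 by simp
    show "0 \<le> ?l + 1" using l ln2 by linarith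
  qed (rule R)
  have "(\<Sum>i\<in>types I. \<Sum>j\<in>resources I. rew I i (\<sigma> i j) * (real (j + 1) * M - real j) * (?l + 1)) \<le>
      (\<Sum>i\<in>types I. \<Sum>j\<in>resources I. R * (2 * M * ?m) * (?l * (1 + 1 / ln 2)))"
    by (intro sum_mono term_le)
  also have "\<dots> = R * (2 * M) * (1 + 1 / ln 2) * ?n * ?m ^ 2 * ?l"
    by (simp add: power2_eq_square)
  finally have first: "(\<Sum>i\<in>types I. \<Sum>j\<in>resources I. rew I i (\<sigma> i j) * (real (j + 1) * M - real j) * (?l + 1)) \<le>
      R * (2 * M) * (1 + 1 / ln 2) * ?n * ?m ^ 2 * ?l" .
  have "max_reward I i * of_int (K_const I \<sigma> cs wbar i) \<le> R * (\<kappa> + 1)" if i: "i \<in> types I" for i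
  proof -
    have "max_reward I i * of_int (K_const I \<sigma> cs wbar i) \<le> max_reward I i * (\<kappa> + 1)"
      using K_const_le[OF bd i] max_reward_nonneg[OF i] by (rule mult_left_mono)
    also have "\<dots> \<le> R * (\<kappa> + 1)"
      using max_reward_le[OF bd i] \<kappa> by (intro mult_right_mono) auto
    finally show ?thesis .
  qed
  then have "(\<Sum>i\<in>types I. max_reward I i * of_int (K_const I \<sigma> cs wbar i)) \<le> (\<Sum>i\<in>types I. R * (\<kappa> + 1))"
    by (rule sum_mono)
  also have "\<dots> = R * (\<kappa> + 1) * ?n * 1" by simp
  also have "\<dots> \<le> R * (\<kappa> + 1) * ?n * (?m ^ 2 * (?l / ln 2))"
    using mult_mono[OF m2 l1] R \<kappa> by (intro mult_left_mono) auto
  also have "\<dots> = R * (\<kappa> + 1) / ln 2 * ?n * ?m ^ 2 * ?l" by simp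
  finally have "(\<Sum>i\<in>types I. max_reward I i * of_int (K_const I \<sigma> cs wbar i)) \<le>
      R * (\<kappa> + 1) / ln 2 * ?n * ?m ^ 2 * ?l" .
  with first show ?thesis
    unfolding atp1_bound_def by (simp only: distrib_right)
qed

end

theorem theorem1:
  shows "(\<forall>I wbar M cs \<sigma>.
            valid_instance I \<and> regular_sizes I wbar \<and> ratio_const I wbar M \<and>
            optimal_split I cs \<and> reward_order I \<sigma> \<longrightarrow>
            regret I (atp1 I \<sigma> cs) \<le> atp1_bound I \<sigma> cs wbar M) \<and>
         (\<forall>R \<kappa> M. \<exists>C. \<forall>I wbar cs \<sigma>.
            valid_instance I \<and> regular_sizes I wbar \<and> ratio_const I wbar M \<and>
            optimal_split I cs \<and> reward_order I \<sigma> \<and> bounded_data I wbar R \<kappa> \<and>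
            2 \<le> horizon I \<longrightarrow>
            atp1_bound I \<sigma> cs wbar M
              \<le> C * real (num_types I) * real (num_res I) ^ 2 * ln (real (horizon I)))"
proof (intro conjI allI impI)
  fix I wbar M cs \<sigma>
  assume "valid_instance I \<and> regular_sizes I wbar \<and> ratio_const I wbar M \<and>
    optimal_split I cs \<and> reward_order I \<sigma>"
  then interpret atp_instance I wbar M cs \<sigma> by unfold_locales auto
  show "regret I (atp1 I \<sigma> cs) \<le> atp1_bound I \<sigma> cs wbar M" by (rule regret_le)
next
  fix R \<kappa> M :: real
  show "\<exists>C. \<forall>I wbar cs \<sigma>.
      valid_instance I \<and> regular_sizes I wbar \<and> ratio_const I wbar M \<and>
      optimal_split I cs \<and> reward_order I \<sigma> \<and> bounded_data I wbar R \<kappa> \<and> 2 \<le> horizon I \<longrightarrow>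
      atp1_bound I \<sigma> cs wbar M \<le> C * real (num_types I) * real (num_res I) ^ 2 * ln (real (horizon I))"
  proof (intro exI[of _ "R * (2 * M) * (1 + 1 / ln 2) + R * (\<kappa> + 1) / ln 2"] allI impI)
    fix I wbar cs \<sigma>
    assume A: "valid_instance I \<and> regular_sizes I wbar \<and> ratio_const I wbar M \<and>
      optimal_split I cs \<and> reward_order I \<sigma> \<and> bounded_data I wbar R \<kappa> \<and> 2 \<le> horizon I"
    then interpret atp_instance I wbar M cs \<sigma> by unfold_locales auto
    show "atp1_bound I \<sigma> cs wbar M \<le>
        (R * (2 * M) * (1 + 1 / ln 2) + R * (\<kappa> + 1) / ln 2) * real (num_types I) * real (num_res I) ^ 2 *
          ln (real (horizon I))"
      using A by (intro bound_order) auto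
  qed
qed

end
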